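(* Let $X$ and $Y$ be rational functions with complex coefficients, of degree at least two, satisfying $\mathbb{C}(X,Y)=\mathbb{C}(z)$. Assume that $X$ is a Galois covering. Then the equality $$[\mathbb{C}(z):\mathbb{C}(X)\cap\mathbb{C}(Y)]=\deg X\cdot\deg Y$$ holds if and only if $Y$ admits a factorization $Y=U\circ V$, where $V$ is a $G_X$-equivariant rational function and $U$ is a rational Galois covering such that the group $\langle G_X,G_U\rangle$ is finite of order $\deg X\cdot\deg U$, with $G_X\cap G_U=\{e\}$.
   Context: Rational functions are viewed as holomorphic maps $\mathbb{CP}^1\to\mathbb{CP}^1$. For a non-constant rational function $F$, $G_F=\{\mu\in\mathrm{Aut}(\mathbb{CP}^1) : F\circ\mu=F\}$ is its deck transformation group (a finite group of Möbius transformations). $F$ is called a Galois covering if $G_F$ acts transitively on the fibers of $F$, equivalently if $|G_F|=\deg F$ (functions of degree one are allowed). A rational function $V$ is called $G_X$-equivariant if there exists a group automorphism $\varphi:G_X\to G_X$ such that $V\circ\mu=\varphi(\mu)\circ V$ for all $\mu\in G_X$. $\langle G_X,G_U\rangle$ is the subgroup of $\mathrm{Aut}(\mathbb{CP}^1)$ generated by $G_X$ and $G_U$. *)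

theory Defs
  imports
    "HOL-Algebra.Algebraic_Closure_Type"
    "HOL-Algebra.Embedded_Algebras"
    "HOL-Algebra.Generated_Fields"
    "HOL-Algebra.Generated_Groups"
begin

section \<open>The field of rational functions\<close>

type_synonym ratfun = "complex poly fract"

text \<open>\<^const>\<open>quot_of_fract\<close> is the representation in lowest terms with monic denominator.\<close>

definition numer :: "ratfun \<Rightarrow> complex poly" where
  "numer F = fst (quot_of_fract F)"

definition denom :: "ratfun \<Rightarrow> complex poly" where
  "denom F = snd (quot_of_fract F)"

definition rat_degree :: "ratfun \<Rightarrow> nat" where
  "rat_degree F = max (Polynomial.degree (numer F)) (Polynomial.degree (denom F))"

definition const_ratfun :: "complex \<Rightarrow> ratfun" where
  "const_ratfun c = to_fract [:c:]"

abbreviation ratfun_field :: "ratfun ring" where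
  "ratfun_field \<equiv> ring_of_type_algebra"

text \<open>The subfield of \<open>\<complex>(z)\<close> generated by \<open>S\<close> over \<open>\<complex>\<close>; thus \<open>\<complex>(X)\<close> is
  \<open>adjoin {X}\<close> and \<open>\<complex>(X, Y)\<close> is \<open>adjoin {X, Y}\<close>.\<close>

definition adjoin :: "ratfun set \<Rightarrow> ratfun set" where
  "adjoin S = generate_field ratfun_field (range const_ratfun \<union> S)"

section \<open>Rational functions as maps of the Riemann sphere\<close>

datatype sphere = Fin complex | Infty

text \<open>Numerator and denominator have no common zero, so a zero of the denominator is a pole.
  The value at infinity is the limit there; if the numerator has smaller degree than the
  denominator, the coefficient taken from it is \<open>0\<close>.\<close>

fun rat_map :: "ratfun \<Rightarrow> sphere \<Rightarrow> sphere" where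
  "rat_map F (Fin z) =
     (if poly (denom F) z = 0 then Infty else Fin (poly (numer F) z / poly (denom F) z))"
| "rat_map F Infty =
     (let n = Polynomial.degree (denom F) in
      if Polynomial.degree (numer F) > n then Infty
      else Fin (Polynomial.coeff (numer F) n / Polynomial.coeff (denom F) n))"

fun moebius :: "complex \<Rightarrow> complex \<Rightarrow> complex \<Rightarrow> complex \<Rightarrow> sphere \<Rightarrow> sphere" where
  "moebius a b c d (Fin z) = (if c * z + d = 0 then Infty else Fin ((a * z + b) / (c * z + d)))"
| "moebius a b c d Infty = (if c = 0 then Infty else Fin (a / c))"

definition aut_sphere :: "(sphere \<Rightarrow> sphere) monoid" where
  "aut_sphere = \<lparr>carrier = {moebius a b c d | a b c d. a * d - b * c \<noteq> 0},
                 monoid.mult = (\<circ>), one = id\<rparr>"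

section \<open>Deck transformations, Galois coverings, equivariance\<close>

definition deck_group :: "ratfun \<Rightarrow> (sphere \<Rightarrow> sphere) set" where
  "deck_group F = {\<sigma> \<in> carrier aut_sphere. rat_map F \<circ> \<sigma> = rat_map F}"

definition galois_covering :: "ratfun \<Rightarrow> bool" where
  "galois_covering F \<longleftrightarrow> rat_degree F > 0 \<and>
     (\<forall>x y. rat_map F x = rat_map F y \<longrightarrow> (\<exists>\<sigma>\<in>deck_group F. \<sigma> x = y))"

definition deck_equivariant :: "ratfun \<Rightarrow> ratfun \<Rightarrow> bool" where
  "deck_equivariant F V \<longleftrightarrow>
     (\<exists>h\<in>iso (aut_sphere\<lparr>carrier := deck_group F\<rparr>) (aut_sphere\<lparr>carrier := deck_group F\<rparr>).
        \<forall>\<sigma>\<in>deck_group F. rat_map V \<circ> \<sigma> = h \<sigma> \<circ> rat_map V)"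

section \<open>Consistency of the definitions\<close>

lemma moebius_comp:
  assumes "a' * d' - b' * c' \<noteq> 0"
  shows "moebius a b c d \<circ> moebius a' b' c' d' =
         moebius (a * a' + b * c') (a * b' + b * d') (c * a' + d * c') (c * b' + d * d')"
proof -
  have fin: "moebius a b c d (if p = 0 then Infty else Fin (q / p)) =
        (if c * q + d * p = 0 then Infty else Fin ((a * q + b * p) / (c * q + d * p)))"
    if "p \<noteq> 0 \<or> q \<noteq> 0" for p q
  proof (cases "p = 0")
    case True
    then show ?thesis using that by (cases "c = 0") auto
  next
    case False
    have num: "a * (q / p) + b = (a * q + b * p) / p"
      and den: "c * (q / p) + d = (c * q + d * p) / p"
      using False by (simp_all add: add_divide_distrib)
    have cancel: "(if t / p = 0 then Infty else Fin (s / p / (t / p))) =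
        (if t = 0 then Infty else Fin (s / t))" for s t
      using False by simp
    have "moebius a b c d (Fin (q / p)) =
        (if c * q + d * p = 0 then Infty else Fin ((a * q + b * p) / (c * q + d * p)))"
      unfolding moebius.simps num den by (rule cancel)
    then show ?thesis using False by (simp only: if_False)
  qed
  show ?thesis
  proof
    fix x show "(moebius a b c d \<circ> moebius a' b' c' d') x =
         moebius (a * a' + b * c') (a * b' + b * d') (c * a' + d * c') (c * b' + d * d') x"
    proof (cases x)
      case (Fin z)
      have "c' * z + d' \<noteq> 0 \<or> a' * z + b' \<noteq> 0"
      proof (rule ccontr)
        assume "\<not> ?thesis"
        then have "d' = - (c' * z)" "b' = - (a' * z)"
          by (simp_all add: add_eq_0_iff)
        then have "a' * d' - b' * c' = 0" by (simp only:) simp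
        then show False using assms by simp
      qed
      note fin[OF this]
      moreover have "c * (a' * z + b') + d * (c' * z + d') = (c * a' + d * c') * z + (c * b' + d * d')"
        "a * (a' * z + b') + b * (c' * z + d') = (a * a' + b * c') * z + (a * b' + b * d')"
        by (simp_all add: algebra_simps)
      ultimately show ?thesis
        using Fin by (simp only: comp_apply moebius.simps)
    next
      case Infty
      have "c' \<noteq> 0 \<or> a' \<noteq> 0" using assms by auto
      from fin[OF this] show ?thesis using Infty by simp
    qed
  qed
qed

lemma moebius_id: "a \<noteq> 0 \<Longrightarrow> moebius a 0 0 a = id"
proof
  fix x assume "a \<noteq> 0"
  then show "moebius a 0 0 a x = id x" by (cases x) auto
qed

lemma mem_aut_sphere:
  "f \<in> carrier aut_sphere \<longleftrightarrow> (\<exists>a b c d. f = moebius a b c d \<and> a * d - b * c \<noteq> 0)"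
  by (auto simp: aut_sphere_def)

lemma aut_sphere_inverse:
  assumes "f \<in> carrier aut_sphere"
  obtains g where "g \<in> carrier aut_sphere" "g \<circ> f = id" "f \<circ> g = id"
proof -
  obtain a b c d where f: "f = moebius a b c d" and det: "a * d - b * c \<noteq> 0"
    using assms by (auto simp: mem_aut_sphere)
  have det': "d * a - (- b) * (- c) \<noteq> 0" using det by (simp add: mult.commute)
  have "moebius d (- b) (- c) a \<circ> f = moebius (a * d - b * c) 0 0 (a * d - b * c)"
    unfolding f moebius_comp[OF det] by (simp add: algebra_simps)
  moreover have "f \<circ> moebius d (- b) (- c) a = moebius (a * d - b * c) 0 0 (a * d - b * c)"
    unfolding f moebius_comp[OF det'] by (simp add: algebra_simps)
  ultimately show thesis
    using that[of "moebius d (- b) (- c) a"] det det' moebius_id[OF det]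
    unfolding mem_aut_sphere by metis
qed

lemma group_aut_sphere: "group aut_sphere"
proof (rule groupI)
  fix f g assume "f \<in> carrier aut_sphere" "g \<in> carrier aut_sphere"
  then obtain a b c d a' b' c' d' where
    f: "f = moebius a b c d" "a * d - b * c \<noteq> 0" and
    g: "g = moebius a' b' c' d'" "a' * d' - b' * c' \<noteq> 0"
    unfolding mem_aut_sphere by blast
  have "(a * a' + b * c') * (c * b' + d * d') - (a * b' + b * d') * (c * a' + d * c')
      = (a * d - b * c) * (a' * d' - b' * c')"
    by (simp add: algebra_simps)
  then have "(a * a' + b * c') * (c * b' + d * d') - (a * b' + b * d') * (c * a' + d * c') \<noteq> 0"
    using f g by simp
  moreover have "f \<otimes>\<^bsub>aut_sphere\<^esub> g = f \<circ> g" by (simp add: aut_sphere_def)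
  ultimately show "f \<otimes>\<^bsub>aut_sphere\<^esub> g \<in> carrier aut_sphere"
    unfolding mem_aut_sphere using f g moebius_comp[OF g(2)] by metis
next
  have "moebius 1 0 0 1 \<in> carrier aut_sphere"
    unfolding mem_aut_sphere by (intro exI[of _ 1] exI[of _ 0] conjI) auto
  then show "\<one>\<^bsub>aut_sphere\<^esub> \<in> carrier aut_sphere"
    by (simp add: moebius_id) (simp add: aut_sphere_def)
next
  fix f assume "f \<in> carrier aut_sphere"
  then obtain g where "g \<in> carrier aut_sphere" "g \<circ> f = id"
    by (rule aut_sphere_inverse)
  then show "\<exists>g\<in>carrier aut_sphere. g \<otimes>\<^bsub>aut_sphere\<^esub> f = \<one>\<^bsub>aut_sphere\<^esub>"
    by (intro bexI[of _ g]) (auto simp: aut_sphere_def)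
qed (auto simp: aut_sphere_def)

lemma subgroup_deck_group: "subgroup (deck_group F) aut_sphere"
proof -
  interpret group aut_sphere by (rule group_aut_sphere)
  have comp: "f \<otimes>\<^bsub>aut_sphere\<^esub> g = f \<circ> g" and one: "\<one>\<^bsub>aut_sphere\<^esub> = id" for f g
    by (simp_all add: aut_sphere_def)
  show ?thesis
  proof (rule subgroupI)
    show "deck_group F \<noteq> {}"
      using one_closed by (auto simp: deck_group_def one)
  next
    fix f assume f: "f \<in> deck_group F"
    then have fc: "f \<in> carrier aut_sphere" and inv: "rat_map F \<circ> f = rat_map F"
      by (auto simp: deck_group_def)
    have "f \<circ> inv\<^bsub>aut_sphere\<^esub> f = id"
      using r_inv[OF fc] by (simp add: comp one)
    then have "rat_map F \<circ> inv\<^bsub>aut_sphere\<^esub> f = rat_map F"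
      by (metis inv comp_assoc comp_id)
    then show "inv\<^bsub>aut_sphere\<^esub> f \<in> deck_group F"
      using fc by (simp add: deck_group_def)
  next
    fix f g assume "f \<in> deck_group F" "g \<in> deck_group F"
    then show "f \<otimes>\<^bsub>aut_sphere\<^esub> g \<in> deck_group F"
      using m_closed[of f g] by (auto simp: deck_group_def comp comp_assoc[symmetric])
  qed (auto simp: deck_group_def)
qed

lemma denom_nonzero: "denom F \<noteq> 0"
  by (simp add: denom_def)

lemma coprime_numer_denom: "coprime (numer F) (denom F)"
  by (simp add: numer_def denom_def coprime_quot_of_fract)

lemma Fract_numer_denom: "Fraction_Field.Fract (numer F) (denom F) = F"
  using quot_to_fract_quot_of_fract[of F]
  by (simp add: quot_to_fract_def numer_def denom_def case_prod_unfold)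

lemma numer_denom_Fract:
  assumes "coprime p q" "q \<noteq> 0"
  obtains k where "k \<noteq> 0" "numer (Fraction_Field.Fract p q) = Polynomial.smult k p"
    "denom (Fraction_Field.Fract p q) = Polynomial.smult k q"
proof -
  define F where "F = Fraction_Field.Fract p q"
  have "Fraction_Field.Fract p q = Fraction_Field.Fract (numer F) (denom F)"
    by (simp only: Fract_numer_denom) (simp add: F_def)
  then have eq: "p * denom F = numer F * q"
    using assms(2) denom_nonzero[of F] by (simp add: eq_fract)
  have "denom F dvd q * numer F"
    using eq by (metis dvd_triv_right mult.commute)
  then have "denom F dvd q"
    using coprime_numer_denom[of F] by (metis coprime_commute coprime_dvd_mult_left_iff)
  moreover have "q dvd p * denom F" using eq by simp
  then have "q dvd denom F"
    using assms(1) by (metis coprime_commute coprime_dvd_mult_right_iff)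
  ultimately obtain u w where u: "denom F = q * u" and w: "q = denom F * w"
    by (metis dvdE)
  have "u * w = 1" using u w assms(2)
    by (metis mult.assoc mult_cancel_left mult.right_neutral)
  then obtain k where k: "u = [:k:]" "k dvd 1"
    by (metis dvdI is_unit_poly_iff)
  have "q * (p * u) = q * numer F" using eq u by (simp add: ac_simps)
  then have "numer F = p * u" using assms(2) by simp
  then have "numer F = Polynomial.smult k p" "denom F = Polynomial.smult k q"
    using u k(1) by simp_all
  moreover have "k \<noteq> 0" using k(2) by auto
  ultimately show thesis
    using that unfolding F_def by blast
qed

lemma rat_map_degree_one:
  assumes "numer F = [:b, a:]" "denom F = [:d, c:]" "a \<noteq> 0 \<or> c \<noteq> 0"
  shows "rat_map F = moebius a b c d"
proof
  fix x show "rat_map F x = moebius a b c d x"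
    using assms by (cases x) (auto simp: algebra_simps)
qed

lemma moebius_scale: "k \<noteq> 0 \<Longrightarrow> moebius (k * a) (k * b) (k * c) (k * d) = moebius a b c d"
proof
  fix x assume k: "k \<noteq> 0"
  have "k * c * z + k * d = k * (c * z + d)" "k * a * z + k * b = k * (a * z + b)" for z
    by (simp_all add: algebra_simps)
  then show "moebius (k * a) (k * b) (k * c) (k * d) x = moebius a b c d x"
    using k by (cases x) simp_all
qed

text \<open>The automorphisms of the sphere are exactly the rational maps of degree one.\<close>

lemma carrier_aut_sphere_eq: "carrier aut_sphere = rat_map ` {F. rat_degree F = 1}"
proof (intro equalityI subsetI)
  fix f assume "f \<in> carrier aut_sphere"
  then obtain a b c d where f: "f = moebius a b c d" and det: "a * d - b * c \<noteq> 0"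
    unfolding mem_aut_sphere by blast
  have "coprime [:b, a:] [:d, c:]"
  proof (rule coprimeI)
    fix r assume "r dvd [:b, a:]" "r dvd [:d, c:]"
    then have "r dvd Polynomial.smult a [:d, c:] - Polynomial.smult c [:b, a:]"
      by (intro dvd_diff dvd_smult)
    also have "\<dots> = [:a * d - b * c:]" by simp
    finally show "is_unit r"
      using det by (meson dvd_trans is_unit_pCons_iff)
  qed
  moreover have ne: "[:d, c:] \<noteq> 0" using det by auto
  ultimately obtain k where k: "k \<noteq> 0"
    "numer (Fraction_Field.Fract [:b, a:] [:d, c:]) = [:k * b, k * a:]"
    "denom (Fraction_Field.Fract [:b, a:] [:d, c:]) = [:k * d, k * c:]"
    by (rule numer_denom_Fract) auto
  have ac: "a \<noteq> 0 \<or> c \<noteq> 0" using det by auto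
  have "rat_map (Fraction_Field.Fract [:b, a:] [:d, c:]) = f"
    unfolding f using rat_map_degree_one[OF k(2,3)] k(1) ac by (simp add: moebius_scale)
  moreover have "rat_degree (Fraction_Field.Fract [:b, a:] [:d, c:]) = 1"
    using k ac by (auto simp: rat_degree_def)
  ultimately show "f \<in> rat_map ` {F. rat_degree F = 1}" by blast
next
  fix f assume "f \<in> rat_map ` {F. rat_degree F = 1}"
  then obtain F where f: "f = rat_map F" and deg: "rat_degree F = 1" by blast
  have lin: "\<exists>u v. p = [:v, u:]" if "Polynomial.degree p \<le> 1" for p :: "complex poly"
  proof (intro exI poly_eqI)
    fix n
    have "Polynomial.coeff p n = 0" if "n > 1"
      using that \<open>Polynomial.degree p \<le> 1\<close> by (intro coeff_eq_0) simp
    then show "Polynomial.coeff p n =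
        Polynomial.coeff [:Polynomial.coeff p 0, Polynomial.coeff p 1:] n"
      by (auto simp: coeff_pCons split: nat.split)
  qed
  have "Polynomial.degree (numer F) \<le> 1" "Polynomial.degree (denom F) \<le> 1"
    using deg by (auto simp: rat_degree_def)
  then obtain a b c d where nd: "numer F = [:b, a:]" "denom F = [:d, c:]"
    using lin by metis
  have ac: "a \<noteq> 0 \<or> c \<noteq> 0"
    using deg by (auto simp: rat_degree_def nd)
  have "a * d - b * c \<noteq> 0"
  proof
    assume "a * d - b * c = 0"
    then have eq: "Polynomial.smult a (denom F) = Polynomial.smult c (numer F)"
      by (simp add: nd mult.commute)
    have "c \<noteq> 0"
      using eq ac denom_nonzero[of F] by auto
    then have "denom F dvd numer F"
      using eq by (metis dvd_refl dvd_smult dvd_smult_iff)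
    then have "is_unit (denom F)"
      using coprime_numer_denom[of F] by (metis coprime_common_divisor dvd_refl)
    then show False using \<open>c \<noteq> 0\<close> by (simp add: nd is_unit_pCons_iff)
  qed
  then show "f \<in> carrier aut_sphere"
    unfolding f mem_aut_sphere using rat_map_degree_one[OF nd ac] by blast
qed

end

theory Submission
  imports Defs
begin

text \<open>
  By Lueroth's theorem the degree condition says that some rational function can be written both as
  \<open>W = A \<circ> X\<close> and as \<open>W = B \<circ> Y\<close> with \<open>deg B = deg X\<close>. In that case the functions
  \<open>Y \<circ> \<sigma>\<close>, \<open>\<sigma> \<in> G\<^sub>X\<close>, are all the solutions \<open>t\<close> of \<open>B(t) = W\<close>, so they generate the normal
  closure \<open>\<complex>(V)\<close> of \<open>\<complex>(Y)\<close> over \<open>\<complex>(W)\<close>, and \<open>V \<circ> \<sigma> = \<phi>(\<sigma>) \<circ> V\<close> for an injective homomorphism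
  \<open>\<phi>\<close> into the Moebius group. Writing \<open>Y = U \<circ> V\<close>, the covering \<open>B \<circ> U\<close> is Galois and \<open>\<phi>(G\<^sub>X)\<close> is a
  complement of \<open>G\<^sub>U\<close> in its deck group. Isomorphic finite groups of Moebius transformations
  are conjugate, so after a change of coordinate \<open>\<phi>(G\<^sub>X) = G\<^sub>X\<close>. Conversely, the quotient
  map \<open>T\<close> by \<open>\<langle>G\<^sub>X, G\<^sub>U\<rangle>\<close> factors through \<open>U\<close>, and \<open>W = T \<circ> V\<close> is invariant under \<open>G\<^sub>X\<close>.
\<close>

text \<open>Equivariance asks for an automorphism of G_X itself, whereas the normal closure only
  yields an embedding \<phi> of G_X as some other subgroup of the Moebius group. That copy must be
  moved onto G_X by a change of coordinate, which is why finite Moebius groups are classified up to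
  conjugacy. Two numbers decide the class: the order of the group and the largest order of a point
  stabiliser. Both are invariant under isomorphism.

  That all conjugates of Y lie in C(z) is a count: B(t) = W has at most deg B = deg X solutions, and
  the deg X functions Y o \<sigma> are pairwise distinct because C(X, Y) = C(z). To speak of
  solutions possibly outside C(z), substitution is set up with values in any field containing the
  constants, in particular in the algebraic closure of C(z).

  Galois coverings are handled through the equality of the degree with the order of the deck group,
  the deck transformations of F being the roots in C(z) of one polynomial of degree deg F over
  C(F).\<close>

hide_const (open) Polynomials.degree Polynomials.lead_coeff Rat.Fract up_ring.coeff up_ring.monom module.smult

section \<open>Substitution into rational functions\<close>

lemma ratfun_Fract_cases:
  obtains p q where "F = Fract p q" "coprime p q" "q \<noteq> 0" "p = numer F" "q = denom F"
  using Fract_numer_denom coprime_numer_denom denom_nonzero by metis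

lemma const_ratfun_simps [simp]:
  "const_ratfun 0 = 0" "const_ratfun 1 = 1"
  "const_ratfun (a + b) = const_ratfun a + const_ratfun b"
  "const_ratfun (a * b) = const_ratfun a * const_ratfun b"
  "const_ratfun (- a) = - const_ratfun a"
  "const_ratfun (a - b) = const_ratfun a - const_ratfun b"
  by (auto simp: const_ratfun_def simp flip: to_fract_add to_fract_mult to_fract_uminus to_fract_diff)
     (simp flip: one_pCons)

lemma const_ratfun_eq_iff [simp]: "const_ratfun a = const_ratfun b \<longleftrightarrow> a = b"
  by (simp add: const_ratfun_def)

lemma numer_const [simp]: "numer (const_ratfun c) = [:c:]"
  and denom_const [simp]: "denom (const_ratfun c) = 1"
  by (simp_all add: numer_def denom_def const_ratfun_def)

lemma rat_degree_eq_0_iff: "rat_degree F = 0 \<longleftrightarrow> F \<in> range const_ratfun"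
proof
  assume "rat_degree F = 0"
  then obtain a b where ab: "numer F = [:a:]" "denom F = [:b:]"
    unfolding rat_degree_def by (metis degree_eq_zeroE max_nat.eq_neutr_iff)
  with denom_nonzero[of F] have "b \<noteq> 0" by auto
  then have "F = const_ratfun (a / b)"
    using Fract_numer_denom[of F] ab unfolding const_ratfun_def to_fract_def
    by (auto simp: eq_fract)
  then show "F \<in> range const_ratfun" by blast
qed (auto simp: rat_degree_def)

definition ratvar :: ratfun where "ratvar = to_fract [:0, 1:]"

lemma numer_ratvar [simp]: "numer ratvar = [:0, 1:]"
  and denom_ratvar [simp]: "denom ratvar = 1"
  by (simp_all add: numer_def denom_def ratvar_def)

lemma rat_degree_ratvar [simp]: "rat_degree ratvar = 1"
  by (simp add: rat_degree_def)

lemma ratvar_not_const [simp]: "ratvar \<notin> range const_ratfun"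
  using rat_degree_eq_0_iff[of ratvar] by simp

lemma poly_const_ratvar: "poly (map_poly const_ratfun p) ratvar = to_fract p"
  by (induction p) (simp_all add: map_poly_pCons const_ratfun_def ratvar_def flip: to_fract_add to_fract_mult)

text \<open>A complex embedding into a field, used both for \<open>\<complex>(z)\<close> itself (where evaluation is
  substitution) and for the algebraic closure of \<open>\<complex>(z)\<close>.\<close>

locale complex_embedding =
  fixes emb :: "complex \<Rightarrow> 'k :: field"
  assumes emb_0 [simp]: "emb 0 = 0" and emb_1 [simp]: "emb 1 = 1"
    and emb_add [simp]: "emb (a + b) = emb a + emb b"
    and emb_mult [simp]: "emb (a * b) = emb a * emb b"
begin

definition pev :: "'k \<Rightarrow> complex poly \<Rightarrow> 'k" where
  "pev t p = poly (map_poly emb p) t"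

text \<open>A homomorphism in F only when t is not a constant: at t = emb a the denominator may
  vanish, and the quotient is then 0 by convention. Hence the recurring assumption
  \<open>t \<notin> range emb\<close>.\<close>

definition ev :: "'k \<Rightarrow> ratfun \<Rightarrow> 'k" where
  "ev t F = pev t (numer F) / pev t (denom F)"

lemma emb_uminus [simp]: "emb (- a) = - emb a"
  by (metis add.right_inverse add_eq_0_iff emb_0 emb_add)

lemma emb_eq_0_iff [simp]: "emb a = 0 \<longleftrightarrow> a = 0"
proof -
  have "emb a * emb (inverse a) = 1" if "a \<noteq> 0"
    using that emb_mult[of a "inverse a"] by (simp del: emb_mult)
  then show ?thesis by (metis emb_0 mult_zero_left zero_neq_one)
qed

lemma pev_0 [simp]: "pev t 0 = 0" and pev_1 [simp]: "pev t 1 = 1"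
  by (simp_all add: pev_def)

lemma pev_pCons [simp]: "pev t (pCons a p) = emb a + t * pev t p"
  by (simp add: pev_def map_poly_pCons)

lemma pev_add [simp]: "pev t (p + q) = pev t p + pev t q"
proof (induction p q rule: poly_induct2)
  case (pCons a p b q)
  then show ?case by (simp add: algebra_simps)
qed simp

lemma pev_smult [simp]: "pev t (smult a p) = emb a * pev t p"
  by (induction p) (simp_all add: algebra_simps)

lemma pev_mult [simp]: "pev t (p * q) = pev t p * pev t q"
  by (induction p) (simp_all add: algebra_simps)

lemma pev_altdef: "pev t p = (\<Sum>i\<le>degree p. emb (coeff p i) * t ^ i)"
proof -
  have "degree (map_poly emb p) = degree p"
    by (rule degree_map_poly) auto
  then show ?thesis by (simp add: pev_def poly_altdef coeff_map_poly)
qed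

text \<open>Complex polynomials split into factors z - a, and t - emb a is nonzero for every a.
  Being non-constant thus does the work of being transcendental over the constants.\<close>

lemma pev_nonzero:
  assumes "t \<notin> range emb" "p \<noteq> 0"
  shows "pev t p \<noteq> 0"
  using assms(2)
proof (induction "degree p" arbitrary: p)
  case 0
  then obtain a where "p = [:a:]" "a \<noteq> 0" by (metis degree_eq_zeroE pCons_0_0)
  then show ?case by simp
next
  case (Suc n)
  then have "\<exists>a. poly p a = 0"
    by (intro alg_closed_imp_poly_has_root) simp
  then obtain a q where p: "p = [:- a, 1:] * q"
    by (metis dvdE poly_eq_0_iff_dvd)
  then have "q \<noteq> 0" using Suc by auto
  moreover have "degree p = Suc (degree q)"
    using \<open>q \<noteq> 0\<close> by (simp add: p degree_mult_eq del: mult_pCons_left)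
  ultimately have "pev t q \<noteq> 0" using Suc by auto
  moreover have "t \<noteq> emb a" using assms(1) by auto
  ultimately show ?case by (simp add: p del: mult_pCons_left)
qed

context
  fixes t assumes t: "t \<notin> range emb"
begin

lemma ev_Fract:
  assumes "q \<noteq> 0"
  shows "ev t (Fract p q) = pev t p / pev t q"
proof -
  define F where "F = Fract p q"
  have "Fract p q = Fract (numer F) (denom F)"
    by (simp add: Fract_numer_denom F_def)
  then have "p * denom F = numer F * q"
    using assms denom_nonzero[of F] by (simp add: eq_fract)
  then have "pev t p * pev t (denom F) = pev t (numer F) * pev t q"
    by (metis pev_mult)
  then show ?thesis
    using pev_nonzero[OF t assms] pev_nonzero[OF t denom_nonzero[of F]]
    by (simp add: ev_def F_def[symmetric] field_simps)
qed

lemma ev_add [simp]: "ev t (F + G) = ev t F + ev t G"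
proof -
  obtain p q p' q' where F: "F = Fract p q" "q \<noteq> 0" and G: "G = Fract p' q'" "q' \<noteq> 0"
    by (metis ratfun_Fract_cases)
  then show ?thesis
    using pev_nonzero[OF t G(2)] pev_nonzero[OF t F(2)]
    by (simp add: ev_Fract divide_simps)
qed

lemma ev_mult [simp]: "ev t (F * G) = ev t F * ev t G"
proof -
  obtain p q p' q' where F: "F = Fract p q" "q \<noteq> 0" and G: "G = Fract p' q'" "q' \<noteq> 0"
    by (metis ratfun_Fract_cases)
  then show ?thesis
    using pev_nonzero[OF t G(2)] pev_nonzero[OF t F(2)]
    by (simp add: ev_Fract divide_simps)
qed

lemma ev_const [simp]: "ev t (const_ratfun c) = emb c"
  by (simp add: ev_def)

lemma ev_0 [simp]: "ev t 0 = 0" and ev_1 [simp]: "ev t 1 = 1"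
  using ev_const[of 0] ev_const[of 1] by simp_all

lemma ev_to_fract [simp]: "ev t (to_fract p) = pev t p"
  using ev_Fract[of 1 p] by (simp add: to_fract_def)

lemma ev_ratvar [simp]: "ev t ratvar = t"
  by (simp add: ev_def)

lemma ev_uminus [simp]: "ev t (- F) = - ev t F"
  by (metis add.right_inverse add_eq_0_iff ev_0 ev_add)

lemma ev_diff [simp]: "ev t (F - G) = ev t F - ev t G"
  using ev_add[of F "- G"] by simp

lemma ev_inverse [simp]: "ev t (inverse F) = inverse (ev t F)"
proof (cases "F = 0")
  case False
  then have "ev t F * ev t (inverse F) = 1" by (simp flip: ev_mult)
  then show ?thesis by (metis inverse_unique)
qed simp

lemma ev_eq_0_iff [simp]: "ev t F = 0 \<longleftrightarrow> F = 0"
  by (metis ev_0 ev_1 ev_inverse ev_mult mult_zero_left right_inverse zero_neq_one)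

lemma ev_eq_iff [simp]: "ev t F = ev t G \<longleftrightarrow> F = G"
  using ev_eq_0_iff[of "F - G"] by simp

lemma ev_not_emb:
  assumes "F \<notin> range const_ratfun"
  shows "ev t F \<notin> range emb"
proof
  assume "ev t F \<in> range emb"
  then obtain c where "ev t F = ev t (const_ratfun c)" by auto
  then show False using assms by (simp only: ev_eq_iff) auto
qed

end

end

interpretation ratfun: complex_embedding const_ratfun
  by standard simp_all

abbreviation ratcomp :: "ratfun \<Rightarrow> ratfun \<Rightarrow> ratfun" (infixl "\<odot>" 75) where
  "F \<odot> V \<equiv> ratfun.ev V F"

lemma ratcomp_ratvar [simp]: "F \<odot> ratvar = F"
  by (metis Fract_conv_to_fract Fract_numer_denom poly_const_ratvar ratfun.ev_def ratfun.pev_def)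

lemma ratcomp_not_const:
  assumes "V \<notin> range const_ratfun" "F \<notin> range const_ratfun"
  shows "F \<odot> V \<notin> range const_ratfun"
  using assms by (rule ratfun.ev_not_emb)

text \<open>Rational functions are quotients of polynomials in z, so a homomorphism with given
  values on the constants is determined by the image of z. Associativity of substitution and its
  compatibility with \<open>to_ac\<close> both follow from this.\<close>

lemma (in complex_embedding) ev_unique:
  assumes h: "\<And>F G. h (F + G) = h F + h G" "\<And>F G. h (F * G) = h F * h G"
      "\<And>F. h (inverse F) = inverse (h F)"
    and hc: "\<And>c. h (const_ratfun c) = emb c"
    and t: "h ratvar \<notin> range emb"
  shows "h F = ev (h ratvar) F"
proof -
  have p: "h (to_fract p) = pev (h ratvar) p" for p
  proof (induction p)
    case (pCons a p)
    have "to_fract (pCons a p) = const_ratfun a + ratvar * to_fract p"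
      by (simp add: const_ratfun_def ratvar_def flip: to_fract_add to_fract_mult)
    then show ?case using pCons by (simp add: h hc)
  qed (use hc[of 0] in simp)
  obtain p q where F: "F = Fract p q" "q \<noteq> 0" by (metis ratfun_Fract_cases)
  then have "F = to_fract p * inverse (to_fract q)"
    by (simp add: Fract_conv_to_fract divide_inverse)
  then show ?thesis using t by (simp add: h p)
qed

lemma (in complex_embedding) ev_ratcomp:
  assumes "t \<notin> range emb" "V \<notin> range const_ratfun"
  shows "ev t (F \<odot> V) = ev (ev t V) F"
proof -
  have "ev t (F \<odot> V) = ev (ev t (ratvar \<odot> V)) F"
    by (rule ev_unique[where h = "\<lambda>F. ev t (F \<odot> V)"])
       (use assms ev_not_emb[OF assms] in simp_all)
  then show ?thesis using assms by simp
qed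

lemmas ratcomp_assoc = ratfun.ev_ratcomp

section \<open>Rational maps and substitution\<close>

definition sphere_pt :: "complex \<Rightarrow> complex \<Rightarrow> sphere" where
  "sphere_pt s t = (if t = 0 then Infty else Fin (s / t))"

text \<open>The form t^N p(s/t) of degree N. Using N = deg F for numerator and denominator alike
  describes F on homogeneous coordinates (s : t), so that one formula covers the point t = 0 at
  infinity.\<close>

definition hompoly :: "nat \<Rightarrow> complex poly \<Rightarrow> complex \<Rightarrow> complex \<Rightarrow> complex" where
  "hompoly N p s t = (\<Sum>i\<le>N. coeff p i * s ^ i * t ^ (N - i))"

definition hompoly_poly :: "nat \<Rightarrow> complex poly \<Rightarrow> complex poly \<Rightarrow> complex poly \<Rightarrow> complex poly" where
  "hompoly_poly N p a b = (\<Sum>i\<le>N. smult (coeff p i) (a ^ i * b ^ (N - i)))"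

lemma poly_hompoly_poly: "poly (hompoly_poly N p a b) z = hompoly N p (poly a z) (poly b z)"
  by (simp add: hompoly_poly_def hompoly_def poly_sum mult.assoc)

lemma poly_altdef_le: "degree p \<le> N \<Longrightarrow> poly p (x :: complex) = (\<Sum>i\<le>N. coeff p i * x ^ i)"
  unfolding poly_altdef[of p] by (intro sum.mono_neutral_left) (auto simp: coeff_eq_0)

lemma hompoly_nz: "degree p \<le> N \<Longrightarrow> t \<noteq> 0 \<Longrightarrow> hompoly N p s t = t ^ N * poly p (s / t)"
  by (simp add: poly_altdef_le[of p N] hompoly_def sum_distrib_left power_divide)
     (rule sum.cong, auto simp: field_simps simp flip: power_add)

lemma hompoly_zero: "hompoly N p s 0 = coeff p N * s ^ N"
proof -
  have "hompoly N p s 0 = (\<Sum>i\<in>{N}. coeff p i * s ^ i * 0 ^ (N - i))"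
    unfolding hompoly_def by (rule sum.mono_neutral_right) auto
  then show ?thesis by simp
qed

lemma coprime_common_root:
  fixes p q :: "complex poly"
  assumes "coprime p q" "poly p z = 0" "poly q z = 0"
  shows False
  using assms by (metis coprime_poly_0)

lemma rat_map_sphere_pt:
  assumes "(s, t) \<noteq> (0, 0)" and N: "N = rat_degree F"
  shows "rat_map F (sphere_pt s t) = sphere_pt (hompoly N (numer F) s t) (hompoly N (denom F) s t)"
proof -
  have d: "degree (numer F) \<le> N" "degree (denom F) \<le> N"
    using N by (simp_all add: rat_degree_def)
  show ?thesis
  proof (cases "t = 0")
    case False
    then show ?thesis using d by (simp add: sphere_pt_def hompoly_nz)
  next
    case True
    have "coeff (denom F) N = 0" if "degree (numer F) > degree (denom F)"
      using that N by (intro coeff_eq_0) (simp add: rat_degree_def)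
    moreover have "N = degree (denom F)" if "\<not> degree (numer F) > degree (denom F)"
      using that N by (simp add: rat_degree_def)
    moreover have "coeff (denom F) (degree (denom F)) \<noteq> 0"
      using denom_nonzero[of F] by simp
    ultimately show ?thesis
      using True assms(1) by (auto simp: sphere_pt_def hompoly_zero Let_def)
  qed
qed

text \<open>A common zero with t nonzero would be a common root of coprime polynomials; at t = 0 one
  of the two polynomials has degree exactly N.\<close>

lemma hompoly_nonzero:
  assumes "(s, t) \<noteq> (0, 0)" and N: "N = rat_degree F"
  shows "hompoly N (numer F) s t \<noteq> 0 \<or> hompoly N (denom F) s t \<noteq> 0"
proof -
  have d: "degree (numer F) \<le> N" "degree (denom F) \<le> N"
    using N by (simp_all add: rat_degree_def)
  show ?thesis
  proof (cases "t = 0")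
    case False
    then show ?thesis
      using d coprime_common_root[OF coprime_numer_denom[of F], of "s / t"] by (auto simp: hompoly_nz)
  next
    case True
    have "N = degree (numer F) \<or> N = degree (denom F)" using N by (auto simp: rat_degree_def)
    then have "coeff (numer F) N \<noteq> 0 \<or> coeff (denom F) N \<noteq> 0"
      using denom_nonzero[of F] d by (metis degree_0 le_zero_eq leading_coeff_0_iff)
    then show ?thesis using True assms(1) by (auto simp: hompoly_zero)
  qed
qed

text \<open>Substitution produces fractions not known to be in lowest terms. Cross-multiplying with
  the reduced form suffices as long as a and b do not vanish together at z.\<close>

lemma rat_map_Fract_Fin:
  assumes "b \<noteq> 0" "poly a z \<noteq> 0 \<or> poly b z \<noteq> 0"
  shows "rat_map (Fract a b) (Fin z) = sphere_pt (poly a z) (poly b z)"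
proof -
  define F where "F = Fract a b"
  have "Fract a b = Fract (numer F) (denom F)" by (simp add: Fract_numer_denom F_def)
  then have "a * denom F = numer F * b" using assms denom_nonzero by (simp add: eq_fract)
  then have eq: "poly a z * poly (denom F) z = poly (numer F) z * poly b z" by (metis poly_mult)
  show ?thesis
  proof (cases "poly b z = 0")
    case True
    then show ?thesis using assms eq unfolding F_def[symmetric] by (simp add: sphere_pt_def)
  next
    case False
    have "poly (denom F) z \<noteq> 0"
      using eq False coprime_common_root[OF coprime_numer_denom[of F], of z] by auto
    then show ?thesis using eq False unfolding F_def[symmetric]
      by (simp add: sphere_pt_def field_simps)
  qed
qed

lemma coeff_mult_le:
  assumes "degree p \<le> m" "degree q \<le> n"
  shows "coeff (p * q) (m + n) = coeff p m * coeff q n"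
proof -
  have "coeff (p * q) (m + n) = (\<Sum>i\<le>m + n. coeff p i * coeff q (m + n - i))"
    by (simp add: coeff_mult)
  also have "\<dots> = (\<Sum>i\<in>{m}. coeff p i * coeff q (m + n - i))"
  proof (rule sum.mono_neutral_right)
    show "\<forall>i\<in>{..m + n} - {m}. coeff p i * coeff q (m + n - i) = 0"
    proof
      fix i assume "i \<in> {..m + n} - {m}"
      then have "i > m \<or> m + n - i > n" by auto
      then show "coeff p i * coeff q (m + n - i) = 0"
        using assms by (elim disjE) (simp_all add: coeff_eq_0)
    qed
  qed auto
  finally show ?thesis by simp
qed

text \<open>The counterpart at infinity: L is a common degree bound attained by a or b, and the
  cross-multiplied identity is compared in degree L + N.\<close>

lemma rat_map_Fract_Infty:
  assumes "b \<noteq> 0" "degree a \<le> L" "degree b \<le> L" "coeff a L \<noteq> 0 \<or> coeff b L \<noteq> 0"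
  shows "rat_map (Fract a b) Infty = sphere_pt (coeff a L) (coeff b L)"
proof -
  define F where "F = Fract a b"
  define N where "N = rat_degree F"
  have "Fract a b = Fract (numer F) (denom F)" by (simp add: Fract_numer_denom F_def)
  then have "a * denom F = numer F * b" using assms denom_nonzero by (simp add: eq_fract)
  then have "coeff (a * denom F) (L + N) = coeff (b * numer F) (L + N)" by (simp add: mult.commute)
  then have eq: "coeff a L * coeff (denom F) N = coeff (numer F) N * coeff b L"
    using assms by (simp add: coeff_mult_le N_def rat_degree_def mult.commute)
  have inf: "rat_map F Infty = sphere_pt (coeff (numer F) N) (coeff (denom F) N)"
    using rat_map_sphere_pt[of 1 0 N F] by (simp add: N_def hompoly_zero) (simp add: sphere_pt_def)
  have nz: "coeff (numer F) N \<noteq> 0 \<or> coeff (denom F) N \<noteq> 0"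
    using hompoly_nonzero[of 1 0 N F] by (simp add: N_def hompoly_zero)
  show ?thesis unfolding F_def[symmetric] inf
    using eq nz assms(4) by (auto simp: sphere_pt_def field_simps)
qed

lemma coeff_power_le:
  assumes "degree p \<le> m"
  shows "degree (p ^ n) \<le> m * n \<and> coeff (p ^ n) (m * n) = coeff p m ^ n"
proof (induction n)
  case (Suc n)
  have "degree (p * p ^ n) \<le> m + m * n"
    using Suc assms degree_mult_le[of p "p ^ n"] by linarith
  moreover have "coeff (p * p ^ n) (m + m * n) = coeff p m * coeff (p ^ n) (m * n)"
    using Suc assms by (intro coeff_mult_le) auto
  ultimately show ?case using Suc by simp
qed simp

lemma coeff_hompoly_poly:
  assumes "degree a \<le> m" "degree b \<le> m"
  shows "degree (hompoly_poly N p a b) \<le> N * m"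
    and "coeff (hompoly_poly N p a b) (N * m) = hompoly N p (coeff a m) (coeff b m)"
proof -
  have d: "degree (a ^ i * b ^ (N - i)) \<le> N * m"
    and c: "coeff (a ^ i * b ^ (N - i)) (N * m) = coeff a m ^ i * coeff b m ^ (N - i)" if "i \<le> N" for i
  proof -
    have N: "N * m = m * i + m * (N - i)"
      using that by (metis add_mult_distrib2 le_add_diff_inverse mult.commute)
    show "degree (a ^ i * b ^ (N - i)) \<le> N * m"
      using degree_mult_le[of "a ^ i" "b ^ (N - i)"] coeff_power_le[OF assms(1), of i]
        coeff_power_le[OF assms(2), of "N - i"] unfolding N by linarith
    show "coeff (a ^ i * b ^ (N - i)) (N * m) = coeff a m ^ i * coeff b m ^ (N - i)"
      using coeff_power_le[OF assms(1), of i] coeff_power_le[OF assms(2), of "N - i"]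
      unfolding N by (subst coeff_mult_le) auto
  qed
  show "degree (hompoly_poly N p a b) \<le> N * m"
    unfolding hompoly_poly_def
    by (rule degree_sum_le) (auto intro: d order_trans[OF degree_smult_le])
  show "coeff (hompoly_poly N p a b) (N * m) = hompoly N p (coeff a m) (coeff b m)"
    by (simp add: hompoly_poly_def hompoly_def coeff_sum c mult.assoc)
qed

lemma ratcomp_hompoly:
  assumes V: "V \<notin> range const_ratfun" and N: "N = rat_degree F"
  shows "F \<odot> V = Fract (hompoly_poly N (numer F) (numer V) (denom V))
                       (hompoly_poly N (denom F) (numer V) (denom V))"
    and "hompoly_poly N (denom F) (numer V) (denom V) \<noteq> 0"
proof -
  have pev: "to_fract (hompoly_poly N p (numer V) (denom V)) = ratfun.pev V p * to_fract (denom V ^ N)"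
    if "degree p \<le> N" for p
  proof -
    have "V = to_fract (numer V) / to_fract (denom V)"
      by (metis Fract_conv_to_fract Fract_numer_denom)
    moreover have nz: "to_fract (denom V) \<noteq> 0" using denom_nonzero by simp
    ultimately have VD: "V * to_fract (denom V) = to_fract (numer V)" by (simp add: field_simps)
    have pow: "to_fract (q ^ i) = to_fract q ^ i" for q :: "complex poly" and i
      by (induction i) simp_all
    have "to_fract (smult c q) = const_ratfun c * to_fract q" for c q
      by (simp add: const_ratfun_def flip: to_fract_mult)
    then have "to_fract (hompoly_poly N p (numer V) (denom V)) =
        (\<Sum>i\<le>N. const_ratfun (coeff p i) * (V * to_fract (denom V)) ^ i * to_fract (denom V) ^ (N - i))"
      by (simp add: hompoly_poly_def pow VD mult.assoc)
    also have "\<dots> = (\<Sum>i\<le>N. const_ratfun (coeff p i) * V ^ i * to_fract (denom V) ^ N)"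
      by (rule sum.cong) (auto simp: power_mult_distrib mult.assoc simp flip: power_add)
    also have "\<dots> = (\<Sum>i\<le>degree p. const_ratfun (coeff p i) * V ^ i * to_fract (denom V) ^ N)"
      by (rule sum.mono_neutral_right) (use that in \<open>auto simp: coeff_eq_0\<close>)
    finally show ?thesis by (simp add: ratfun.pev_altdef sum_distrib_right pow)
  qed
  have d: "degree (numer F) \<le> N" "degree (denom F) \<le> N"
    using N by (simp_all add: rat_degree_def)
  have nz: "ratfun.pev V (denom F) \<noteq> 0"
    by (rule ratfun.pev_nonzero[OF V denom_nonzero])
  have D: "to_fract (denom V ^ N) \<noteq> 0" using denom_nonzero by simp
  show "hompoly_poly N (denom F) (numer V) (denom V) \<noteq> 0"
    using pev[OF d(2)] nz D by (metis mult_eq_0_iff to_fract_0)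
  show "F \<odot> V = Fract (hompoly_poly N (numer F) (numer V) (denom V))
                       (hompoly_poly N (denom F) (numer V) (denom V))"
    using D by (simp add: Fract_conv_to_fract pev[OF d(1)] pev[OF d(2)] ratfun.ev_def)
qed

lemma rat_map_ratcomp:
  assumes V: "V \<notin> range const_ratfun"
  shows "rat_map (F \<odot> V) = rat_map F \<circ> rat_map V"
proof
  fix x
  define N where "N = rat_degree F"
  note comp = ratcomp_hompoly[OF V N_def]
  show "rat_map (F \<odot> V) x = (rat_map F \<circ> rat_map V) x"
  proof (cases x)
    case (Fin z)
    have st: "(poly (numer V) z, poly (denom V) z) \<noteq> (0, 0)"
      using coprime_common_root[OF coprime_numer_denom[of V], of z] by auto
    have "rat_map V (Fin z) = sphere_pt (poly (numer V) z) (poly (denom V) z)"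
      by (simp add: sphere_pt_def)
    then show ?thesis
      using Fin st rat_map_sphere_pt[OF st N_def] hompoly_nonzero[OF st N_def] comp
      by (simp add: rat_map_Fract_Fin poly_hompoly_poly del: rat_map.simps)
  next
    case Infty
    define M where "M = rat_degree V"
    have d: "degree (numer V) \<le> M" "degree (denom V) \<le> M" by (simp_all add: M_def rat_degree_def)
    have st: "(coeff (numer V) M, coeff (denom V) M) \<noteq> (0, 0)"
      using hompoly_nonzero[of 1 0 M V] by (simp add: M_def hompoly_zero)
    have "rat_map V Infty = sphere_pt (coeff (numer V) M) (coeff (denom V) M)"
      using rat_map_sphere_pt[of 1 0 M V] by (simp add: M_def hompoly_zero) (simp add: sphere_pt_def)
    then show ?thesis
      using Infty st rat_map_sphere_pt[OF st N_def] hompoly_nonzero[OF st N_def] comp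
        coeff_hompoly_poly[OF d, of N]
      by (simp add: rat_map_Fract_Infty[where L = "N * M"] del: rat_map.simps)
  qed
qed

lemma poly_eq_if_agree:
  fixes p q :: "'a :: idom poly"
  assumes "infinite {z. poly p z = poly q z}"
  shows "p = q"
  using assms poly_roots_finite[of "p - q"] by auto

lemma infinite_complex_Diff: "finite A \<Longrightarrow> infinite (- A :: complex set)"
  by (simp add: finite_compl infinite_UNIV_char_0)

lemma rat_map_inject: "rat_map F = rat_map G \<longleftrightarrow> F = G"
proof
  assume eq: "rat_map F = rat_map G"
  define A where "A = {z. poly (denom F) z = 0} \<union> {z. poly (denom G) z = 0}"
  have "finite A" using denom_nonzero by (simp add: A_def poly_roots_finite)
  moreover have "- A \<subseteq> {z. poly (numer F * denom G) z = poly (numer G * denom F) z}"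
  proof
    fix z assume "z \<in> - A"
    then show "z \<in> {z. poly (numer F * denom G) z = poly (numer G * denom F) z}"
      using fun_cong[OF eq, of "Fin z"] by (simp add: A_def field_simps)
  qed
  ultimately have "infinite {z. poly (numer F * denom G) z = poly (numer G * denom F) z}"
    using infinite_complex_Diff finite_subset by blast
  then have "numer F * denom G = numer G * denom F" by (rule poly_eq_if_agree)
  then have "Fract (numer F) (denom F) = Fract (numer G) (denom G)"
    using denom_nonzero by (simp add: eq_fract)
  then show "F = G" by (simp only: Fract_numer_denom)
qed simp

lemma rat_map_const: "rat_map (const_ratfun c) = (\<lambda>_. Fin c)"
proof
  fix x show "rat_map (const_ratfun c) x = Fin c" by (cases x) simp_all
qed

lemma rat_map_ratvar: "rat_map ratvar = id"
proof
  fix x show "rat_map ratvar x = id x" by (cases x) simp_all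
qed

section \<open>Generic fibres and the degree of a composition\<close>

text \<open>From p' q = p q' with p, q coprime, q divides q' and p divides p'; in characteristic
  zero both are then constant. The zeros of this expression account for multiple points in fibres
  and for double roots of fibre polynomials.\<close>

lemma wronskian_nonzero:
  assumes "F \<notin> range const_ratfun"
  shows "pderiv (numer F) * denom F - numer F * pderiv (denom F) \<noteq> 0"
proof
  define p q where "p = numer F" and "q = denom F"
  assume "pderiv (numer F) * denom F - numer F * pderiv (denom F) = 0"
  then have eq: "pderiv p * q = p * pderiv q" by (simp add: p_def q_def)
  have cop: "coprime p q" by (simp add: p_def q_def coprime_numer_denom)
  have "q dvd p * pderiv q" using eq by (metis dvd_triv_right)
  then have "q dvd pderiv q" using cop by (metis coprime_commute coprime_dvd_mult_right_iff)
  then have "degree q = 0" by (metis not_dvd_pderiv)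
  moreover have "p dvd pderiv p * q" using eq by (metis dvd_triv_left)
  then have "p dvd pderiv p" using cop by (metis coprime_dvd_mult_left_iff)
  then have "degree p = 0" by (metis not_dvd_pderiv)
  ultimately have "rat_degree F = 0" by (simp add: rat_degree_def p_def q_def)
  then show False using assms rat_degree_eq_0_iff by blast
qed

lemma degree_numer_minus_smult_denom:
  assumes "F \<notin> range const_ratfun"
  shows "finite {w. degree (numer F - smult w (denom F)) \<noteq> rat_degree F}"
proof -
  define N where "N = rat_degree F"
  have d: "degree (numer F) \<le> N" "degree (denom F) \<le> N" by (simp_all add: N_def rat_degree_def)
  have nz: "coeff (numer F) N \<noteq> 0 \<or> coeff (denom F) N \<noteq> 0"
    using hompoly_nonzero[of 1 0 N F] by (simp add: N_def hompoly_zero)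
  \<comment> \<open>The only candidate is the value F(infinity). If that value is infinity, the
    quotient is 0 by convention and there is no exceptional w.\<close>
  have "{w. degree (numer F - smult w (denom F)) \<noteq> N} \<subseteq> {coeff (numer F) N / coeff (denom F) N}"
  proof safe
    fix w assume "degree (numer F - smult w (denom F)) \<noteq> N"
    moreover have "degree (numer F - smult w (denom F)) \<le> N"
      using d by (intro degree_diff_le order_trans[OF degree_smult_le])
    ultimately have "coeff (numer F - smult w (denom F)) N = 0"
      by (intro coeff_eq_0) simp
    then show "w = coeff (numer F) N / coeff (denom F) N"
      using nz by (auto simp: field_simps)
  qed
  then show ?thesis unfolding N_def by (rule finite_subset) simp
qed

lemma fibre_eq_roots:
  "{z. rat_map F (Fin z) = Fin w} = {z. poly (numer F - smult w (denom F)) z = 0}"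
  using coprime_common_root[OF coprime_numer_denom[of F]] by (auto simp: field_simps)

text \<open>Stated over any algebraically closed field since it counts both the complex points of a
  fibre and the roots of a fibre polynomial in the algebraic closure of C(z).\<close>

lemma card_roots_squarefree:
  fixes p :: "'a :: alg_closed_field poly"
  assumes "p \<noteq> 0" "\<And>z. poly p z = 0 \<Longrightarrow> poly (pderiv p) z \<noteq> 0"
  shows "card {z. poly p z = 0} = degree p"
  using assms
proof (induction "degree p" arbitrary: p)
  case 0
  then obtain a where "p = [:a:]" "a \<noteq> 0" by (metis degree_eq_zeroE pCons_0_0)
  then show ?case by simp
next
  case (Suc n)
  then have "\<exists>a. poly p a = 0" by (intro alg_closed_imp_poly_has_root) simp
  then obtain a q where p: "p = [:- a, 1:] * q" by (metis dvdE poly_eq_0_iff_dvd)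
  then have q: "q \<noteq> 0" using Suc by auto
  have deg: "degree p = Suc (degree q)"
    using q by (simp add: p degree_mult_eq del: mult_pCons_left)
  have dp: "poly (pderiv p) z = poly q z + (z - a) * poly (pderiv q) z" for z
    unfolding p pderiv_mult by (simp add: pderiv_pCons algebra_simps del: mult_pCons_left mult_pCons_right)
  have a: "poly q a \<noteq> 0" using Suc(4)[of a] dp[of a] by (simp add: p del: mult_pCons_left)
  have "card {z. poly q z = 0} = degree q"
  proof (rule Suc.hyps(1))
    fix z assume "poly q z = 0"
    then show "poly (pderiv q) z \<noteq> 0"
      using Suc(4)[of z] dp[of z] by (auto simp: p simp del: mult_pCons_left)
  qed (use deg Suc q in auto)
  moreover have "{z. poly p z = 0} = insert a {z. poly q z = 0}"
    by (auto simp: p simp del: mult_pCons_left)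
  ultimately show ?case using a q deg by (simp add: poly_roots_finite)
qed

lemma generic_fibre:
  assumes F: "F \<notin> range const_ratfun"
  obtains B where "finite B"
    "\<And>w. w \<notin> B \<Longrightarrow> card {z. rat_map F (Fin z) = Fin w} = rat_degree F"
    "\<And>w. w \<notin> B \<Longrightarrow> rat_map F Infty \<noteq> Fin w"
proof -
  define W where "W = pderiv (numer F) * denom F - numer F * pderiv (denom F)"
  \<comment> \<open>Exceptions are the values where the degree drops, the critical values, and the
    value at infinity. A zero of W that is a pole of F only contributes a harmless extra value
    0.\<close>
  define B where "B = {w. degree (numer F - smult w (denom F)) \<noteq> rat_degree F} \<union>
      (\<lambda>z. poly (numer F) z / poly (denom F) z) ` {z. poly W z = 0} \<union> {w. rat_map F Infty = Fin w}"
  have "finite {w. rat_map F Infty = Fin w}"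
    by (cases "rat_map F Infty") auto
  then have "finite B"
    using degree_numer_minus_smult_denom[OF F] wronskian_nonzero[OF F, folded W_def]
    unfolding B_def by (intro finite_UnI finite_imageI poly_roots_finite)
  moreover have "card {z. rat_map F (Fin z) = Fin w} = rat_degree F" if w: "w \<notin> B" for w
  proof -
    let ?p = "numer F - smult w (denom F)"
    have deg: "degree ?p = rat_degree F" using w by (auto simp: B_def)
    have "rat_degree F \<noteq> 0" using F rat_degree_eq_0_iff by blast
    then have "?p \<noteq> 0" using deg by auto
    moreover have "poly (pderiv ?p) z \<noteq> 0" if z: "poly ?p z = 0" for z
    proof
      assume "poly (pderiv ?p) z = 0"
      then have "poly (pderiv (numer F)) z = w * poly (pderiv (denom F)) z"
        by (simp add: pderiv_diff pderiv_smult)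
      then have "poly W z = 0" using z by (simp add: W_def)
      moreover have "poly (denom F) z \<noteq> 0"
        using z coprime_common_root[OF coprime_numer_denom[of F], of z] by auto
      then have "w = poly (numer F) z / poly (denom F) z" using z by (simp add: field_simps)
      ultimately show False using w by (auto simp: B_def)
    qed
    ultimately show ?thesis
      unfolding fibre_eq_roots deg[symmetric] by (rule card_roots_squarefree)
  qed
  moreover have "rat_map F Infty \<noteq> Fin w" if "w \<notin> B" for w
    using that by (auto simp: B_def)
  ultimately show thesis by (rule that)
qed

lemma finite_fibre:
  assumes "F \<notin> range const_ratfun"
  shows "finite {z. rat_map F (Fin z) = p}"
proof (cases p)
  case (Fin w)
  have "numer F - smult w (denom F) \<noteq> 0"
  proof
    assume "numer F - smult w (denom F) = 0"
    then have "numer F = smult w (denom F)" by simp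
    then have "F = Fract (smult w (denom F)) (denom F)" by (metis Fract_numer_denom)
    also have "\<dots> = const_ratfun w"
      using denom_nonzero[of F] by (simp add: const_ratfun_def to_fract_def eq_fract)
    finally show False using assms by auto
  qed
  then show ?thesis unfolding Fin fibre_eq_roots by (rule poly_roots_finite)
next
  case Infty
  have "{z. rat_map F (Fin z) = Infty} \<subseteq> {z. poly (denom F) z = 0}" by auto
  then show ?thesis using Infty denom_nonzero poly_roots_finite finite_subset by blast
qed

text \<open>A generic fibre of the composite is the disjoint union of the V-fibres over the points
  of an F-fibre. Besides the exceptions of F and of the composite, w has to avoid the F-images of
  the exceptions of V.\<close>

lemma rat_degree_ratcomp:
  assumes V: "V \<notin> range const_ratfun"
  shows "rat_degree (F \<odot> V) = rat_degree F * rat_degree V"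
proof (cases "F \<in> range const_ratfun")
  case True
  then obtain c where "F = const_ratfun c" by auto
  then have "F \<odot> V = const_ratfun c" using V by simp
  then show ?thesis using True by (metis mult_zero_left rangeI rat_degree_eq_0_iff)
next
  case F: False
  then have FV: "F \<odot> V \<notin> range const_ratfun" using V ratcomp_not_const by blast
  obtain B where B: "finite B"
    "\<And>w. w \<notin> B \<Longrightarrow> card {z. rat_map F (Fin z) = Fin w} = rat_degree F"
    "\<And>w. w \<notin> B \<Longrightarrow> rat_map F Infty \<noteq> Fin w" using generic_fibre[OF F] by metis
  obtain B' where B': "finite B'"
    "\<And>w. w \<notin> B' \<Longrightarrow> card {z. rat_map V (Fin z) = Fin w} = rat_degree V" using generic_fibre[OF V] by metis
  obtain B'' where B'': "finite B''"
    "\<And>w. w \<notin> B'' \<Longrightarrow> card {z. rat_map (F \<odot> V) (Fin z) = Fin w} = rat_degree (F \<odot> V)"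
    using generic_fibre[OF FV] by metis
  let ?E = "B \<union> B'' \<union> {w. \<exists>u\<in>B'. rat_map F (Fin u) = Fin w}"
  have "{w. \<exists>u\<in>B'. rat_map F (Fin u) = Fin w} = (\<Union>u\<in>B'. {w. rat_map F (Fin u) = Fin w})" by blast
  moreover have "finite {w. s = Fin w}" for s by (cases s) auto
  ultimately have "finite ?E" using B B' B'' by simp
  then obtain w where w: "w \<notin> ?E"
    using infinite_complex_Diff[of ?E] by (metis Compl_iff ex_in_conv finite.emptyI)
  define S where "S = {u. rat_map F (Fin u) = Fin w}"
  have S: "card S = rat_degree F" "finite S"
    using B(2)[of w] w finite_fibre[OF F] by (auto simp: S_def)
  have "{z. rat_map (F \<odot> V) (Fin z) = Fin w} = (\<Union>u\<in>S. {z. rat_map V (Fin z) = Fin u})"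
  proof safe
    fix z assume "rat_map (F \<odot> V) (Fin z) = Fin w"
    then have z: "rat_map F (rat_map V (Fin z)) = Fin w" by (simp add: rat_map_ratcomp[OF V] del: rat_map.simps)
    then obtain u where "rat_map V (Fin z) = Fin u"
      using B(3)[of w] w by (cases "rat_map V (Fin z)") auto
    then show "z \<in> (\<Union>u\<in>S. {z. rat_map V (Fin z) = Fin u})" using z by (auto simp: S_def)
  next
    fix z u assume "u \<in> S" "rat_map V (Fin z) = Fin u"
    then show "rat_map (F \<odot> V) (Fin z) = Fin w"
      by (simp add: rat_map_ratcomp[OF V] S_def del: rat_map.simps)
  qed
  then have "rat_degree (F \<odot> V) = card (\<Union>u\<in>S. {z. rat_map V (Fin z) = Fin u})"
    using B''(2)[of w] w by auto
  also have "\<dots> = (\<Sum>u\<in>S. card {z. rat_map V (Fin z) = Fin u})"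
    by (rule card_UN_disjoint) (use S finite_fibre[OF V] in auto)
  also have "\<dots> = (\<Sum>u\<in>S. rat_degree V)"
    by (rule sum.cong[OF refl], rule B'(2)) (use w in \<open>auto simp: S_def\<close>)
  finally show ?thesis using S by simp
qed

section \<open>Subfields of the rational function field\<close>

text \<open>Plain closure conditions, convenient for images and preimages under substitution;
  \<open>inverse 0 = 0\<close> avoids a case distinction. The passage to HOL-Algebra is
  \<open>const_subfield_imp_subfield\<close>.\<close>

definition const_subfield :: "ratfun set \<Rightarrow> bool" where
  "const_subfield K \<longleftrightarrow> range const_ratfun \<subseteq> K \<and>
     (\<forall>F\<in>K. \<forall>G\<in>K. F + G \<in> K \<and> F * G \<in> K) \<and> (\<forall>F\<in>K. - F \<in> K \<and> inverse F \<in> K)"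

lemma const_subfieldD:
  assumes "const_subfield K"
  shows "const_ratfun c \<in> K" "F \<in> K \<Longrightarrow> G \<in> K \<Longrightarrow> F + G \<in> K" "F \<in> K \<Longrightarrow> G \<in> K \<Longrightarrow> F * G \<in> K"
    "F \<in> K \<Longrightarrow> - F \<in> K" "F \<in> K \<Longrightarrow> inverse F \<in> K" "F \<in> K \<Longrightarrow> G \<in> K \<Longrightarrow> F - G \<in> K"
    "F \<in> K \<Longrightarrow> G \<in> K \<Longrightarrow> F / G \<in> K" "0 \<in> K" "1 \<in> K"
proof -
  note a = assms[unfolded const_subfield_def]
  show "const_ratfun c \<in> K" for c using a by auto
  from this[of 0] this[of 1] show "0 \<in> K" "1 \<in> K" by simp_all
  show "F \<in> K \<Longrightarrow> G \<in> K \<Longrightarrow> F - G \<in> K" using a by (metis diff_conv_add_uminus)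
  show "F \<in> K \<Longrightarrow> G \<in> K \<Longrightarrow> F / G \<in> K" using a by (simp add: divide_inverse)
qed (use assms in \<open>auto simp: const_subfield_def\<close>)

lemma ratfun_field_simps [simp]:
  "carrier ratfun_field = UNIV" "\<one>\<^bsub>ratfun_field\<^esub> = 1" "\<zero>\<^bsub>ratfun_field\<^esub> = 0"
  "F \<oplus>\<^bsub>ratfun_field\<^esub> G = F + G" "F \<otimes>\<^bsub>ratfun_field\<^esub> G = F * G"
  by (simp_all add: ring_of_type_algebra_def)

lemma field_ratfun_field: "field ratfun_field" by (rule field_from_type_algebra)

lemma ratfun_field_uminus [simp]: "\<ominus>\<^bsub>ratfun_field\<^esub> F = - F"
proof -
  interpret field ratfun_field by (rule field_ratfun_field)
  show ?thesis by (rule minus_equality) simp_all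
qed

lemma ratfun_field_inverse [simp]: "F \<noteq> 0 \<Longrightarrow> inv\<^bsub>ratfun_field\<^esub> F = inverse F"
proof -
  interpret field ratfun_field by (rule field_ratfun_field)
  show "F \<noteq> 0 \<Longrightarrow> inv\<^bsub>ratfun_field\<^esub> F = inverse F" by (rule comm_inv_char) simp_all
qed

lemma const_subfield_imp_subfield: "const_subfield K \<Longrightarrow> subfield K ratfun_field"
proof -
  interpret field ratfun_field by (rule field_ratfun_field)
  assume K: "const_subfield K"
  show "subfield K ratfun_field"
    by (rule subfieldI', rule subringI) (use const_subfieldD[OF K] in auto)
qed

lemma const_subfield_adjoin: "const_subfield (adjoin S)"
proof -
  have inv: "inverse F \<in> adjoin S" if "F \<in> adjoin S" for F
    using that generate_field.m_inv[of F ratfun_field] unfolding adjoin_def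
    by (cases "F = 0") auto
  show ?thesis unfolding const_subfield_def
    using inv generate_field.incl[of _ "range const_ratfun \<union> S" ratfun_field]
      generate_field.eng_add[of _ ratfun_field "range const_ratfun \<union> S"]
      generate_field.eng_mult[of _ ratfun_field "range const_ratfun \<union> S"]
      generate_field.a_inv[of _ ratfun_field "range const_ratfun \<union> S"]
    unfolding adjoin_def by auto
qed

lemma adjoin_incl: "S \<subseteq> adjoin S"
  by (auto simp: adjoin_def intro: generate_field.incl)

lemma adjoin_least:
  assumes "const_subfield K" "S \<subseteq> K"
  shows "adjoin S \<subseteq> K"
proof
  fix F assume "F \<in> adjoin S"
  then show "F \<in> K" unfolding adjoin_def
  proof (induction rule: generate_field.induct)
    case (incl h)
    then show ?case using assms const_subfieldD(1)[OF assms(1)] by auto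
  qed (use const_subfieldD[OF assms(1)] in auto)
qed

lemma const_subfield_Int: "const_subfield K \<Longrightarrow> const_subfield L \<Longrightarrow> const_subfield (K \<inter> L)"
  unfolding const_subfield_def by blast

lemma const_subfield_sum:
  "const_subfield K \<Longrightarrow> (\<And>i. i \<in> A \<Longrightarrow> f i \<in> K) \<Longrightarrow> sum f A \<in> K"
  by (induction A rule: infinite_finite_induct) (auto intro: const_subfieldD)

lemma ratcomp_in_const_subfield:
  assumes K: "const_subfield K" and V: "V \<in> K"
  shows "F \<odot> V \<in> K"
proof -
  have "ratfun.pev V p \<in> K" for p
    by (induction p) (use V in \<open>auto intro: const_subfieldD[OF K]\<close>)
  then show ?thesis unfolding ratfun.ev_def by (intro const_subfieldD[OF K])
qed

lemma const_subfield_range_ratcomp: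
  assumes V: "V \<notin> range const_ratfun"
  shows "const_subfield (range (\<lambda>F. F \<odot> V))"
  unfolding const_subfield_def
proof (intro conjI ballI)
  show "range const_ratfun \<subseteq> range (\<lambda>F. F \<odot> V)"
    using ratfun.ev_const[OF V] by (metis image_subsetI rangeI)
qed (auto simp: ratfun.ev_add[OF V, symmetric] ratfun.ev_mult[OF V, symmetric]
    ratfun.ev_uminus[OF V, symmetric] ratfun.ev_inverse[OF V, symmetric])

lemma adjoin_singleton:
  assumes V: "V \<notin> range const_ratfun"
  shows "adjoin {V} = range (\<lambda>F. F \<odot> V)"
proof
  have "V = ratvar \<odot> V" using V by simp
  then show "adjoin {V} \<subseteq> range (\<lambda>F. F \<odot> V)"
    by (intro adjoin_least const_subfield_range_ratcomp[OF V]) blast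
  show "range (\<lambda>F. F \<odot> V) \<subseteq> adjoin {V}"
    using ratcomp_in_const_subfield[OF const_subfield_adjoin, of V] adjoin_incl by blast
qed

lemma const_subfield_vimage_ratcomp:
  assumes "const_subfield K" "V \<notin> range const_ratfun"
  shows "const_subfield {F. F \<odot> V \<in> K}"
  using const_subfieldD[OF assms(1)] assms(2) by (auto simp: const_subfield_def)

lemma const_subfield_image_ratcomp:
  assumes K: "const_subfield K" and V: "V \<notin> range const_ratfun"
  shows "const_subfield ((\<lambda>F. F \<odot> V) ` K)"
  unfolding const_subfield_def
proof (intro conjI ballI)
  show "range const_ratfun \<subseteq> (\<lambda>F. F \<odot> V) ` K"
    using ratfun.ev_const[OF V] const_subfieldD(1)[OF K] by (metis image_eqI image_subsetI)
qed (auto simp: ratfun.ev_add[OF V, symmetric] ratfun.ev_mult[OF V, symmetric]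
    ratfun.ev_uminus[OF V, symmetric] ratfun.ev_inverse[OF V, symmetric] intro!: imageI const_subfieldD[OF K])

lemma const_subfield_fixed:
  assumes "m \<notin> range const_ratfun"
  shows "const_subfield {F. F \<odot> m = F}"
  using assms by (auto simp: const_subfield_def)

section \<open>The degree of the field extension generated by a rational function\<close>

lemma rat_map_add:
  assumes "rat_map F (Fin z) = Fin a" "rat_map G (Fin z) = Fin b"
  shows "rat_map (F + G) (Fin z) = Fin (a + b)"
proof -
  have nz: "poly (denom F) z \<noteq> 0" "poly (denom G) z \<noteq> 0" using assms by (auto split: if_splits)
  have "F + G = Fract (numer F) (denom F) + Fract (numer G) (denom G)"
    by (simp add: Fract_numer_denom)
  also have "\<dots> = Fract (numer F * denom G + numer G * denom F) (denom F * denom G)"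
    by (rule add_fract) (simp_all add: denom_nonzero)
  finally show ?thesis
    using assms nz denom_nonzero
    by (simp only:, subst rat_map_Fract_Fin) (auto simp: sphere_pt_def field_simps)
qed

lemma rat_map_mult:
  assumes "rat_map F (Fin z) = Fin a" "rat_map G (Fin z) = Fin b"
  shows "rat_map (F * G) (Fin z) = Fin (a * b)"
proof -
  have nz: "poly (denom F) z \<noteq> 0" "poly (denom G) z \<noteq> 0" using assms by (auto split: if_splits)
  have "F * G = Fract (numer F) (denom F) * Fract (numer G) (denom G)"
    by (simp add: Fract_numer_denom)
  also have "\<dots> = Fract (numer F * numer G) (denom F * denom G)"
    by simp
  finally show ?thesis
    using assms nz denom_nonzero
    by (simp only:, subst rat_map_Fract_Fin) (auto simp: sphere_pt_def field_simps)
qed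

lemma rat_map_power:
  "rat_map F (Fin z) = Fin a \<Longrightarrow> rat_map (F ^ n) (Fin z) = Fin (a ^ n)"
proof (induction n)
  case 0
  then show ?case using rat_map_const[of 1] by (simp del: rat_map.simps)
next
  case (Suc n)
  then show ?case using rat_map_mult[of F z a "F ^ n"] by (simp del: rat_map.simps)
qed

lemma rat_map_sum:
  "(\<And>i. i \<in> A \<Longrightarrow> rat_map (F i) (Fin z) = Fin (a i)) \<Longrightarrow>
    rat_map (sum F A) (Fin z) = Fin (sum a A)"
proof (induction A rule: infinite_finite_induct)
  case (insert i A)
  then show ?case by (simp add: rat_map_add del: rat_map.simps)
qed (use rat_map_const[of 0] in \<open>simp_all del: rat_map.simps\<close>)

lemma rat_map_prod:
  "(\<And>i. i \<in> A \<Longrightarrow> rat_map (F i) (Fin z) = Fin (a i)) \<Longrightarrow>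
    rat_map (prod F A) (Fin z) = Fin (prod a A)"
proof (induction A rule: infinite_finite_induct)
  case (insert i A)
  then show ?case by (simp add: rat_map_mult del: rat_map.simps)
qed (use rat_map_const[of 1] in \<open>simp_all del: rat_map.simps\<close>)

section \<open>Polynomials with coefficients in a subfield\<close>

definition coeffs_in :: "ratfun set \<Rightarrow> ratfun poly \<Rightarrow> bool" where
  "coeffs_in K p \<longleftrightarrow> (\<forall>i. coeff p i \<in> K)"

lemma coeffs_in_closed:
  assumes K: "const_subfield K"
  shows "coeffs_in K 0" "a \<in> K \<Longrightarrow> coeffs_in K p \<Longrightarrow> coeffs_in K (pCons a p)"
    "coeffs_in K p \<Longrightarrow> coeffs_in K q \<Longrightarrow> coeffs_in K (p + q)"
    "coeffs_in K p \<Longrightarrow> coeffs_in K q \<Longrightarrow> coeffs_in K (p - q)"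
    "a \<in> K \<Longrightarrow> coeffs_in K p \<Longrightarrow> coeffs_in K (smult a p)"
    "coeffs_in K p \<Longrightarrow> coeffs_in K q \<Longrightarrow> coeffs_in K (p * q)"
    "a \<in> K \<Longrightarrow> coeffs_in K (monom a n)"
    "coeffs_in K (map_poly const_ratfun r)"
  by (auto simp: coeffs_in_def coeff_pCons coeff_mult coeff_map_poly
      intro: const_subfieldD[OF K] const_subfield_sum[OF K] split: nat.split)

lemma coeffs_in_pCons: "coeffs_in K (pCons a p) \<longleftrightarrow> a \<in> K \<and> coeffs_in K p"
  unfolding coeffs_in_def coeff_pCons by (auto split: nat.splits)

lemma coeffs_in_poly:
  assumes K: "const_subfield K"
  shows "coeffs_in K p \<Longrightarrow> a \<in> K \<Longrightarrow> poly p a \<in> K"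
  by (induction p) (auto simp: coeffs_in_pCons intro: const_subfieldD[OF K])

text \<open>After clearing denominators, specialise \<open>z\<close> to the distinct points of a generic fibre of \<open>V\<close>;
  there are more of them than the degree of the polynomial.\<close>

lemma poly_ratvar_nonzero:
  assumes V: "V \<notin> range const_ratfun" and p: "coeffs_in (range (\<lambda>F. F \<odot> V)) p" "p \<noteq> 0"
    and deg: "degree p < rat_degree V"
  shows "poly p ratvar \<noteq> 0"
proof
  assume p0: "poly p ratvar = 0"
  \<comment> \<open>A chosen inverse of substituting V into the coefficients; it has to respect 0
    for \<open>map_poly\<close> to act coefficientwise.\<close>
  define g where "g F = (SOME G. G \<odot> V = F)" for F
  have g: "g F \<odot> V = F" if "F \<in> range (\<lambda>F. F \<odot> V)" for F
    unfolding g_def by (rule someI_ex) (use that in blast)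
  have "g 0 \<odot> V = 0 \<odot> V" using g[of 0] V by (metis ratfun.ev_0 rangeI)
  then have g0: "g 0 = 0" using ratfun.ev_eq_iff[OF V] by blast
  \<comment> \<open>Up to a common factor c the pulled back coefficients are polynomials. Those of p
    are thus polynomials in V, which can be specialised at every finite value w of V.\<close>
  obtain c q where q: "map_poly g p = smult c (map_poly to_fract q)"
    by (metis content_decompose_fract)
  have cp: "coeff p i = (c \<odot> V) * ratfun.pev V (coeff q i)" for i
  proof -
    have "coeff p i = g (coeff p i) \<odot> V" using p(1) g by (simp add: coeffs_in_def)
    also have "g (coeff p i) = coeff (map_poly g p) i" using g0 by (simp add: coeff_map_poly)
    also have "\<dots> = c * to_fract (coeff q i)" by (simp add: q coeff_map_poly)
    finally show ?thesis using V by simp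
  qed
  have c: "c \<odot> V \<noteq> 0" using cp p(2) by (metis leading_coeff_0_iff mult_zero_left)
  have "coeff q i = 0" if "i > degree p" for i
  proof -
    have "ratfun.pev V (coeff q i) = 0" using cp[of i] that c by (simp add: coeff_eq_0)
    then show ?thesis using ratfun.pev_nonzero[OF V] by blast
  qed
  then have dq: "degree q \<le> degree p" by (rule degree_le[rule_format]) auto
  have "(c \<odot> V) * (\<Sum>i\<le>degree p. ratfun.pev V (coeff q i) * ratvar ^ i) = 0"
    using p0 by (simp add: poly_altdef cp sum_distrib_left mult.assoc)
  then have sum0: "(\<Sum>i\<le>degree p. ratfun.pev V (coeff q i) * ratvar ^ i) = 0" using c by simp
  obtain B where B: "finite B"
    "\<And>w. w \<notin> B \<Longrightarrow> card {z. rat_map V (Fin z) = Fin w} = rat_degree V"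
    using generic_fibre[OF V] by metis
  have van: "poly (coeff q i) w = 0" if w: "w \<notin> B" for i w
  proof -
    \<comment> \<open>Putting V = w leaves h, of degree below deg V, with the whole fibre over w
      among its roots. A generic fibre has deg V points, so h = 0.\<close>
    define h where "h = map_poly (\<lambda>r. poly r w) q"
    have dh: "degree h \<le> degree q"
      unfolding h_def by (rule degree_le) (simp add: coeff_map_poly coeff_eq_0)
    have "poly h z = 0" if z: "rat_map V (Fin z) = Fin w" for z
    proof -
      have "rat_map (ratfun.pev V r) (Fin z) = Fin (poly r w)" for r
      proof -
        have "ratfun.pev V r = to_fract r \<odot> V" using V by simp
        then have "rat_map (ratfun.pev V r) (Fin z) = rat_map (to_fract r) (Fin w)"
          using z by (simp only: rat_map_ratcomp[OF V]) (simp del: rat_map.simps)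
        then show ?thesis by (simp add: numer_def denom_def)
      qed
      moreover have "rat_map ratvar (Fin z) = Fin z" by (simp add: rat_map_ratvar del: rat_map.simps)
      ultimately have "rat_map (\<Sum>i\<le>degree p. ratfun.pev V (coeff q i) * ratvar ^ i) (Fin z) =
          Fin (\<Sum>i\<le>degree p. poly (coeff q i) w * z ^ i)"
        by (intro rat_map_sum rat_map_mult rat_map_power)
      then have "Fin (\<Sum>i\<le>degree p. poly (coeff q i) w * z ^ i) = Fin 0"
        unfolding sum0 using rat_map_const[of 0] by (simp del: rat_map.simps)
      moreover have "degree h \<le> degree p" using dh dq by simp
      ultimately show "poly h z = 0"
        by (simp add: poly_altdef_le) (simp add: h_def coeff_map_poly)
    qed
    then have "{z. rat_map V (Fin z) = Fin w} \<subseteq> {z. poly h z = 0}" by blast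
    moreover have "degree h < rat_degree V"
      using dq deg dh by linarith
    ultimately have "h = 0"
      using card_poly_roots_bound[of h] poly_roots_finite[of h] card_mono[of "{z. poly h z = 0}" "{z. rat_map V (Fin z) = Fin w}"]
        B(2)[OF w] by fastforce
    then show ?thesis
      using coeff_map_poly[of "\<lambda>r. poly r w" q i] by (simp add: h_def)
  qed
  have "coeff q i = 0" for i
  proof (rule ccontr)
    assume "coeff q i \<noteq> 0"
    then have "finite {w. poly (coeff q i) w = 0}" by (rule poly_roots_finite)
    moreover have "- B \<subseteq> {w. poly (coeff q i) w = 0}" using van by auto
    ultimately show False using infinite_complex_Diff[OF B(1)] finite_subset by blast
  qed
  then have "coeff p i = 0" for i using cp by simp
  then show False using p(2) by (simp add: poly_eq_iff)
qed

text \<open>For V = N/D this is N(T) - V D(T), a polynomial over C(V) with the root z. Its roots in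
  C(z) will be precisely the deck transformations of V.\<close>

definition fibre_poly :: "ratfun \<Rightarrow> ratfun poly" where
  "fibre_poly V = map_poly const_ratfun (numer V) - smult V (map_poly const_ratfun (denom V))"

lemma const_combination_nonzero:
  assumes V: "V \<notin> range const_ratfun" and "a \<noteq> 0 \<or> b \<noteq> 0"
  shows "const_ratfun a - V * const_ratfun b \<noteq> 0"
proof
  assume eq: "const_ratfun a - V * const_ratfun b = 0"
  show False
  proof (cases "b = 0")
    case True
    then have "const_ratfun a = const_ratfun 0" using eq by simp
    then have "a = 0" by (simp only: const_ratfun_eq_iff)
    then show False using True assms(2) by simp
  next
    case False
    then have "V * (const_ratfun b * const_ratfun (inverse b)) = const_ratfun a * const_ratfun (inverse b)"
      using eq by (simp add: mult.assoc[symmetric] del: const_ratfun_simps)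
    also have "const_ratfun b * const_ratfun (inverse b) = 1"
      using False by (simp flip: const_ratfun_simps)
    finally have "V = const_ratfun (a * inverse b)" by simp
    then show False using V by blast
  qed
qed

lemma
  assumes V: "V \<notin> range const_ratfun"
  shows degree_fibre_poly: "degree (fibre_poly V) = rat_degree V"
    and poly_fibre_poly_ratvar: "poly (fibre_poly V) ratvar = 0"
    and poly_fibre_poly_const: "poly (fibre_poly V) (const_ratfun c) \<noteq> 0"
    and coeffs_in_fibre_poly: "const_subfield K \<Longrightarrow> V \<in> K \<Longrightarrow> coeffs_in K (fibre_poly V)"
proof -
  define N where "N = rat_degree V"
  have c: "coeff (fibre_poly V) i = const_ratfun (coeff (numer V) i) - V * const_ratfun (coeff (denom V) i)" for i
    by (simp add: fibre_poly_def coeff_map_poly)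
  have "coeff (fibre_poly V) i = 0" if "i > N" for i
    using that by (simp add: c N_def rat_degree_def coeff_eq_0)
  then have "degree (fibre_poly V) \<le> N" by (intro degree_le) auto
  moreover have "coeff (numer V) N \<noteq> 0 \<or> coeff (denom V) N \<noteq> 0"
    using hompoly_nonzero[of 1 0 N V] by (simp add: N_def hompoly_zero)
  then have "coeff (fibre_poly V) N \<noteq> 0"
    unfolding c by (rule const_combination_nonzero[OF V])
  ultimately show "degree (fibre_poly V) = rat_degree V"
    unfolding N_def by (metis antisym le_degree)
  have "V * to_fract (denom V) = to_fract (numer V)"
    using denom_nonzero[of V] Fract_numer_denom[of V] Fract_conv_to_fract[of "numer V" "denom V"]
    by (metis nonzero_eq_divide_eq to_fract_eq_0_iff)
  then show "poly (fibre_poly V) ratvar = 0" by (simp add: fibre_poly_def poly_const_ratvar)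
  have "poly (map_poly const_ratfun p) (const_ratfun c) = const_ratfun (poly p c)" for p
    by (induction p) (simp_all add: map_poly_pCons)
  moreover have "poly (numer V) c \<noteq> 0 \<or> poly (denom V) c \<noteq> 0"
    using coprime_common_root[OF coprime_numer_denom[of V]] by blast
  ultimately show "poly (fibre_poly V) (const_ratfun c) \<noteq> 0"
    using const_combination_nonzero[OF V] by (simp add: fibre_poly_def)
  show "coeffs_in K (fibre_poly V)" if "const_subfield K" "V \<in> K"
    unfolding fibre_poly_def using that by (intro coeffs_in_closed)
qed

text \<open>Division with remainder that keeps all coefficients in the set K: a multiple of f
  cancels the leading term of q without changing the value at a.\<close>

lemma reduce_degree:
  assumes K: "const_subfield K" and f: "coeffs_in K f" "degree f > 0" "poly f a = 0"
  shows "coeffs_in K q \<Longrightarrow> \<exists>r. coeffs_in K r \<and> degree r < degree f \<and> poly r a = poly q a"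
proof (induction "degree q" arbitrary: q rule: less_induct)
  case less
  show ?case
  proof (cases "degree q < degree f")
    case False
    define h where "h = monom (coeff q (degree q) / coeff f (degree f)) (degree q - degree f) * f"
    have "f \<noteq> 0" using f(2) by auto
    have "q \<noteq> 0" using False f(2) by auto
    have ch: "coeffs_in K h" unfolding h_def using f(1) less.prems
      by (intro coeffs_in_closed[OF K] const_subfieldD[OF K]) (auto simp: coeffs_in_def)
    have dh: "degree h = degree q" unfolding h_def using False \<open>f \<noteq> 0\<close> \<open>q \<noteq> 0\<close>
      by (subst degree_mult_eq) (auto simp: degree_monom_eq monom_eq_0_iff)
    have "coeff h (degree q) = coeff q (degree q)"
      using False \<open>f \<noteq> 0\<close> by (simp add: h_def coeff_monom_mult)
    then have "coeff (q - h) (degree q) = 0" by simp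
    moreover have "degree (q - h) \<le> degree q" using dh by (intro degree_diff_le) auto
    moreover have "degree q > 0" using False f(2) by simp
    ultimately have "degree (q - h) < degree q"
      by (metis degree_0 leading_coeff_0_iff le_neq_implies_less)
    then obtain r where "coeffs_in K r" "degree r < degree f" "poly r a = poly (q - h) a"
      using less.hyps[of "q - h"] coeffs_in_closed(4)[OF K less.prems ch] by blast
    moreover have "poly h a = 0" by (simp add: h_def f(3))
    ultimately show ?thesis by auto
  qed (use less in blast)
qed

lemma coeffs_in_synthetic_div:
  "const_subfield K \<Longrightarrow> c \<in> K \<Longrightarrow> coeffs_in K p \<Longrightarrow> coeffs_in K (synthetic_div p c)"
  by (induction p) (auto simp: coeffs_in_pCons coeffs_in_poly coeffs_in_closed)

text \<open>The span of \<open>1, z, \<dots>, z\<^bsup>d-1\<^esup>\<close> over \<open>\<complex>(V)\<close> is a ring containing \<open>z\<close>; dividing the fibre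
  polynomial \<open>f(T)\<close> by \<open>T - c\<close> shows that it contains \<open>1 / (z - c)\<close>.\<close>

lemma poly_ratvar_surj:
  assumes V: "V \<notin> range const_ratfun" and K: "const_subfield K" "V \<in> K"
  shows "\<exists>p. coeffs_in K p \<and> degree p < rat_degree V \<and> poly p ratvar = F"
proof -
  define S where "S = {poly p ratvar |p. coeffs_in K p}"
  have SI: "coeffs_in K p \<Longrightarrow> poly p ratvar \<in> S" for p by (auto simp: S_def)
  have mult: "G * H \<in> S" if GH: "G \<in> S" "H \<in> S" for G H
  proof -
    obtain p q where "G = poly p ratvar" "coeffs_in K p" "H = poly q ratvar" "coeffs_in K q"
      using GH unfolding S_def by blast
    then show ?thesis using SI[of "p * q"] coeffs_in_closed(6)[OF K(1)] by simp
  qed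
  have poly: "to_fract q \<in> S" for q
    using SI[OF coeffs_in_closed(8)[OF K(1), of q]] by (simp add: poly_const_ratvar)
  have lin: "inverse (to_fract [:- c, 1:]) \<in> S" for c
  proof -
    define f where "f = fibre_poly V"
    define s where "s = synthetic_div f (const_ratfun c)"
    define y where "y = poly f (const_ratfun c)"
    have f: "coeffs_in K f" unfolding f_def by (rule coeffs_in_fibre_poly[OF V K])
    have "f + smult (const_ratfun c) s = pCons y s"
      unfolding s_def y_def by (rule synthetic_div_correct)
    \<comment> \<open>At T = z the division identity reads c s(z) = y + z s(z), so - s(z) / y
      inverts z - c.\<close>
    then have "poly (f + smult (const_ratfun c) s) ratvar = poly (pCons y s) ratvar" by (rule arg_cong)
    then have "const_ratfun c * poly s ratvar = y + ratvar * poly s ratvar"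
      using poly_fibre_poly_ratvar[OF V] by (simp add: f_def)
    moreover have lin: "to_fract [:- c, 1:] = ratvar - const_ratfun c"
      by (simp add: ratvar_def const_ratfun_def flip: to_fract_diff)
    moreover have y: "y \<noteq> 0" unfolding y_def f_def by (rule poly_fibre_poly_const[OF V])
    ultimately have "to_fract [:- c, 1:] * (- (poly s ratvar) / y) = 1"
      unfolding lin by (simp add: field_simps)
    then have "inverse (to_fract [:- c, 1:]) = poly (smult (- 1 / y) s) ratvar"
      by (simp add: inverse_unique)
    moreover have "coeffs_in K s" "y \<in> K"
      unfolding s_def y_def by (intro coeffs_in_synthetic_div coeffs_in_poly f K const_subfieldD[OF K(1)])+
    then have "coeffs_in K (smult (- 1 / y) s)"
      by (intro coeffs_in_closed[OF K(1)] const_subfieldD[OF K(1)])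
    ultimately show ?thesis using SI by metis
  qed
  have inv: "inverse (to_fract q) \<in> S" if "q \<noteq> 0" for q
    using that
  proof (induction "degree q" arbitrary: q)
    case 0
    then obtain a where q: "q = [:a:]" "a \<noteq> 0" by (metis degree_eq_zeroE pCons_0_0)
    then have "to_fract q * to_fract [:inverse a:] = 1"
      by (simp flip: to_fract_mult) (simp flip: one_pCons)
    then have "inverse (to_fract q) = to_fract [:inverse a:]" by (rule inverse_unique)
    then show ?case using poly by simp
  next
    case (Suc n)
    then have "\<exists>a. poly q a = 0" by (intro alg_closed_imp_poly_has_root) simp
    then obtain a r where q: "q = [:- a, 1:] * r" by (metis dvdE poly_eq_0_iff_dvd)
    then have "r \<noteq> 0" using Suc by auto
    moreover have "degree q = Suc (degree r)"
      using \<open>r \<noteq> 0\<close> by (simp add: q degree_mult_eq del: mult_pCons_left)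
    ultimately have "inverse (to_fract r) \<in> S" using Suc by auto
    then have "inverse (to_fract [:- a, 1:]) * inverse (to_fract r) \<in> S" using lin mult by blast
    then show ?case by (simp only: q to_fract_mult inverse_mult_distrib)
  qed
  have "F = to_fract (numer F) * inverse (to_fract (denom F))"
    by (metis Fract_conv_to_fract Fract_numer_denom divide_inverse)
  then have "F \<in> S" using mult[OF poly inv] denom_nonzero by metis
  then obtain q where q: "coeffs_in K q" "F = poly q ratvar" by (auto simp: S_def)
  have "rat_degree V > 0" using V rat_degree_eq_0_iff by blast
  then show ?thesis
    using reduce_degree[OF K(1) coeffs_in_fibre_poly[OF V K] _ poly_fibre_poly_ratvar[OF V] q(1)] q(2)
    by (simp add: degree_fibre_poly[OF V])
qed

text \<open>Transcendence of z over the constants. A subfield over which z is algebraic must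
  therefore contain a non-constant function.\<close>

lemma const_poly_ratvar_nonzero:
  assumes p: "coeffs_in (range const_ratfun) p" "p \<noteq> 0"
  shows "poly p ratvar \<noteq> 0"
proof
  assume p0: "poly p ratvar = 0"
  obtain c where c: "\<And>i. coeff p i = const_ratfun (c i)"
    using p(1) unfolding coeffs_in_def image_iff by metis
  define r where "r = (\<Sum>i\<le>degree p. monom (c i) i)"
  have cr: "coeff r i = (if i \<le> degree p then c i else 0)" for i
    by (simp add: r_def coeff_sum)
  have pr: "p = map_poly const_ratfun r"
  proof (rule poly_eqI)
    fix k show "coeff p k = coeff (map_poly const_ratfun r) k"
      using c[of k] by (cases "k \<le> degree p") (simp_all add: coeff_map_poly cr coeff_eq_0)
  qed
  then have "to_fract r = 0" using p0 by (simp add: poly_const_ratvar)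
  then show False using p(2) pr by simp
qed

text \<open>Translates the linear combinations of HOL-Algebra into polynomial values at z. Each
  induction step shifts the exponents, hence the offset k in the proof.\<close>

lemma combine_powers:
  "ring.combine ratfun_field Ks (map (\<lambda>i. ratvar ^ i) [0..<length Ks]) = poly (Poly Ks) ratvar"
proof -
  interpret field ratfun_field by (rule field_ratfun_field)
  have "combine Ks (map (\<lambda>i. ratvar ^ (k + i)) [0..<length Ks]) = ratvar ^ k * poly (Poly Ks) ratvar" for k
  proof (induction Ks arbitrary: k)
    case (Cons a Ks)
    have "map (\<lambda>i. ratvar ^ (k + i)) [0..<length (a # Ks)] =
        ratvar ^ k # map (\<lambda>i. ratvar ^ (Suc k + i)) [0..<length Ks]"
      by (simp add: upt_conv_Cons comp_def del: upt_Suc flip: map_Suc_upt)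
    then show ?case using Cons.IH[of "Suc k"] by (simp add: algebra_simps)
  qed simp
  from this[of 0] show ?thesis by simp
qed

lemma independent_powers:
  assumes K: "const_subfield K" and d: "d > 0"
    and nz: "\<And>p. coeffs_in K p \<Longrightarrow> p \<noteq> 0 \<Longrightarrow> degree p < d \<Longrightarrow> poly p ratvar \<noteq> 0"
  shows "ring.independent ratfun_field K (map (\<lambda>i. ratvar ^ i) [0..<d])"
proof (rule ccontr)
  interpret field ratfun_field by (rule field_ratfun_field)
  define Us where "Us = map (\<lambda>i. ratvar ^ i) [0..<d]"
  assume "\<not> ring.independent ratfun_field K (map (\<lambda>i. ratvar ^ i) [0..<d])"
  then have "\<not> independent K Us" by (simp add: Us_def)
  then obtain Ks where Ks: "length Ks = length Us" "combine Ks Us = 0" "set Ks \<subseteq> K" "set Ks \<noteq> {0}"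
    using dependent_imp_non_trivial_combine[OF const_subfield_imp_subfield[OF K], of Us] by auto
  have len: "length Ks = d" using Ks(1) by (simp add: Us_def)
  have "poly (Poly Ks) ratvar = 0" using Ks(2) combine_powers[of Ks] len by (simp add: Us_def)
  moreover have "coeffs_in K (Poly Ks)"
    using Ks(3) const_subfieldD(8)[OF K] by (auto simp: coeffs_in_def nth_default_def coeff_Poly_eq)
  moreover have "Ks \<noteq> []" using len d by auto
  then have "Poly Ks \<noteq> 0" using Ks(4) Poly_eq_0[of Ks]
    by (metis empty_replicate length_0_conv set_replicate)
  moreover have "degree (Poly Ks) < d"
    using degree_Poly[of Ks] \<open>Ks \<noteq> []\<close> len d
    by (metis Poly.simps(1) \<open>Poly Ks \<noteq> 0\<close> coeff_Poly_eq leI leading_coeff_0_iff nth_default_beyond)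
  ultimately show False using nz by blast
qed

text \<open>The powers 1, z, ..., z^(d-1) form a basis over C(W): \<open>poly_ratvar_nonzero\<close>
  gives independence and \<open>poly_ratvar_surj\<close> gives spanning.\<close>

lemma dimension_adjoin:
  assumes W: "W \<notin> range const_ratfun"
  shows "ring.dimension ratfun_field (rat_degree W) (adjoin {W}) (carrier ratfun_field)"
proof -
  interpret field ratfun_field by (rule field_ratfun_field)
  define K where "K = adjoin {W}"
  define d where "d = rat_degree W"
  define Us where "Us = map (\<lambda>i. ratvar ^ i) [0..<d]"
  have K: "const_subfield K" unfolding K_def by (rule const_subfield_adjoin)
  note sub = const_subfield_imp_subfield[OF K]
  have KW: "K = range (\<lambda>F. F \<odot> W)" unfolding K_def by (rule adjoin_singleton[OF W])
  have WK: "W \<in> K" unfolding K_def using adjoin_incl by blast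
  have "d > 0" using W rat_degree_eq_0_iff unfolding d_def by blast
  then have "independent K Us"
    unfolding Us_def by (rule independent_powers[OF K]) (use poly_ratvar_nonzero[OF W] in \<open>simp add: KW d_def\<close>)
  moreover have "Span K Us = carrier ratfun_field"
  proof -
    have "F \<in> Span K Us" for F
    proof -
      obtain p where p: "coeffs_in K p" "degree p < d" "poly p ratvar = F"
        using poly_ratvar_surj[OF W K WK] unfolding d_def by blast
      define Ks where "Ks = map (poly.coeff p) [0..<d]"
      have "Poly Ks = p"
        using p(2) by (intro poly_eqI) (auto simp: Ks_def coeff_Poly_eq nth_default_def coeff_eq_0)
      then have "combine Ks Us = F" using combine_powers[of Ks] p(3) by (simp add: Ks_def Us_def)
      moreover have "set Ks \<subseteq> K" using p(1) by (auto simp: Ks_def coeffs_in_def)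
      ultimately show ?thesis
        using Span_eq_combine_set[OF sub, of Us] by (auto simp del: Span.simps)
    qed
    then show ?thesis by auto
  qed
  ultimately show ?thesis
    using dimension_independent[of K Us] unfolding K_def d_def Us_def by simp
qed

section \<open>The theorem of Lueroth\<close>

lemma minimal_poly_dvd:
  assumes K: "const_subfield K" and p: "coeffs_in K p" "p \<noteq> 0" "poly p a = 0"
    and min: "\<And>q. coeffs_in K q \<Longrightarrow> q \<noteq> 0 \<Longrightarrow> poly q a = 0 \<Longrightarrow> degree p \<le> degree q"
  shows "coeffs_in K q \<Longrightarrow> poly q a = 0 \<Longrightarrow> p dvd q"
proof -
  assume q: "coeffs_in K q" "poly q a = 0"
  show "p dvd q"
  proof (cases "degree p = 0")
    case True
    then show ?thesis using p(2) by (metis degree_eq_zeroE dvd_trans is_unit_pCons_iff one_dvd pCons_0_0)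
  next
    case False
    have "\<exists>r h. coeffs_in K r \<and> degree r < degree p \<and> q = p * h + r"
      using q(1)
    proof (induction "degree q" arbitrary: q rule: less_induct)
      case less
      show ?case
      proof (cases "degree q < degree p")
        case True
        then show ?thesis using less.prems by (intro exI[of _ q] exI[of _ 0]) simp
      next
        case ge: False
        define g where "g = monom (coeff q (degree q) / coeff p (degree p)) (degree q - degree p)"
        have "coeffs_in K (g * p)" unfolding g_def using p(1) less.prems
          by (intro coeffs_in_closed[OF K] const_subfieldD[OF K]) (auto simp: coeffs_in_def)
        then have cd: "coeffs_in K (q - g * p)" using less.prems by (intro coeffs_in_closed(4)[OF K])
        have "q \<noteq> 0" using ge False by auto
        then have "degree (g * p) = degree q" unfolding g_def using ge p(2)
          by (subst degree_mult_eq) (auto simp: degree_monom_eq monom_eq_0_iff)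
        then have "degree (q - g * p) \<le> degree q" by (intro degree_diff_le) auto
        moreover have "coeff (q - g * p) (degree q) = 0"
          using ge p(2) by (simp add: g_def coeff_monom_mult)
        moreover have "degree q > 0" using ge False by simp
        ultimately have "degree (q - g * p) < degree q"
          by (metis degree_0 leading_coeff_0_iff le_neq_implies_less)
        then obtain r h where "coeffs_in K r" "degree r < degree p" "q - g * p = p * h + r"
          using less.hyps[of "q - g * p"] cd by blast
        then show ?thesis
          by (intro exI[of _ r] exI[of _ "h + g"]) (auto simp: algebra_simps)
      qed
    qed
    then obtain r h where r: "coeffs_in K r" "degree r < degree p" "q = p * h + r" by blast
    then have "poly r a = 0" using q(2) p(3) by simp
    then have "r = 0" using min[of r] r by fastforce
    then show ?thesis using r(3) by simp
  qed
qed

text \<open>Viewing \<open>P(z, T)\<close> as a polynomial in \<open>T\<close>, the coefficient of \<open>z\<^sup>e\<close> as a polynomial in \<open>T\<close>.\<close>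

definition inner_coeff :: "nat \<Rightarrow> complex poly poly \<Rightarrow> complex poly" where
  "inner_coeff e P = map_poly (\<lambda>q. coeff q e) P"

lemma poly_inner_coeff: "poly (inner_coeff e P) c = coeff (poly P [:c:]) e"
  unfolding inner_coeff_def by (induction P) (simp_all add: map_poly_pCons)

text \<open>V is a non-constant quotient of two coefficients of the minimal polynomial p of z over
  K. Then p divides the fibre polynomial of V, and comparing degrees in z after clearing
  denominators shows that the cofactor is constant. So z has the same degree over K as over its
  subfield C(V), and the two fields agree.\<close>

theorem lueroth:
  assumes K: "const_subfield K" and nc: "K \<noteq> range const_ratfun"
  obtains V where "V \<notin> range const_ratfun" "K = range (\<lambda>F. F \<odot> V)"
proof -
  obtain V0 where V0: "V0 \<in> K" "V0 \<notin> range const_ratfun"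
    using nc const_subfieldD(1)[OF K] by blast
  define Q where "Q p \<longleftrightarrow> coeffs_in K p \<and> p \<noteq> 0 \<and> poly p ratvar = 0" for p
  have "fibre_poly V0 \<noteq> 0"
    using poly_fibre_poly_const[OF V0(2), of 0] by auto
  then have "Q (fibre_poly V0)"
    using coeffs_in_fibre_poly[OF V0(2) K V0(1)] poly_fibre_poly_ratvar[OF V0(2)] by (simp add: Q_def)
  then obtain p where p: "Q p" "\<And>q. Q q \<Longrightarrow> degree p \<le> degree q"
    using ex_has_least_nat[of Q _ degree] by blast
  have pK: "coeffs_in K p" "p \<noteq> 0" "poly p ratvar = 0" using p(1) by (simp_all add: Q_def)
  define m where "m = degree p"
  have lc: "coeff p m \<noteq> 0" using pK by (simp add: m_def)
  have "\<exists>i. coeff p i / coeff p m \<notin> range const_ratfun"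
  proof (rule ccontr)
    assume "\<not> ?thesis"
    then have "coeffs_in (range const_ratfun) (smult (inverse (coeff p m)) p)"
      by (simp add: coeffs_in_def divide_inverse mult.commute)
    then have "poly (smult (inverse (coeff p m)) p) ratvar \<noteq> 0"
      by (rule const_poly_ratvar_nonzero) (use lc pK in simp)
    then show False using pK by simp
  qed
  then obtain i where i: "coeff p i / coeff p m \<notin> range const_ratfun" by blast
  define V where "V = coeff p i / coeff p m"
  have V: "V \<notin> range const_ratfun" using i by (simp add: V_def)
  have VK: "V \<in> K" unfolding V_def using pK(1) by (intro const_subfieldD[OF K]) (auto simp: coeffs_in_def)
  define d where "d = rat_degree V"
  define P where "P = primitive_part_fract p"
  have pP: "p = smult (fract_content p) (map_poly to_fract P)"
    unfolding P_def by (rule content_times_primitive_part_fract[symmetric])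
  have cP: "content P = 1" unfolding P_def using pK(2) by (rule content_primitive_part_fract)
  have dP: "degree P = m" unfolding P_def m_def by simp
  have coP: "coeff p j = fract_content p * to_fract (coeff P j)" for j
    by (subst pP) (simp add: coeff_map_poly)
  have "V = Fract (coeff P i) (coeff P m)"
    unfolding V_def Fract_conv_to_fract using pK(2) by (simp add: coP)
  moreover have Pm: "coeff P m \<noteq> 0" using lc coP by auto
  ultimately have "Fract (coeff P i) (coeff P m) = Fract (numer V) (denom V)"
    by (simp add: Fract_numer_denom)
  then have eq: "coeff P i * denom V = numer V * coeff P m"
    using Pm denom_nonzero by (simp add: eq_fract)
  \<comment> \<open>Since V = P_i / P_m, its reduced numerator divides P_i and its reduced
    denominator divides P_m. One of these two coefficients has degree at least d in z.\<close>
  have "numer V dvd coeff P i * denom V" unfolding eq by simp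
  then have nd: "numer V dvd coeff P i"
    using coprime_numer_denom[of V] by (metis coprime_dvd_mult_left_iff)
  have "denom V dvd numer V * coeff P m" unfolding eq[symmetric] by simp
  then have dd: "denom V dvd coeff P m"
    using coprime_numer_denom[of V] by (metis coprime_commute coprime_dvd_mult_right_iff)
  have Pi: "coeff P i \<noteq> 0"
  proof
    assume "coeff P i = 0"
    then have "V = const_ratfun 0" by (simp add: V_def coP)
    then show False using V by blast
  qed
  obtain j where j: "degree (coeff P j) \<ge> d"
    using dvd_imp_degree_le[OF nd Pi] dvd_imp_degree_le[OF dd Pm] unfolding d_def rat_degree_def
    by (metis max.cobounded1 max_def)
  \<comment> \<open>The fibre polynomial of V = N/D with its denominator cleared, N(T) D(z) - D(T)
    N(z), as a polynomial in T over C[z].\<close>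
  define f where "f = map_poly (\<lambda>a. smult a (denom V)) (numer V) - map_poly (\<lambda>a. smult a (numer V)) (denom V)"
  have cf: "coeff f k = smult (coeff (numer V) k) (denom V) - smult (coeff (denom V) k) (numer V)" for k
    by (simp add: f_def coeff_map_poly)
  have Vd: "V * to_fract (denom V) = to_fract (numer V)"
    using denom_nonzero[of V] Fract_numer_denom[of V] Fract_conv_to_fract[of "numer V" "denom V"]
    by (metis nonzero_eq_divide_eq to_fract_eq_0_iff)
  have sm: "to_fract (smult c q) = const_ratfun c * to_fract q" for c q
    by (simp add: const_ratfun_def flip: to_fract_mult)
  have ff: "map_poly to_fract f = smult (to_fract (denom V)) (fibre_poly V)"
    by (intro poly_eqI)
      (simp add: coeff_map_poly cf fibre_poly_def sm algebra_simps Vd[symmetric])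
  have "p dvd fibre_poly V"
    using minimal_poly_dvd[OF K pK, of "fibre_poly V"] p(2) coeffs_in_fibre_poly[OF V K VK]
      poly_fibre_poly_ratvar[OF V] unfolding Q_def by blast
  then have "p dvd map_poly to_fract f" unfolding ff by (rule dvd_smult)
  moreover have "map_poly to_fract P dvd p"
    by (subst pP) (rule dvd_smult[OF dvd_refl])
  ultimately have "map_poly to_fract P dvd map_poly to_fract f" by (rule dvd_trans[rotated])
  \<comment> \<open>P is primitive, so divisibility over C(z) descends to C[z].\<close>
  then have "P dvd f" using cP by (rule fract_poly_dvdD)
  then obtain R where R: "f = P * R" by blast
  have fc: "poly f [:c:] = smult (poly (numer V) c) (denom V) - smult (poly (denom V) c) (numer V)" for c
  proof -
    have "poly (map_poly (\<lambda>a. smult a q) r) [:c:] = smult (poly r c) q" for q r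
      by (induction r) (simp_all add: map_poly_pCons smult_add_left mult.commute)
    then show ?thesis by (simp add: f_def)
  qed
  have fc_nz: "poly f [:c:] \<noteq> 0" for c
  proof
    assume f0: "poly f [:c:] = 0"
    have "to_fract (poly f [:c:]) = to_fract (denom V) * poly (fibre_poly V) (const_ratfun c)"
    proof -
      have "poly (map_poly const_ratfun q) (const_ratfun c) = const_ratfun (poly q c)" for q
        by (induction q) (simp_all add: map_poly_pCons)
      then show ?thesis
        by (simp add: fc sm fibre_poly_def algebra_simps Vd[symmetric])
    qed
    then show False using f0 poly_fibre_poly_const[OF V] denom_nonzero[of V] by simp
  qed
  have fc_deg: "degree (poly f [:c:]) \<le> d" for c
    unfolding fc d_def rat_degree_def
    by (intro degree_diff_le order_trans[OF degree_smult_le]) auto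
  \<comment> \<open>For c outside the finite set Z, P(z, c) has degree at least d in z, while f(z,
    c) has degree at most d. The cofactor R(z, c) is then constant in z.\<close>
  define Z where "Z = {c. poly (inner_coeff (degree (coeff P j)) P) c = 0}"
  have "finite Z"
  proof -
    have "coeff (inner_coeff (degree (coeff P j)) P) j = lead_coeff (coeff P j)"
      by (simp add: inner_coeff_def coeff_map_poly)
    moreover have "d > 0" unfolding d_def using V rat_degree_eq_0_iff by blast
    then have "coeff P j \<noteq> 0" using j by auto
    ultimately have "inner_coeff (degree (coeff P j)) P \<noteq> 0" by auto
    then show ?thesis unfolding Z_def by (rule poly_roots_finite)
  qed
  have degR: "degree (poly R [:c:]) = 0" if c: "c \<notin> Z" for c
  proof -
    have "coeff (poly P [:c:]) (degree (coeff P j)) \<noteq> 0"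
      using c by (simp add: Z_def poly_inner_coeff)
    then have "degree (poly P [:c:]) \<ge> d" using j le_degree order_trans by blast
    moreover have "poly f [:c:] = poly P [:c:] * poly R [:c:]" by (simp add: R)
    ultimately show ?thesis
      using fc_nz[of c] fc_deg[of c] degree_mult_eq[of "poly P [:c:]" "poly R [:c:]"] by auto
  qed
  have Rconst: "degree (coeff R k) = 0" for k
  proof -
    have "coeff (coeff R k) e = 0" if "e > 0" for e
    proof -
      have "- Z \<subseteq> {c. poly (inner_coeff e R) c = 0}"
        using degR that by (auto simp: poly_inner_coeff coeff_eq_0)
      then have "infinite {c. poly (inner_coeff e R) c = 0}"
        using infinite_complex_Diff[OF \<open>finite Z\<close>] finite_subset by blast
      then have "inner_coeff e R = 0" using poly_roots_finite by blast
      then have "coeff (inner_coeff e R) k = 0" by simp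
      then show ?thesis by (simp add: inner_coeff_def coeff_map_poly)
    qed
    then show ?thesis by (metis degree_0 gr0I leading_coeff_0_iff)
  qed
  \<comment> \<open>R involves T alone by now; a root c of it would give f(z, c) = 0, impossible for
    non-constant V.\<close>
  have "degree R = 0"
  proof (rule ccontr)
    assume dR: "degree R \<noteq> 0"
    have R0: "R = map_poly (\<lambda>a. [:a:]) (inner_coeff 0 R)"
    proof (rule poly_eqI)
      fix k
      have "coeff R k = [:coeff (coeff R k) 0:]" using Rconst[of k] by (metis coeff_pCons_0 degree_eq_zeroE)
      then show "coeff R k = coeff (map_poly (\<lambda>a. [:a:]) (inner_coeff 0 R)) k"
        by (simp add: coeff_map_poly inner_coeff_def)
    qed
    then have "degree (inner_coeff 0 R) \<noteq> 0"
      using dR by (metis degree_map_poly pCons_eq_0_iff)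
    then obtain c where c: "poly (inner_coeff 0 R) c = 0"
      using alg_closed_imp_poly_has_root[of "inner_coeff 0 R"] by auto
    have "poly (map_poly (\<lambda>a. [:a:]) r) [:c:] = [:poly r c:]" for r
      by (induction r) (simp_all add: map_poly_pCons mult.commute)
    then have "poly R [:c:] = 0" using R0 c by (metis pCons_0_0)
    then show False using fc_nz[of c] by (simp add: R)
  qed
  moreover have "degree f = d"
  proof -
    have "degree (map_poly to_fract f) = degree f" by (rule degree_map_poly) simp
    then show ?thesis using ff degree_fibre_poly[OF V] denom_nonzero[of V] by (simp add: d_def)
  qed
  moreover have "f \<noteq> 0" using fc_nz[of 0] by auto
  ultimately have md: "m = d"
    using degree_mult_eq[of P R] dP R by auto
  have "W \<in> range (\<lambda>F. F \<odot> V)" if W: "W \<in> K" for W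
  proof -
    have "V = ratvar \<odot> V" using V by simp
    \<comment> \<open>W is a polynomial in z over C(V) of degree below d. Subtracting W gives a
      polynomial over K with root z and smaller degree than p, hence zero.\<close>
    then obtain r where r: "coeffs_in (range (\<lambda>F. F \<odot> V)) r" "degree r < d" "poly r ratvar = W"
      using poly_ratvar_surj[OF V const_subfield_range_ratcomp[OF V], of W] unfolding d_def by blast
    have "range (\<lambda>F. F \<odot> V) \<subseteq> K" using ratcomp_in_const_subfield[OF K VK] by blast
    then have "coeffs_in K (r - [:W:])"
      using r(1) W by (intro coeffs_in_closed[OF K]) (auto simp: coeffs_in_def coeff_pCons const_subfieldD[OF K] split: nat.split)
    moreover have "poly (r - [:W:]) ratvar = 0" using r(3) by simp
    moreover have "degree (r - [:W:]) < degree p"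
      using r(2) md m_def degree_diff_le_max[of r "[:W:]"] by simp
    ultimately have "r - [:W:] = 0" using p(2)[of "r - [:W:]"] unfolding Q_def by force
    then have "W = coeff r 0" by (metis coeff_pCons_0 eq_iff_diff_eq_0)
    then show ?thesis using r(1) by (simp add: coeffs_in_def)
  qed
  then have "K = range (\<lambda>F. F \<odot> V)" using ratcomp_in_const_subfield[OF K VK] by blast
  then show thesis using that V by blast
qed

section \<open>Deck transformations as rational functions\<close>

text \<open>The deck group inside C(z), where its elements are roots of \<open>fibre_poly\<close>
  and can be counted algebraically; \<open>rat_map\<close> identifies it with
  \<open>deck_group\<close>.\<close>

definition deck :: "ratfun \<Rightarrow> ratfun set" where
  "deck F = {m. rat_degree m = 1 \<and> F \<odot> m = F}"

lemma degree_one_not_const: "rat_degree m = 1 \<Longrightarrow> m \<notin> range const_ratfun"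
  by (metis One_nat_def nat.distinct(1) rat_degree_eq_0_iff)

lemma rat_map_deck: "rat_map ` deck F = deck_group F"
proof -
  have "F \<odot> m = F \<longleftrightarrow> rat_map F \<circ> rat_map m = rat_map F" if "rat_degree m = 1" for m
    using rat_map_inject[of "F \<odot> m" F] rat_map_ratcomp[OF degree_one_not_const[OF that], of F] by simp
  then show ?thesis unfolding deck_group_def carrier_aut_sphere_eq deck_def by blast
qed

lemma inj_on_rat_map: "inj_on rat_map A"
  using rat_map_inject by (auto simp: inj_on_def)

lemma card_deck_group: "card (deck_group F) = card (deck F)"
  unfolding rat_map_deck[symmetric] by (rule card_image[OF inj_on_rat_map])

lemma aut_inverse:
  assumes "rat_degree m = 1"
  obtains m' where "rat_degree m' = 1" "m \<odot> m' = ratvar" "m' \<odot> m = ratvar"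
proof -
  have "rat_map m \<in> carrier aut_sphere" using assms carrier_aut_sphere_eq by auto
  then obtain g where g: "g \<in> carrier aut_sphere" "g \<circ> rat_map m = id" "rat_map m \<circ> g = id"
    by (rule aut_sphere_inverse)
  then obtain m' where m': "g = rat_map m'" "rat_degree m' = 1" using carrier_aut_sphere_eq by auto
  have "rat_map (m \<odot> m') = rat_map ratvar" "rat_map (m' \<odot> m) = rat_map ratvar"
    using g m' assms by (simp_all add: rat_map_ratcomp degree_one_not_const rat_map_ratvar)
  then show thesis using that m' by (simp add: rat_map_inject)
qed

lemma degree_one_ratcomp: "rat_degree m = 1 \<Longrightarrow> rat_degree m' = 1 \<Longrightarrow> rat_degree (m \<odot> m') = 1"
  by (simp add: rat_degree_ratcomp degree_one_not_const)

lemma ratcomp_right_cancel: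
  "V \<notin> range const_ratfun \<Longrightarrow> F \<odot> V = G \<odot> V \<longleftrightarrow> F = G"
  by (rule ratfun.ev_eq_iff)

text \<open>A non-constant solution m of F(m) = F has degree one by multiplicativity of degrees, and
  constants are never roots. The degree therefore bounds the order of the deck group.\<close>

lemma poly_fibre_poly_eq_0_iff:
  assumes F: "F \<notin> range const_ratfun"
  shows "poly (fibre_poly F) m = 0 \<longleftrightarrow> m \<in> deck F"
proof -
  have nc: "m \<notin> range const_ratfun \<Longrightarrow> poly (fibre_poly F) m = 0 \<longleftrightarrow> F \<odot> m = F"
    using ratfun.pev_nonzero[of m "denom F"] denom_nonzero[of F]
    by (simp add: fibre_poly_def ratfun.ev_def ratfun.pev_def field_simps)
  have "rat_degree m = 1" if "F \<odot> m = F" "m \<notin> range const_ratfun"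
  proof -
    have "rat_degree F = rat_degree F * rat_degree m" using rat_degree_ratcomp[of m F] that by simp
    moreover have "rat_degree F \<noteq> 0" using F rat_degree_eq_0_iff by blast
    ultimately show ?thesis by simp
  qed
  then show ?thesis
    using nc poly_fibre_poly_const[OF F] degree_one_not_const unfolding deck_def by blast
qed

lemma
  assumes F: "F \<notin> range const_ratfun"
  shows finite_deck: "finite (deck F)" and card_deck_le: "card (deck F) \<le> rat_degree F"
proof -
  have eq: "deck F = {m. poly (fibre_poly F) m = 0}" using poly_fibre_poly_eq_0_iff[OF F] by blast
  have nz: "fibre_poly F \<noteq> 0" using poly_fibre_poly_const[OF F, of 0] by auto
  show "finite (deck F)" unfolding eq by (rule poly_roots_finite[OF nz])
  show "card (deck F) \<le> rat_degree F"
    unfolding eq degree_fibre_poly[OF F, symmetric] by (rule card_poly_roots_bound[OF nz])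
qed

lemma ratvar_in_deck: "ratvar \<in> deck F" by (simp add: deck_def)

lemma deck_ratcomp: "m \<in> deck F \<Longrightarrow> m' \<in> deck F \<Longrightarrow> m \<odot> m' \<in> deck F"
  using degree_one_ratcomp by (auto simp: deck_def degree_one_not_const simp flip: ratcomp_assoc)

lemma deck_inverse:
  assumes "m \<in> deck F"
  obtains m' where "m' \<in> deck F" "m \<odot> m' = ratvar" "m' \<odot> m = ratvar"
proof -
  have m: "rat_degree m = 1" "F \<odot> m = F" using assms by (auto simp: deck_def)
  obtain m' where m': "rat_degree m' = 1" "m \<odot> m' = ratvar" "m' \<odot> m = ratvar"
    using aut_inverse[OF m(1)] by blast
  have "F \<odot> m' = F \<odot> m \<odot> m'" using m by simp
  also have "\<dots> = F \<odot> (m \<odot> m')"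
    using degree_one_not_const[OF m(1)] degree_one_not_const[OF m'(1)] by (simp only: ratcomp_assoc not_False_eq_True)
  also have "\<dots> = F" using m' by simp
  finally show thesis using that m' by (auto simp: deck_def)
qed

lemma bij_betw_deck_translate:
  assumes "m \<in> deck F"
  shows "bij_betw (\<lambda>s. s \<odot> m) (deck F) (deck F)"
proof -
  obtain m' where m': "m' \<in> deck F" "m \<odot> m' = ratvar" "m' \<odot> m = ratvar"
    using deck_inverse[OF assms] by blast
  have nc: "m \<notin> range const_ratfun" "m' \<notin> range const_ratfun"
    using assms m' degree_one_not_const unfolding deck_def by blast+
  show ?thesis
    by (rule bij_betw_byWitness[where f' = "\<lambda>s. s \<odot> m'"])
      (use assms m' nc deck_ratcomp in \<open>auto simp: ratcomp_assoc\<close>)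
qed

lemma deck_subset_ratcomp:
  assumes "V \<notin> range const_ratfun"
  shows "deck V \<subseteq> deck (F \<odot> V)"
  using assms by (auto simp: deck_def ratcomp_assoc degree_one_not_const)

text \<open>By Lueroth the fixed field is some C(T), with F = S o T. All of deck F fixes T, so deg F
  = |deck F| \<le> |deck T| \<le> deg T. This forces deg S = 1, and C(T) = C(F).\<close>

lemma deck_fixed_field:
  assumes F: "F \<notin> range const_ratfun" and c: "card (deck F) = rat_degree F"
    and W: "\<And>m. m \<in> deck F \<Longrightarrow> W \<odot> m = W"
  obtains H where "W = H \<odot> F"
proof -
  define K where "K = {W. \<forall>m\<in>deck F. W \<odot> m = W}"
  have "const_subfield {W. W \<odot> m = W}" if "m \<in> deck F" for m
    using that by (intro const_subfield_fixed degree_one_not_const) (simp add: deck_def)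
  then have K: "const_subfield K" unfolding K_def const_subfield_def by blast
  have FK: "F \<in> K" by (simp add: K_def deck_def)
  obtain T where T: "T \<notin> range const_ratfun" "K = range (\<lambda>H. H \<odot> T)"
    using lueroth[OF K] FK F by blast
  obtain S where S: "F = S \<odot> T" using FK T by blast
  have "T \<in> K" using T by (metis ratfun.ev_ratvar rangeI)
  then have "T \<odot> m = T" if "m \<in> deck F" for m using that by (simp add: K_def)
  then have "deck F \<subseteq> deck T" unfolding deck_def by blast
  then have "card (deck F) \<le> card (deck T)" by (rule card_mono[OF finite_deck[OF T(1)]])
  then have "rat_degree F \<le> rat_degree T" using card_deck_le[OF T(1)] c by simp
  moreover have "rat_degree F = rat_degree S * rat_degree T"
    unfolding S by (rule rat_degree_ratcomp[OF T(1)])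
  moreover have "rat_degree F > 0" using F rat_degree_eq_0_iff by blast
  ultimately have "rat_degree S * rat_degree T \<le> 1 * rat_degree T" "rat_degree S * rat_degree T > 0"
    by simp_all
  then have "rat_degree S = 1" unfolding mult_le_cancel2 by auto
  then obtain S' where S': "S' \<odot> S = ratvar" "rat_degree S' = 1" by (metis aut_inverse)
  have Sc: "S \<notin> range const_ratfun" using \<open>rat_degree S = 1\<close> by (rule degree_one_not_const)
  have "T = S' \<odot> F" unfolding S using S' T Sc by (simp flip: ratcomp_assoc)
  have "W \<in> K" using W by (simp add: K_def)
  then obtain H where "W = H \<odot> T" using T by blast
  then have "W = (H \<odot> S') \<odot> F"
    using \<open>T = S' \<odot> F\<close> F S' by (simp add: ratcomp_assoc degree_one_not_const)
  then show thesis by (rule that)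
qed

section \<open>Galois coverings and the order of the deck group\<close>

lemma moebius_in_aut: "a * d - b * c \<noteq> 0 \<Longrightarrow> moebius a b c d \<in> carrier aut_sphere"
  unfolding mem_aut_sphere by blast

lemma aut_sphere_two_points:
  assumes "a \<noteq> b"
  shows "\<exists>f\<in>carrier aut_sphere. f a = Fin 0 \<and> f b = Infty"
proof (cases a)
  case a: (Fin u)
  show ?thesis
  proof (cases b)
    case (Fin v)
    then show ?thesis using a assms
      by (intro bexI[of _ "moebius 1 (- u) 1 (- v)"] moebius_in_aut) auto
  next
    case Infty
    then show ?thesis using a
      by (intro bexI[of _ "moebius 1 (- u) 0 1"] moebius_in_aut) auto
  qed
next
  case a: Infty
  then obtain v where "b = Fin v" using assms by (cases b) auto
  then show ?thesis using a
    by (intro bexI[of _ "moebius 0 1 1 (- v)"] moebius_in_aut) auto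
qed

lemma degree_one_two_points:
  assumes "a \<noteq> b"
  obtains m where "rat_degree m = 1" "rat_map m a = Fin 0" "rat_map m b = Infty"
  using aut_sphere_two_points[OF assms] carrier_aut_sphere_eq that by auto

lemma infinite_sphere: "infinite (UNIV :: sphere set)"
proof
  assume "finite (UNIV :: sphere set)"
  then have "finite (range Fin)" by (rule finite_subset[OF subset_UNIV])
  moreover have "inj Fin" by (auto simp: inj_def)
  ultimately have "finite (UNIV :: complex set)" by (rule finite_imageD)
  then show False using infinite_UNIV_char_0 by blast
qed

lemma ratcomp_prod:
  "V \<notin> range const_ratfun \<Longrightarrow> prod f A \<odot> V = (\<Prod>i\<in>A. f i \<odot> V)"
  by (induction A rule: infinite_finite_induct) simp_all

text \<open>A point \<open>y\<close> of the fibre outside the orbit of \<open>x\<close> would be separated from \<open>x\<close> by the invariant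
  function \<open>\<Prod>\<gamma>. m \<circ> \<gamma>\<close>, where \<open>m\<close> is a coordinate vanishing at \<open>x\<close>.\<close>

lemma galois_covering_iff:
  "galois_covering F \<longleftrightarrow> F \<notin> range const_ratfun \<and> card (deck F) = rat_degree F"
proof safe
  fix c assume "galois_covering (const_ratfun c)"
  then show False using rat_degree_eq_0_iff[of "const_ratfun c"] by (simp add: galois_covering_def)
next
  assume gal: "galois_covering F"
  then have F: "F \<notin> range const_ratfun"
    using rat_degree_eq_0_iff[of F] by (auto simp: galois_covering_def)
  obtain B where B: "finite B"
    "\<And>w. w \<notin> B \<Longrightarrow> card {z. rat_map F (Fin z) = Fin w} = rat_degree F" using generic_fibre[OF F] by metis
  obtain w where "w \<notin> B" using infinite_complex_Diff[OF B(1)] by (metis Compl_iff ex_in_conv finite.emptyI)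
  define S where "S = {z. rat_map F (Fin z) = Fin w}"
  have S: "card S = rat_degree F" unfolding S_def using B(2) \<open>w \<notin> B\<close> by blast
  moreover have "rat_degree F > 0" using gal by (simp add: galois_covering_def)
  ultimately obtain z0 where z0: "z0 \<in> S" by fastforce
  \<comment> \<open>The orbit of one point covers a generic fibre of deg F points, so the deck group
    has at least deg F elements.\<close>
  have "Fin ` S \<subseteq> (\<lambda>\<sigma>. \<sigma> (Fin z0)) ` deck_group F"
  proof
    fix p assume "p \<in> Fin ` S"
    then have "rat_map F (Fin z0) = rat_map F p" using z0 by (auto simp: S_def simp del: rat_map.simps)
    then show "p \<in> (\<lambda>\<sigma>. \<sigma> (Fin z0)) ` deck_group F"
      using gal unfolding galois_covering_def by blast
  qed
  moreover have fin: "finite (deck_group F)"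
    unfolding rat_map_deck[symmetric] using finite_deck[OF F] by simp
  ultimately have "card (Fin ` S) \<le> card (deck_group F)"
    by (meson card_image_le card_mono finite_imageI order_trans)
  moreover have "card (Fin ` S) = card S" by (rule card_image) (auto simp: inj_on_def)
  ultimately show "card (deck F) = rat_degree F"
    using S card_deck_le[OF F] by (simp add: card_deck_group)
next
  assume F: "F \<notin> range const_ratfun" and c: "card (deck F) = rat_degree F"
  show "galois_covering F" unfolding galois_covering_def
  proof (intro conjI allI impI)
    show "rat_degree F > 0" using F rat_degree_eq_0_iff by blast
    fix x y assume xy: "rat_map F x = rat_map F y"
    show "\<exists>\<sigma>\<in>deck_group F. \<sigma> x = y"
    proof (rule ccontr)
      assume no: "\<not> ?thesis"
      have no': "rat_map \<gamma> y \<noteq> x" if \<gamma>: "\<gamma> \<in> deck F" for \<gamma>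
      proof
        assume gx: "rat_map \<gamma> y = x"
        obtain \<delta> where d: "\<delta> \<in> deck F" "\<delta> \<odot> \<gamma> = ratvar" using deck_inverse[OF \<gamma>] by blast
        have "\<gamma> \<notin> range const_ratfun" using \<gamma> degree_one_not_const by (simp add: deck_def)
        then have "rat_map \<delta> \<circ> rat_map \<gamma> = id" using d(2) rat_map_ratcomp rat_map_ratvar by metis
        then have "rat_map \<delta> x = y" using gx by (metis comp_apply id_apply)
        then show False using no d(1) rat_map_deck by blast
      qed
      have "finite ((\<lambda>\<gamma>. rat_map \<gamma> x) ` deck F \<union> (\<lambda>\<gamma>. rat_map \<gamma> y) ` deck F)"
        using finite_deck[OF F] by simp
      \<comment> \<open>Avoiding both orbits, p may be sent to infinity by m; every factor of the
        product is then finite at x and at y.\<close>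
      then obtain p where p: "p \<notin> (\<lambda>\<gamma>. rat_map \<gamma> x) ` deck F \<union> (\<lambda>\<gamma>. rat_map \<gamma> y) ` deck F"
        using infinite_sphere by (metis finite_subset subset_UNIV ex_new_if_finite)
      then have "x \<noteq> p" using ratvar_in_deck[of F] rat_map_ratvar by force
      then obtain m where m: "rat_degree m = 1" "rat_map m x = Fin 0" "rat_map m p = Infty"
        by (rule degree_one_two_points)
      have inj_m: "rat_map m a = rat_map m b \<Longrightarrow> a = b" for a b
      proof -
        obtain m' where "m' \<odot> m = ratvar" using aut_inverse[OF m(1)] by blast
        then have "rat_map m' \<circ> rat_map m = id"
          using rat_map_ratcomp[OF degree_one_not_const[OF m(1)]] rat_map_ratvar by metis
        then show "rat_map m a = rat_map m b \<Longrightarrow> a = b" by (metis comp_apply id_apply)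
      qed
      define T where "T = (\<Prod>\<gamma>\<in>deck F. m \<odot> \<gamma>)"
      have nc: "\<gamma> \<notin> range const_ratfun" if "\<gamma> \<in> deck F" for \<gamma>
        using that degree_one_not_const by (simp add: deck_def)
      have "T \<odot> \<delta> = T" if d: "\<delta> \<in> deck F" for \<delta>
      proof -
        have "T \<odot> \<delta> = (\<Prod>\<gamma>\<in>deck F. m \<odot> (\<gamma> \<odot> \<delta>))"
          unfolding T_def ratcomp_prod[OF nc[OF d]]
          by (rule prod.cong) (auto simp: ratcomp_assoc nc d)
        also have "\<dots> = T" unfolding T_def by (rule prod.reindex_bij_betw[OF bij_betw_deck_translate[OF d]])
        finally show ?thesis .
      qed
      then obtain H where H: "T = H \<odot> F" using deck_fixed_field[OF F c] by blast
      have val: "\<exists>h. rat_map T q = Fin (prod h (deck F)) \<and> (\<forall>\<gamma>\<in>deck F. rat_map m (rat_map \<gamma> q) = Fin (h \<gamma>))"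
        if q: "\<And>\<gamma>. \<gamma> \<in> deck F \<Longrightarrow> rat_map \<gamma> q \<noteq> p" for q
      proof -
        \<comment> \<open>Products are evaluated at finite points only, while q may be infinity;
          \<nu> carries 0 to q.\<close>
        obtain q' where "q \<noteq> q'" by (metis sphere.distinct(1))
        then obtain k where k: "rat_degree k = 1" "rat_map k q = Fin 0" using degree_one_two_points by metis
        obtain \<nu> where nu: "rat_degree \<nu> = 1" "\<nu> \<odot> k = ratvar" using aut_inverse[OF k(1)] by metis
        note nun = degree_one_not_const[OF nu(1)]
        have "rat_map \<nu> \<circ> rat_map k = id"
          using nu rat_map_ratcomp[OF degree_one_not_const[OF k(1)]] rat_map_ratvar by metis
        then have nu0: "rat_map \<nu> (Fin 0) = q" using k(2) by (metis comp_apply id_apply)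
        have "\<exists>h. rat_map m (rat_map \<gamma> q) = Fin h" if "\<gamma> \<in> deck F" for \<gamma>
          using q[OF that] inj_m[of "rat_map \<gamma> q" p] m(3) by (cases "rat_map m (rat_map \<gamma> q)") auto
        then obtain h where h: "\<And>\<gamma>. \<gamma> \<in> deck F \<Longrightarrow> rat_map m (rat_map \<gamma> q) = Fin (h \<gamma>)" by metis
        have "rat_map T q = rat_map (T \<odot> \<nu>) (Fin 0)"
          using nu0 by (simp add: rat_map_ratcomp[OF nun] del: rat_map.simps)
        also have "T \<odot> \<nu> = (\<Prod>\<gamma>\<in>deck F. m \<odot> \<gamma> \<odot> \<nu>)" unfolding T_def by (rule ratcomp_prod[OF nun])
        also have "rat_map \<dots> (Fin 0) = Fin (prod h (deck F))"
          by (rule rat_map_prod)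
            (use h nu0 in \<open>simp add: rat_map_ratcomp[OF nun] rat_map_ratcomp[OF nc] del: rat_map.simps\<close>)
        finally show ?thesis using h by blast
      qed
      obtain h where h: "rat_map T x = Fin (prod h (deck F))"
        "\<And>\<gamma>. \<gamma> \<in> deck F \<Longrightarrow> rat_map m (rat_map \<gamma> x) = Fin (h \<gamma>)" using val[of x] p by blast
      have "h ratvar = 0" using h(2)[OF ratvar_in_deck] m(2) by (simp add: rat_map_ratvar del: rat_map.simps)
      then have "rat_map T x = Fin 0" using h(1) ratvar_in_deck finite_deck[OF F] prod_zero by metis
      moreover obtain g where g: "rat_map T y = Fin (prod g (deck F))"
        "\<And>\<gamma>. \<gamma> \<in> deck F \<Longrightarrow> rat_map m (rat_map \<gamma> y) = Fin (g \<gamma>)" using val[of y] p by blast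
      moreover have "g \<gamma> \<noteq> 0" if "\<gamma> \<in> deck F" for \<gamma>
        using no'[OF that] inj_m[of "rat_map \<gamma> y" x] g(2)[OF that] m(2) by auto
      then have "prod g (deck F) \<noteq> 0" using finite_deck[OF F] by (simp add: prod_zero_iff)
      moreover have "rat_map T x = rat_map T y"
        unfolding H rat_map_ratcomp[OF F] using xy by (simp del: rat_map.simps)
      ultimately show False by simp
    qed
  qed
qed

section \<open>Splitting of the fibre polynomial\<close>

interpretation ac: complex_embedding "\<lambda>c. to_ac (const_ratfun c)"
  by standard simp_all

lemma to_ac_ratcomp:
  assumes V: "V \<notin> range const_ratfun"
  shows "to_ac (F \<odot> V) = ac.ev (to_ac V) F"
proof -
  have "to_ac (F \<odot> V) = ac.ev (to_ac (ratvar \<odot> V)) F"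
    by (rule ac.ev_unique[where h = "\<lambda>F. to_ac (F \<odot> V)"]) (use V in auto)
  then show ?thesis using V by simp
qed

text \<open>In the algebraic closure the fibre polynomial has deg F distinct roots: a double root
  would annihilate the Wronskian, a nonzero complex polynomial, but no root is constant. The
  assumption \<open>split\<close> puts all roots into C(z), where they are deck
  transformations.\<close>

lemma card_deck_eq_degree:
  assumes F: "F \<notin> range const_ratfun"
    and split: "\<And>t. t \<notin> range (\<lambda>c. to_ac (const_ratfun c)) \<Longrightarrow> ac.ev t F = to_ac F \<Longrightarrow> t \<in> range to_ac"
  shows "card (deck F) = rat_degree F"
proof -
  define f where "f = map_poly to_ac (fibre_poly F)"
  have deg: "degree f = rat_degree F"
    unfolding f_def degree_fibre_poly[OF F, symmetric] by (rule degree_map_poly) simp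
  have f_to_ac: "poly f (to_ac m) = to_ac (poly (fibre_poly F) m)" for m
  proof -
    have "poly (map_poly to_ac p) (to_ac m) = to_ac (poly p m)" for p
      by (induction p) (simp_all add: map_poly_pCons)
    then show ?thesis by (simp add: f_def)
  qed
  have f_alt: "f = map_poly (\<lambda>c. to_ac (const_ratfun c)) (numer F)
      - smult (to_ac F) (map_poly (\<lambda>c. to_ac (const_ratfun c)) (denom F))"
    by (rule poly_eqI) (simp add: f_def fibre_poly_def coeff_map_poly)
  have ft: "poly f t = ac.pev t (numer F) - to_ac F * ac.pev t (denom F)" for t
    by (simp add: f_alt ac.pev_def)
  have pd: "pderiv (map_poly (\<lambda>c. to_ac (const_ratfun c)) p) = map_poly (\<lambda>c. to_ac (const_ratfun c)) (pderiv p)" for p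
  proof (induction p)
    case (pCons a p)
    have "map_poly (\<lambda>c. to_ac (const_ratfun c)) (p + q) =
        map_poly (\<lambda>c. to_ac (const_ratfun c)) p + map_poly (\<lambda>c. to_ac (const_ratfun c)) q" for p q
      by (rule poly_eqI) (simp add: coeff_map_poly)
    then show ?case using pCons by (simp add: pderiv_pCons map_poly_pCons)
  qed simp
  have dft: "poly (pderiv f) t = ac.pev t (pderiv (numer F)) - to_ac F * ac.pev t (pderiv (denom F))" for t
    by (simp add: f_alt pderiv_diff pderiv_smult pd ac.pev_def)
  have "f \<noteq> 0"
    using deg F rat_degree_eq_0_iff[of F] by auto
  have nc: "t \<notin> range (\<lambda>c. to_ac (const_ratfun c))" if "poly f t = 0" for t
    using that f_to_ac poly_fibre_poly_const[OF F] by auto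
  have "poly (pderiv f) t \<noteq> 0" if t: "poly f t = 0" for t
  proof
    assume "poly (pderiv f) t = 0"
    then have "ac.pev t (pderiv (numer F)) = to_ac F * ac.pev t (pderiv (denom F))" by (simp add: dft)
    moreover have "ac.pev t (numer F) = to_ac F * ac.pev t (denom F)" using t by (simp add: ft)
    ultimately have "ac.pev t (pderiv (numer F) * denom F) = ac.pev t (numer F * pderiv (denom F))" by simp
    moreover define W where "W = pderiv (numer F) * denom F - numer F * pderiv (denom F)"
    have "pderiv (numer F) * denom F = W + numer F * pderiv (denom F)" by (simp add: W_def)
    ultimately have "ac.pev t W = 0" by (metis ac.pev_add add_cancel_left_left)
    then show False using ac.pev_nonzero[OF nc[OF t]] wronskian_nonzero[OF F] unfolding W_def by blast
  qed
  then have card: "card {t. poly f t = 0} = rat_degree F"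
    unfolding deg[symmetric] by (rule card_roots_squarefree[OF \<open>f \<noteq> 0\<close>])
  have "{t. poly f t = 0} = to_ac ` deck F"
  proof (intro equalityI subsetI)
    fix t assume "t \<in> {t. poly f t = 0}"
    then have t: "poly f t = 0" by simp
    have "ac.pev t (denom F) \<noteq> 0" by (rule ac.pev_nonzero[OF nc[OF t] denom_nonzero])
    then have "ac.ev t F = to_ac F" using t by (simp add: ft ac.ev_def field_simps)
    then obtain m where m: "t = to_ac m" using split[OF nc[OF t]] by blast
    then have "m \<in> deck F" using t f_to_ac poly_fibre_poly_eq_0_iff[OF F] by simp
    then show "t \<in> to_ac ` deck F" using m by blast
  qed (use f_to_ac poly_fibre_poly_eq_0_iff[OF F] in auto)
  then show ?thesis using card card_image[of to_ac "deck F"] inj_to_ac by (metis inj_on_subset subset_UNIV)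
qed

section \<open>Finite groups of Moebius transformations\<close>

abbreviation finv :: "('a \<Rightarrow> 'b) \<Rightarrow> 'b \<Rightarrow> 'a" where "finv \<equiv> inv_into UNIV"

lemma aut_comp: "f \<in> carrier aut_sphere \<Longrightarrow> g \<in> carrier aut_sphere \<Longrightarrow> f \<circ> g \<in> carrier aut_sphere"
  using monoid.m_closed[OF group.is_monoid[OF group_aut_sphere], of f g] by (simp add: aut_sphere_def)

lemma aut_id: "id \<in> carrier aut_sphere"
  using monoid.one_closed[OF group.is_monoid[OF group_aut_sphere]] by (simp add: aut_sphere_def)

lemma aut_inv:
  assumes "f \<in> carrier aut_sphere"
  shows "finv f \<in> carrier aut_sphere" "finv f \<circ> f = id" "f \<circ> finv f = id" "bij f"
proof -
  obtain g where g: "g \<in> carrier aut_sphere" "g \<circ> f = id" "f \<circ> g = id"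
    by (rule aut_sphere_inverse[OF assms])
  then show b: "bij f" by (metis o_bij)
  have "finv f = g" using g by (metis inv_unique_comp)
  then show "finv f \<in> carrier aut_sphere" "finv f \<circ> f = id" "f \<circ> finv f = id" using g by simp_all
qed

lemma aut_inv_apply:
  assumes "f \<in> carrier aut_sphere"
  shows "finv f (f x) = x" "f (finv f x) = x" "f x = f y \<longleftrightarrow> x = y"
  using aut_inv[OF assms] by (metis comp_apply id_apply)+

section \<open>Affine maps and rotations\<close>

lemma aut_fix_Infty:
  assumes "f \<in> carrier aut_sphere" "f Infty = Infty"
  obtains a b where "a \<noteq> 0" "\<And>z. f (Fin z) = Fin (a * z + b)" "f = moebius a b 0 1"
proof -
  obtain a b c d where f: "f = moebius a b c d" "a * d - b * c \<noteq> 0"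
    using assms(1) unfolding mem_aut_sphere by blast
  then have c: "c = 0" using assms(2) by (auto split: if_splits)
  then have d: "d \<noteq> 0" "a \<noteq> 0" using f by auto
  have "f = moebius (d * (a / d)) (d * (b / d)) (d * 0) (d * 1)" using f c d by simp
  then have "f = moebius (a / d) (b / d) 0 1" using d moebius_scale by metis
  then show thesis using that[of "a / d" "b / d"] d by simp
qed

definition rot :: "complex \<Rightarrow> sphere \<Rightarrow> sphere" where
  "rot a = moebius a 0 0 1"

lemma rot_simps [simp]: "rot a Infty = Infty" "rot a (Fin z) = Fin (a * z)"
  by (simp_all add: rot_def)

lemma sphere_fun_eqI: "f Infty = g Infty \<Longrightarrow> (\<And>z. f (Fin z) = g (Fin z)) \<Longrightarrow> f = g"
  using sphere.exhaust by (metis ext)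

lemma rot_comp: "rot a \<circ> rot b = rot (a * b)"
  by (rule sphere_fun_eqI) simp_all

lemma rot_1: "rot 1 = id"
  by (rule sphere_fun_eqI) simp_all

lemma rot_inject: "rot a = rot b \<longleftrightarrow> a = b"
  by (metis mult.right_neutral rot_simps(2) sphere.inject)

lemma rot_aut: "a \<noteq> 0 \<Longrightarrow> rot a \<in> carrier aut_sphere"
  unfolding rot_def by (rule moebius_in_aut) simp

lemma aut_fix_Infty_0:
  assumes "f \<in> carrier aut_sphere" "f Infty = Infty" "f (Fin 0) = Fin 0"
  obtains a where "a \<noteq> 0" "f = rot a"
proof -
  obtain a b where ab: "a \<noteq> 0" "\<And>z. f (Fin z) = Fin (a * z + b)" "f = moebius a b 0 1"
    using aut_fix_Infty[OF assms(1,2)] by metis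
  then have "b = 0" using assms(3) by simp
  then show thesis using that[of a] ab by (simp add: rot_def)
qed

text \<open>Finite subgroups in terms of composition and inverse functions, so that the geometry can
  argue with maps. \<open>mgroup_imp_subgroup\<close> and \<open>mgroup_generate\<close> connect
  this with HOL-Algebra.\<close>

definition mgroup :: "(sphere \<Rightarrow> sphere) set \<Rightarrow> bool" where
  "mgroup G \<longleftrightarrow> finite G \<and> G \<subseteq> carrier aut_sphere \<and> id \<in> G \<and>
     (\<forall>f\<in>G. \<forall>g\<in>G. f \<circ> g \<in> G) \<and> (\<forall>f\<in>G. finv f \<in> G)"

lemma mgroupD:
  assumes "mgroup G"
  shows "finite G" "f \<in> G \<Longrightarrow> f \<in> carrier aut_sphere" "id \<in> G" "f \<in> G \<Longrightarrow> g \<in> G \<Longrightarrow> f \<circ> g \<in> G"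
    "f \<in> G \<Longrightarrow> finv f \<in> G"
  using assms by (auto simp: mgroup_def)

lemma mgroup_funpow: "mgroup G \<Longrightarrow> f \<in> G \<Longrightarrow> f ^^ k \<in> G"
  by (induction k) (auto dest: mgroupD)

section \<open>Conjugates, stabilisers and orbits\<close>

definition cj :: "(sphere \<Rightarrow> sphere) \<Rightarrow> (sphere \<Rightarrow> sphere) set \<Rightarrow> (sphere \<Rightarrow> sphere) set" where
  "cj m G = (\<lambda>f. m \<circ> f \<circ> finv m) ` G"

definition stab :: "(sphere \<Rightarrow> sphere) set \<Rightarrow> sphere \<Rightarrow> (sphere \<Rightarrow> sphere) set" where
  "stab G p = {f \<in> G. f p = p}"

definition orb :: "(sphere \<Rightarrow> sphere) set \<Rightarrow> sphere \<Rightarrow> sphere set" where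
  "orb G p = (\<lambda>f. f p) ` G"

lemma cj_comp:
  assumes "m \<in> carrier aut_sphere" "m' \<in> carrier aut_sphere"
  shows "cj (m \<circ> m') G = cj m (cj m' G)"
proof -
  have "finv (m \<circ> m') = finv m' \<circ> finv m" using assms by (simp add: aut_inv o_inv_distrib)
  then show ?thesis by (simp add: cj_def image_image comp_assoc)
qed

lemma cj_id: "cj id G = G" by (simp add: cj_def)

lemma cj_inv: "m \<in> carrier aut_sphere \<Longrightarrow> cj (finv m) (cj m G) = G"
  by (metis aut_inv(1,2) cj_comp cj_id)

lemma cj_comm:
  assumes "m \<in> carrier aut_sphere" "\<And>f. f \<in> G \<Longrightarrow> m \<circ> f = f \<circ> m"
  shows "cj m G = G"
proof -
  have "m \<circ> f \<circ> finv m = f" if "f \<in> G" for f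
    by (metis assms that aut_inv(3) comp_assoc comp_id)
  then show ?thesis by (simp add: cj_def)
qed

lemma inj_on_cj: "m \<in> carrier aut_sphere \<Longrightarrow> inj_on (\<lambda>f. m \<circ> f \<circ> finv m) G"
proof (rule inj_onI)
  fix f g assume m: "m \<in> carrier aut_sphere" and eq: "m \<circ> f \<circ> finv m = m \<circ> g \<circ> finv m"
  show "f = g"
  proof
    fix x show "f x = g x"
      using fun_cong[OF eq, of "m x"] by (simp add: aut_inv_apply[OF m])
  qed
qed

lemma card_cj: "m \<in> carrier aut_sphere \<Longrightarrow> card (cj m G) = card G"
  unfolding cj_def by (rule card_image[OF inj_on_cj])

lemma mgroup_cj:
  assumes m: "m \<in> carrier aut_sphere" and G: "mgroup G"
  shows "mgroup (cj m G)"
  unfolding mgroup_def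
proof (intro conjI ballI)
  show "finite (cj m G)" using G by (simp add: cj_def mgroup_def)
  show "cj m G \<subseteq> carrier aut_sphere"
    using m G aut_comp aut_inv(1) by (auto simp: cj_def mgroup_def)
  show "id \<in> cj m G" unfolding cj_def
    using m G by (intro image_eqI[of _ _ id]) (auto simp: aut_inv mgroup_def)
next
  fix f g assume "f \<in> cj m G" "g \<in> cj m G"
  then obtain f' g' where fg: "f = m \<circ> f' \<circ> finv m" "g = m \<circ> g' \<circ> finv m" "f' \<in> G" "g' \<in> G"
    by (auto simp: cj_def)
  have "f \<circ> g = m \<circ> (f' \<circ> g') \<circ> finv m"
    using aut_inv_apply[OF m] by (auto simp: fg)
  then show "f \<circ> g \<in> cj m G" using fg mgroupD(4)[OF G] unfolding cj_def by blast
next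
  fix f assume "f \<in> cj m G"
  then obtain f' where f: "f = m \<circ> f' \<circ> finv m" "f' \<in> G" by (auto simp: cj_def)
  have "(m \<circ> finv f' \<circ> finv m) \<circ> f = id" "f \<circ> (m \<circ> finv f' \<circ> finv m) = id"
    using aut_inv_apply[OF m] aut_inv_apply[OF mgroupD(2)[OF G f(2)]] by (auto simp: f)
  then have "finv f = m \<circ> finv f' \<circ> finv m" by (metis inv_unique_comp)
  then show "finv f \<in> cj m G" using mgroupD(5)[OF G f(2)] unfolding cj_def by blast
qed

lemma stab_cj:
  assumes "m \<in> carrier aut_sphere"
  shows "stab (cj m G) (m p) = cj m (stab G p)"
  using aut_inv_apply[OF assms] by (auto simp: stab_def cj_def)

lemma orb_cj:
  assumes "m \<in> carrier aut_sphere"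
  shows "orb (cj m G) (m p) = m ` orb G p"
  using aut_inv_apply[OF assms] by (auto simp: orb_def cj_def image_image)

lemma card_stab_cj:
  assumes "m \<in> carrier aut_sphere"
  shows "card (stab (cj m G) p) = card (stab G (finv m p))"
  using stab_cj[OF assms, of G "finv m p"] card_cj[OF assms, of "stab G (finv m p)"]
  by (simp add: aut_inv_apply[OF assms])

lemma aut_has_fixed_point:
  assumes "f \<in> carrier aut_sphere"
  obtains p where "f p = p"
proof -
  obtain a b c d where f: "f = moebius a b c d" "a * d - b * c \<noteq> 0"
    using assms unfolding mem_aut_sphere by blast
  show thesis
  proof (cases "c = 0")
    case True
    then show ?thesis using that[of Infty] f by simp
  next
    case False
    \<comment> \<open>Finite fixed points are the roots of c z^2 + (d - a) z - b.\<close>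
    then have "degree [:- b, d - a, c:] > 0" by simp
    then obtain z where z: "poly [:- b, d - a, c:] z = 0"
      using alg_closed_imp_poly_has_root by blast
    then have eq: "a * z + b = z * (c * z + d)" by (simp add: algebra_simps)
    have "c * z + d \<noteq> 0"
    proof
      assume 0: "c * z + d = 0"
      then have "a * z + b = 0" using eq by simp
      then have "b = - (a * z)" "d = - (c * z)" using 0 minus_unique by metis+
      then have "a * d - b * c = 0" by simp
      then show False using f by simp
    qed
    then have "f (Fin z) = Fin z" using f eq by (simp add: field_simps)
    then show ?thesis using that by blast
  qed
qed

text \<open>Otherwise f is a translation by some b \<noteq> 0, and its powers move 0 to the
  infinitely many points k b.\<close>

lemma mgroup_no_translation:
  assumes G: "mgroup G" and f: "f \<in> G" "f \<noteq> id" and ab: "\<And>z. f (Fin z) = Fin (a * z + b)" "f Infty = Infty"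
  shows "a \<noteq> 1"
proof
  assume a: "a = 1"
  have pow: "(f ^^ k) (Fin 0) = Fin (of_nat k * b)" for k
    by (induction k) (simp_all add: ab a algebra_simps)
  have "b \<noteq> 0"
  proof
    assume "b = 0"
    then have "f = id" using ab a by (intro sphere_fun_eqI) simp_all
    then show False using f by simp
  qed
  then have "inj (\<lambda>k. f ^^ k)"
    using pow by (intro injI) (metis mult_cancel_right of_nat_eq_iff sphere.inject)
  moreover have "range (\<lambda>k. f ^^ k) \<subseteq> G" using mgroup_funpow[OF G f(1)] by blast
  ultimately show False using mgroupD(1)[OF G] by (metis finite_subset finite_imageD infinite_UNIV_nat)
qed

text \<open>Moving one fixed point to infinity makes f affine, z -> a z + b, with a \<noteq> 1 since
  the group is finite. The only other fixed point is then b / (1 - a).\<close>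

lemma mgroup_fixed_points:
  assumes G: "mgroup G" and f: "f \<in> G" "f \<noteq> id"
  shows "card {p. f p = p} = 2"
proof -
  obtain p where p: "f p = p" using aut_has_fixed_point[OF mgroupD(2)[OF G f(1)]] by blast
  obtain q where "q \<noteq> p" by (metis sphere.distinct(1))
  then obtain m where m: "m \<in> carrier aut_sphere" "m p = Infty" using aut_sphere_two_points by metis
  define g where "g = m \<circ> f \<circ> finv m"
  have g: "g \<in> cj m G" using f by (auto simp: g_def cj_def)
  have "g Infty = Infty" using p m aut_inv_apply(1)[OF m(1), of p] by (simp add: g_def)
  moreover have "g \<noteq> id"
  proof
    assume gid: "g = id"
    have "f x = x" for x
      using fun_cong[OF gid, of "m x"] by (simp add: g_def aut_inv_apply[OF m(1)])
    then show False using f by auto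
  qed
  ultimately obtain a b where ab: "\<And>z. g (Fin z) = Fin (a * z + b)" "a \<noteq> 1" "g Infty = Infty"
    by (metis aut_fix_Infty g mgroupD(2) mgroup_cj[OF m(1) G] mgroup_no_translation)
  have "{p. g p = p} = {Infty, Fin (b / (1 - a))}"
  proof -
    have "g (Fin z) = Fin z \<longleftrightarrow> z = b / (1 - a)" for z
      using ab by (auto simp: field_simps)
    then show ?thesis using ab(3) by (auto, metis sphere.exhaust)
  qed
  moreover have "{p. g p = p} = m ` {p. f p = p}"
  proof -
    have "x \<in> m ` {p. f p = p}" if "g x = x" for x
    proof (rule image_eqI[of _ _ "finv m x"])
      show "x = m (finv m x)" by (simp add: aut_inv_apply[OF m(1)])
      have "m (f (finv m x)) = x" using that by (simp add: g_def)
      then have "finv m (m (f (finv m x))) = finv m x" by simp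
      then show "finv m x \<in> {p. f p = p}" by (simp add: aut_inv_apply(1)[OF m(1)])
    qed
    moreover have "g (m y) = m y" if "f y = y" for y
      using that by (simp add: g_def aut_inv_apply(1)[OF m(1)])
    ultimately show ?thesis by blast
  qed
  moreover have "card (m ` {p. f p = p}) = card {p. f p = p}"
    by (rule card_image) (simp add: inj_on_def aut_inv_apply[OF m(1)])
  ultimately show ?thesis by simp
qed

subsection \<open>Counting orbits\<close>

lemma orbit_stabilizer:
  assumes G: "mgroup G"
  shows "card G = card (orb G p) * card (stab G p)"
proof -
  have fin: "finite (orb G p)" using mgroupD(1)[OF G] by (simp add: orb_def)
  have fib: "card {f \<in> G. f p = q} = card (stab G p)" if q: "q \<in> orb G p" for q
  proof -
    obtain g where g: "g \<in> G" "g p = q" using q unfolding orb_def by blast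
    note ga = aut_inv_apply[OF mgroupD(2)[OF G g(1)]]
    have "bij_betw (\<lambda>f. g \<circ> f) (stab G p) {f \<in> G. f p = q}"
    proof (rule bij_betw_byWitness[where f' = "\<lambda>f. finv g \<circ> f"])
      show "\<forall>a\<in>stab G p. finv g \<circ> (g \<circ> a) = a" by (simp add: fun_eq_iff ga(1))
      show "\<forall>a\<in>{f \<in> G. f p = q}. g \<circ> (finv g \<circ> a) = a" by (simp add: fun_eq_iff ga(2))
      show "(\<lambda>f. g \<circ> f) ` stab G p \<subseteq> {f \<in> G. f p = q}"
        using g mgroupD(4)[OF G] by (auto simp: stab_def)
      have "finv g q = p" using ga(1)[of p] unfolding g(2) .
      then have "finv g \<circ> f \<in> stab G p" if "f \<in> G" "f p = q" for f
        using mgroupD(4)[OF G mgroupD(5)[OF G g(1)] that(1)] that(2) unfolding stab_def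
        by simp
      then show "(\<lambda>f. finv g \<circ> f) ` {f \<in> G. f p = q} \<subseteq> stab G p" by blast
    qed
    then show ?thesis by (rule bij_betw_same_card[symmetric])
  qed
  have "G = (\<Union>q\<in>orb G p. {f \<in> G. f p = q})" by (auto simp: orb_def)
  then have "card G = card (\<Union>q\<in>orb G p. {f \<in> G. f p = q})" by simp
  also have "\<dots> = (\<Sum>q\<in>orb G p. card {f \<in> G. f p = q})"
    by (rule card_UN_disjoint) (use fin mgroupD(1)[OF G] in auto)
  also have "\<dots> = (\<Sum>q\<in>orb G p. card (stab G p))" using fib by simp
  finally show ?thesis by simp
qed

lemma orb_eq:
  assumes G: "mgroup G" and q: "q \<in> orb G p"
  shows "orb G q = orb G p"
proof -
  obtain g where g: "g \<in> G" "g p = q" using q unfolding orb_def by blast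
  have "f q \<in> orb G p" if "f \<in> G" for f
    using mgroupD(4)[OF G that g(1)] g(2) unfolding orb_def by (metis comp_apply image_eqI)
  moreover have "f p \<in> orb G q" if "f \<in> G" for f
  proof -
    have "p = finv g q" using aut_inv_apply(1)[OF mgroupD(2)[OF G g(1)], of p] g(2) by simp
    then show ?thesis
      using mgroupD(4)[OF G that mgroupD(5)[OF G g(1)]] unfolding orb_def by (metis comp_apply image_eqI)
  qed
  ultimately show ?thesis by (auto simp: orb_def)
qed

lemma self_in_orb: "mgroup G \<Longrightarrow> p \<in> orb G p"
  unfolding orb_def by (rule image_eqI[of _ _ id]) (auto dest: mgroupD)

lemma id_in_stab: "mgroup G \<Longrightarrow> id \<in> stab G p"
  by (auto simp: stab_def dest: mgroupD)

text \<open>Pairs of a nontrivial f and a fixed point of f are counted twice. Each f contributes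
  two; an orbit with stabilisers of order s contributes |Ob| (s - 1) = |G| - |Ob|. This is the
  Riemann-Hurwitz formula for the quotient by G.\<close>

lemma orbit_count:
  assumes G: "mgroup G" and n: "card G \<ge> 2"
  defines "Q \<equiv> orb G ` {p. card (stab G p) \<ge> 2}"
  shows "finite Q" "(\<Sum>Ob\<in>Q. card G - card Ob) = 2 * (card G - 1)"
proof -
  note fin = mgroupD(1)[OF G]
  define P where "P = {p. card (stab G p) \<ge> 2}"
  have fs: "finite (stab G p)" for p using fin by (simp add: stab_def)
  have fix_fin: "finite {p. f p = p}" if "f \<in> G - {id}" for f
    using mgroup_fixed_points[OF G, of f] that by (metis DiffE card.infinite insertI1 zero_neq_numeral)
  have PU: "P = (\<Union>f\<in>G - {id}. {p. f p = p})"
  proof -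
    have "card (stab G p) \<ge> 2 \<longleftrightarrow> (\<exists>f\<in>G - {id}. f p = p)" for p
    proof
      assume "card (stab G p) \<ge> 2"
      then have "card (stab G p - {id}) \<ge> 1" using id_in_stab[OF G, of p] fs by simp
      then have "stab G p - {id} \<noteq> {}" by force
      then show "\<exists>f\<in>G - {id}. f p = p" by (auto simp: stab_def)
    next
      assume "\<exists>f\<in>G - {id}. f p = p"
      then obtain f where "f \<in> G" "f \<noteq> id" "f p = p" by auto
      then have "{id, f} \<subseteq> stab G p" using id_in_stab[OF G, of p] by (simp add: stab_def)
      then have "card {id, f} \<le> card (stab G p)" by (rule card_mono[OF fs])
      moreover have "card {id, f} = 2" using \<open>f \<noteq> id\<close> by (metis card_2_iff)
      ultimately show "card (stab G p) \<ge> 2" by simp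
    qed
    then show ?thesis unfolding P_def by auto
  qed
  have finP: "finite P" unfolding PU using fin fix_fin by blast
  then show finQ: "finite Q" unfolding Q_def P_def by simp
  have "(\<Sum>f\<in>G - {id}. card {p \<in> P. f p = p}) = (\<Sum>p\<in>P. card {f \<in> G - {id}. f p = p})"
  proof -
    have "(\<Sum>f\<in>G - {id}. card {p \<in> P. f p = p}) = (\<Sum>f\<in>G - {id}. \<Sum>p\<in>P. of_bool (f p = p))"
      using finP by (intro sum.cong) (simp_all add: sum.If_cases of_bool_def Int_def)
    also have "\<dots> = (\<Sum>p\<in>P. \<Sum>f\<in>G - {id}. of_bool (f p = p))" by (rule sum.swap)
    also have "\<dots> = (\<Sum>p\<in>P. card {f \<in> G - {id}. f p = p})"
      using fin by (intro sum.cong) (simp_all add: sum.If_cases of_bool_def Int_def)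
    finally show ?thesis .
  qed
  moreover have "card {p \<in> P. f p = p} = 2" if "f \<in> G - {id}" for f
  proof -
    have "{p \<in> P. f p = p} = {p. f p = p}" using that unfolding PU by blast
    then show ?thesis using mgroup_fixed_points[OF G, of f] that by simp
  qed
  moreover have "card {f \<in> G - {id}. f p = p} = card (stab G p) - 1" for p
  proof -
    have "{f \<in> G - {id}. f p = p} = stab G p - {id}" by (auto simp: stab_def)
    then show ?thesis using id_in_stab[OF G, of p] fs by simp
  qed
  ultimately have dc: "2 * (card G - 1) = (\<Sum>p\<in>P. card (stab G p) - 1)"
    using mgroupD(3)[OF G] by simp
  have orbP: "Ob \<subseteq> P" and orbc: "\<And>p. p \<in> Ob \<Longrightarrow> orb G p = Ob" if Ob: "Ob \<in> Q" for Ob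
  proof -
    obtain p where p: "Ob = orb G p" "card (stab G p) \<ge> 2" using Ob by (auto simp: Q_def)
    show e: "\<And>q. q \<in> Ob \<Longrightarrow> orb G q = Ob" using p orb_eq[OF G] by simp
    show "Ob \<subseteq> P"
    proof
      fix q assume "q \<in> Ob"
      then have "card (orb G p) * card (stab G q) = card (orb G p) * card (stab G p)"
        using e p orbit_stabilizer[OF G] by metis
      moreover have "card (orb G p) \<noteq> 0" using orbit_stabilizer[OF G, of p] n by (metis mult_0 not_numeral_le_zero)
      ultimately show "q \<in> P" using p by (simp add: P_def)
    qed
  qed
  have PQ: "P = \<Union> Q" using orbP self_in_orb[OF G] unfolding Q_def P_def by blast
  have "(\<Sum>p\<in>P. card (stab G p) - 1) = (\<Sum>Ob\<in>Q. \<Sum>p\<in>Ob. card (stab G p) - 1)"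
    unfolding PQ
  proof (rule sum.Union_disjoint[unfolded comp_def])
    show "\<forall>A\<in>Q. finite A" using orbP finP finite_subset by blast
    show "\<forall>A\<in>Q. \<forall>B\<in>Q. A \<noteq> B \<longrightarrow> A \<inter> B = {}" using orbc by blast
  qed
  also have "\<dots> = (\<Sum>Ob\<in>Q. card G - card Ob)"
  proof (rule sum.cong[OF refl])
    fix Ob assume Ob: "Ob \<in> Q"
    then obtain p where p: "Ob = orb G p" by (auto simp: Q_def)
    have ne: "card Ob \<noteq> 0" using orbit_stabilizer[OF G, of p] n p by (metis mult_0 not_numeral_le_zero)
    have "card (stab G q) = card (stab G p)" if "q \<in> Ob" for q
      using orbit_stabilizer[OF G, of p] orbit_stabilizer[OF G, of q] orbc[OF Ob that] ne p
      by (metis mult_cancel1)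
    then have "(\<Sum>p\<in>Ob. card (stab G p) - 1) = card Ob * (card (stab G p) - 1)" by simp
    also have "\<dots> = card G - card Ob" using orbit_stabilizer[OF G, of p] p by (simp add: right_diff_distrib')
    finally show "(\<Sum>p\<in>Ob. card (stab G p) - 1) = card G - card Ob" .
  qed
  finally show "(\<Sum>Ob\<in>Q. card G - card Ob) = 2 * (card G - 1)" using dc by simp
qed

text \<open>Divided by N = |G|, the orbit count says that the numbers 1 - 1/s, over the orbits with
  stabilisers of order s \<ge> 2, sum to 2 - 2/N. Each is at least 1/2 and below 1, so there are two
  or three orbits. Two give N = k; three leave the orders (2, 2, k), (2, 3, 3), (2, 3, 4) and (2, 3,
  5).\<close>

lemma mgroup_orders:
  assumes G: "mgroup G" and n: "card G \<ge> 2"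
    and k: "card (stab G p) = k" "\<And>q. card (stab G q) \<le> k"
  shows "k \<ge> 2" and "card G = k \<or> card G = 2 * k \<or> (k, card G) \<in> {(3, 12), (4, 24), (5, 60)}"
proof -
  define Q where "Q = orb G ` {p. card (stab G p) \<ge> 2}"
  note oc = orbit_count[OF G n, folded Q_def]
  define N where "N = card G"
  have sz: "\<exists>s. card Ob * s = N \<and> s \<ge> 2 \<and> s \<le> k \<and> card Ob \<ge> 1" if Ob: "Ob \<in> Q" for Ob
  proof -
    obtain q where q: "Ob = orb G q" "card (stab G q) \<ge> 2" using Ob by (auto simp: Q_def)
    have eq: "card Ob * card (stab G q) = N" using orbit_stabilizer[OF G, of q] q by (simp add: N_def)
    then have "card Ob \<ge> 1" using n by (cases "card Ob") (auto simp: N_def)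
    then show ?thesis using eq q k by blast
  qed
  have N2: "N \<ge> 2" using n by (simp add: N_def)
  have "Q \<noteq> {}" using oc(2) N2 unfolding N_def by auto
  then obtain q where "q \<in> Q" by blast
  then show k2: "k \<ge> 2" using sz[of q] by auto
  define O0 where "O0 = orb G p"
  have O0: "O0 \<in> Q" unfolding O0_def Q_def using k(1) k2 by blast
  have c0: "card O0 * k = N" unfolding O0_def N_def using orbit_stabilizer[OF G, of p] k(1) by simp
  define A where "A = (\<Sum>Ob\<in>Q - {O0}. N - card Ob)"
  have sum: "(N - card O0) + A = 2 * (N - 1)"
    using oc(2) sum.remove[OF oc(1) O0, of "\<lambda>Ob. N - card Ob"] by (simp add: A_def N_def)
  have bnd: "N \<le> 2 * (N - card Ob) \<and> N - card Ob < N" if Ob: "Ob \<in> Q" for Ob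
  proof -
    obtain s where "card Ob * s = N" "s \<ge> 2" "card Ob \<ge> 1" using sz[OF Ob] by blast
    moreover have "card Ob * 2 \<le> card Ob * s" using \<open>s \<ge> 2\<close> by simp
    ultimately show ?thesis using N2 by linarith
  qed
  have fQ: "finite (Q - {O0})" using oc(1) by simp
  have "(\<Sum>Ob\<in>Q - {O0}. N) \<le> (\<Sum>Ob\<in>Q - {O0}. 2 * (N - card Ob))"
    by (rule sum_mono) (use bnd in auto)
  then have up: "card (Q - {O0}) * N \<le> 2 * A" by (simp add: A_def sum_distrib_left)
  have c0b: "N \<le> 2 * (N - card O0)" "N - card O0 < N" using bnd[OF O0] by auto
  have "card (Q - {O0}) < 3"
  proof (rule ccontr)
    assume "\<not> card (Q - {O0}) < 3"
    then have "3 * N \<le> card (Q - {O0}) * N" by simp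
    then show False using up sum c0b N2 by linarith
  qed
  moreover have "card (Q - {O0}) \<noteq> 0"
  proof
    assume "card (Q - {O0}) = 0"
    then have e: "Q - {O0} = {}" using fQ by (simp only: card_0_eq)
    have "A = 0" unfolding A_def e by simp
    then show False using sum c0b N2 by linarith
  qed
  ultimately consider "card (Q - {O0}) = 1" | "card (Q - {O0}) = 2" by linarith
  then show "card G = k \<or> card G = 2 * k \<or> (k, card G) \<in> {(3, 12), (4, 24), (5, 60)}"
  proof cases
    case 1
    then obtain O1 where O1: "Q - {O0} = {O1}" by (metis card_1_singletonE)
    then have "(N - card O0) + (N - card O1) = 2 * (N - 1)" using sum by (simp add: A_def)
    moreover have "O1 \<in> Q" using O1 by blast
    then have "card O1 \<ge> 1" "card O0 \<ge> 1" using sz[of O1] sz[OF O0] by auto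
    ultimately have "card O0 = 1" using N2 by linarith
    then show ?thesis using c0 by (simp add: N_def)
  next
    case 2
    then obtain O1 O2 where O12: "Q - {O0} = {O1, O2}" "O1 \<noteq> O2" by (meson card_2_iff)
    then have s: "(N - card O0) + ((N - card O1) + (N - card O2)) = 2 * (N - 1)" using sum by (simp add: A_def)
    have Q12: "O1 \<in> Q" "O2 \<in> Q" using O12 by auto
    obtain s1 where s1: "card O1 * s1 = N" "s1 \<ge> 2" "s1 \<le> k" using sz[OF Q12(1)] by blast
    obtain s2 where s2: "card O2 * s2 = N" "s2 \<ge> 2" "s2 \<le> k" using sz[OF Q12(2)] by blast
    have le: "card O0 < N" "card O1 < N" "card O2 < N" using bnd[OF Q12(1)] bnd[OF Q12(2)] c0b N2 by auto
    \<comment> \<open>Argued for s1 \<le> s2 \<le> k and applied to the two remaining orbits in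
      either order. If all orders were at least 3, the orbit sizes would sum to at most N.\<close>
    have key: "N = k \<or> N = 2 * k \<or> (k, N) \<in> {(3, 12), (4, 24), (5, 60)}"
      if c1: "c1 * s1 = N" "s1 \<ge> 2" "s1 \<le> s2" and c2: "c2 * s2 = N" "s2 \<le> k"
        and tot: "c0 + c1 + c2 = N + 2" and cc0: "c0 * k = N" for c0 c1 c2 s1 s2 :: nat
    proof -
      have m: "c * t \<le> N" if "c * s = N" "t \<le> s" for c s t :: nat
        using that mult_le_mono2[of t s c] by simp
      have "s1 < 3"
      proof (rule ccontr)
        assume "\<not> s1 < 3"
        then have "c1 * 3 \<le> N" "c2 * 3 \<le> N" "c0 * 3 \<le> N" using m c1 c2 cc0 by auto
        then show False using tot by linarith
      qed
      then have c1': "c1 * 2 = N" proof -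
        have "s1 = 2" using \<open>s1 < 3\<close> c1(2) by linarith
        then show ?thesis using c1(1) by simp
      qed
      have "s2 < 4"
      proof (rule ccontr)
        assume "\<not> s2 < 4"
        then have "c2 * 4 \<le> N" "c0 * 4 \<le> N" using m c2 cc0 by auto
        then show False using tot c1' by linarith
      qed
      then consider "s2 = 2" | "s2 = 3" using c1 by linarith
      then show ?thesis
      proof cases
        case 1
        then have "c2 * 2 = N" using c2(1) by simp
        then have "c0 = 2" using tot c1' by linarith
        then show ?thesis using cc0 by simp
      next
        case 2
        then have "c2 * 3 = N" using c2(1) by simp
        \<comment> \<open>From c0 + N/2 + N/3 = N + 2.\<close>
        then have eq: "N + 12 = 6 * c0" "c0 > 2" using tot c1' N2 by linarith+
        then have "c0 * k + 12 = 6 * c0" using cc0 by linarith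
        then have "c0 * k < c0 * 6" by linarith
        then have "k < 6" using eq by simp
        moreover have "k \<ge> 3" using c2 2 by simp
        ultimately consider "k = 3" | "k = 4" | "k = 5" by linarith
        then show ?thesis using eq cc0 by cases auto
      qed
    qed
    have tot: "card O0 + card O1 + card O2 = N + 2" using s le N2 by linarith
    show ?thesis
    proof (cases "s1 \<le> s2")
      case True
      show ?thesis using key[OF s1(1,2) True s2(1,3) tot c0] by (simp add: N_def)
    next
      case False
      then have "s2 \<le> s1" by simp
      moreover have "card O0 + card O2 + card O1 = N + 2" using tot by simp
      ultimately show ?thesis using key[OF s2(1,2) _ s1(1,3) _ c0] by (simp add: N_def)
    qed
  qed
qed

subsection \<open>Normal forms\<close>

lemma stab_mono: "stab G p \<subseteq> G" by (auto simp: stab_def)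

lemma mgroup_stab: "mgroup G \<Longrightarrow> mgroup (stab G p)"
  unfolding mgroup_def stab_def
  by (auto simp: aut_inv_apply) (metis aut_inv_apply(1) subsetD)

text \<open>Commutators of affine maps are translations, so a finite stabiliser of \<open>\<infinity>\<close> is abelian and
  its elements share their second fixed point.\<close>

lemma stab_Infty_common_fixed_point:
  assumes G: "mgroup G" and k: "card (stab G Infty) \<ge> 2"
  obtains q where "\<And>g. g \<in> stab G Infty \<Longrightarrow> g (Fin q) = Fin q"
proof -
  define S where "S = stab G Infty"
  have S: "mgroup S" unfolding S_def by (rule mgroup_stab[OF G])
  have aff: "\<exists>a b. a \<noteq> 0 \<and> (\<forall>z. g (Fin z) = Fin (a * z + b))" if g: "g \<in> S" for g
  proof -
    have "g \<in> carrier aut_sphere" "g Infty = Infty"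
      using g mgroupD(2)[OF S] by (auto simp: S_def stab_def)
    then show ?thesis using aut_fix_Infty by metis
  qed
  have "S \<noteq> {id}" using k by (auto simp: S_def)
  then obtain f where f: "f \<in> S" "f \<noteq> id" using mgroupD(3)[OF S] by blast
  then obtain a b where ab: "a \<noteq> 0" "\<And>z. f (Fin z) = Fin (a * z + b)" using aff by metis
  have "f Infty = Infty" using f by (simp add: S_def stab_def)
  then have a1: "a \<noteq> 1" using mgroup_no_translation[OF S f ab(2)] by blast
  define q where "q = b / (1 - a)"
  have fix_q: "f (Fin z) = Fin z \<longleftrightarrow> z = q" for z
    using a1 by (auto simp: ab q_def field_simps)
  have "g (Fin q) = Fin q" if g: "g \<in> S" for g
  proof -
    obtain c d where cd: "c \<noteq> 0" "\<And>z. g (Fin z) = Fin (c * z + d)" using aff[OF g] by metis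
    \<comment> \<open>The commutator of g and f: it maps f(g(x)) to g(f(x)).\<close>
    define w where "w = (g \<circ> f) \<circ> finv (f \<circ> g)"
    have fg: "f \<circ> g \<in> S" "g \<circ> f \<in> S" using f g mgroupD(4)[OF S] by auto
    have w: "w \<in> S" unfolding w_def by (intro mgroupD(4,5)[OF S] fg)
    obtain a' b' where w': "a' \<noteq> 0" "\<And>z. w (Fin z) = Fin (a' * z + b')" using aff[OF w] by metis
    have wfg: "w (f (g x)) = g (f x)" for x
      using aut_inv_apply(1)[OF mgroupD(2)[OF S fg(1)], of x] by (simp add: w_def)
    have eq: "a' * (a * (c * z + d) + b) + b' = c * (a * z + b) + d" for z
      using wfg[of "Fin z"] by (simp add: ab cd w')
    \<comment> \<open>Subtracting the values at 0 and 1 isolates the slopes, a' a c = c a.\<close>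
    have "(a' * (a * (c * 1 + d) + b) + b') - (a' * (a * (c * 0 + d) + b) + b') =
        (c * (a * 1 + b) + d) - (c * (a * 0 + b) + d)"
      unfolding eq ..
    then have "(a' - 1) * (a * c) = 0" by (simp add: algebra_simps)
    then have "a' = 1" using ab cd by simp
    moreover have "w Infty = Infty" using w by (simp add: S_def stab_def)
    ultimately have "w = id" using mgroup_no_translation[OF S w _ w'(2)] by blast
    then have "f (g (Fin q)) = g (f (Fin q))" using wfg[of "Fin q"] by simp
    then have "f (g (Fin q)) = g (Fin q)" using fix_q[of q] by simp
    then show ?thesis using cd fix_q by simp
  qed
  then show thesis using that unfolding S_def by blast
qed

abbreviation unity_roots :: "nat \<Rightarrow> complex set" where "unity_roots k \<equiv> {z. z ^ k = 1}"

lemma finite_unity_roots: "k > 0 \<Longrightarrow> finite (unity_roots k)"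
  by (rule finite_roots_unity) simp

text \<open>With p moved to infinity and the common second fixed point to 0, the stabiliser consists
  of rotations by a finite set A of k numbers closed under products. Multiplication by a in A
  permutes A, so comparing the products of all elements gives a^k = 1; counting identifies A with
  the k-th roots of unity.\<close>

lemma mgroup_normal_stab:
  assumes G: "mgroup G" and k: "card (stab G p) = k" "k \<ge> 2"
  obtains m where "m \<in> carrier aut_sphere" "stab (cj m G) Infty = rot ` unity_roots k"
proof -
  obtain q where "q \<noteq> p" by (metis sphere.distinct(1))
  then obtain m1 where m1: "m1 \<in> carrier aut_sphere" "m1 p = Infty" using aut_sphere_two_points by metis
  define G1 where "G1 = cj m1 G"
  have G1: "mgroup G1" unfolding G1_def by (rule mgroup_cj[OF m1(1) G])
  have k1: "card (stab G1 Infty) = k"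
    unfolding G1_def card_stab_cj[OF m1(1)] using m1 aut_inv_apply(1)[OF m1(1), of p] k by simp
  then obtain q where q: "\<And>g. g \<in> stab G1 Infty \<Longrightarrow> g (Fin q) = Fin q"
    using stab_Infty_common_fixed_point[OF G1] k by metis
  define m2 where "m2 = moebius 1 (- q) 0 1"
  have m2: "m2 \<in> carrier aut_sphere" unfolding m2_def by (rule moebius_in_aut) simp
  have m2v: "m2 Infty = Infty" "m2 (Fin q) = Fin 0" by (simp_all add: m2_def)
  define G2 where "G2 = cj m2 G1"
  have G2: "mgroup G2" unfolding G2_def by (rule mgroup_cj[OF m2 G1])
  define S where "S = stab G2 Infty"
  have S: "S = cj m2 (stab G1 Infty)" unfolding S_def G2_def using stab_cj[OF m2, of G1 Infty] m2v by simp
  have mS: "mgroup S" unfolding S_def by (rule mgroup_stab[OF G2])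
  have kS: "card S = k" unfolding S card_cj[OF m2] by (rule k1)
  have "g (Fin 0) = Fin 0" if gS: "g \<in> S" for g
  proof -
    obtain h where h: "h \<in> stab G1 Infty" "g = m2 \<circ> h \<circ> finv m2" using gS by (auto simp: S cj_def)
    have "finv m2 (Fin 0) = Fin q" using aut_inv_apply(1)[OF m2, of "Fin q"] m2v by simp
    then show ?thesis using h(2) q[OF h(1)] m2v by simp
  qed
  then have rotS: "\<exists>a. a \<noteq> 0 \<and> g = rot a" if "g \<in> S" for g
    using aut_fix_Infty_0[of g] that mgroupD(2)[OF mS that] unfolding S_def stab_def by auto
  define A where "A = {a. rot a \<in> S}"
  have SA: "S = rot ` A" using rotS unfolding A_def by blast
  have A0: "a \<noteq> 0" if "a \<in> A" for a using rotS[of "rot a"] that rot_inject by (auto simp: A_def)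
  have inj: "inj_on rot A" using rot_inject by (simp add: inj_on_def)
  have cA: "card A = k" using kS card_image[OF inj] by (simp add: SA)
  then have fA: "finite A" using k(2) by (metis card.infinite not_numeral_le_zero)
  have "a ^ k = 1" if a: "a \<in> A" for a
  proof -
    have "(\<lambda>x. a * x) ` A = A"
    proof (rule card_subset_eq[OF fA])
      show "(\<lambda>x. a * x) ` A \<subseteq> A"
        using mgroupD(4)[OF mS] a by (auto simp: A_def rot_comp[symmetric])
      show "card ((\<lambda>x. a * x) ` A) = card A"
        by (rule card_image) (use A0[OF a] in \<open>simp add: inj_on_def\<close>)
    qed
    then have "(\<Prod>x\<in>A. x) = (\<Prod>x\<in>(\<lambda>x. a * x) ` A. x)" by simp
    also have "\<dots> = (\<Prod>x\<in>A. a * x)"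
      by (rule prod.reindex_cong[of "\<lambda>x. a * x"]) (use A0[OF a] in \<open>auto simp: inj_on_def\<close>)
    also have "\<dots> = a ^ k * (\<Prod>x\<in>A. x)" by (simp add: prod.distrib cA)
    finally show ?thesis using A0 fA by (simp add: prod_zero_iff)
  qed
  then have "A \<subseteq> unity_roots k" by blast
  then have "A = unity_roots k"
    using card_subset_eq[OF finite_unity_roots] card_roots_unity_eq[of k] k cA by simp
  then have "stab (cj (m2 \<circ> m1) G) Infty = rot ` unity_roots k"
    using SA unfolding S_def G2_def G1_def cj_comp[OF m2 m1(1)] by simp
  then show thesis using that aut_comp[OF m2 m1(1)] by blast
qed

lemma sphere_fix_rot: "a \<noteq> 1 \<Longrightarrow> rot a p = p \<longleftrightarrow> p = Infty \<or> p = Fin 0"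
  by (cases p) auto

lemma nontrivial_unity_root:
  assumes "k \<ge> 2"
  obtains \<zeta> :: complex where "\<zeta> ^ k = 1" "\<zeta> \<noteq> 1"
proof -
  have "card (unity_roots k) = k" using assms by (intro card_roots_unity_eq) simp
  then have "unity_roots k \<noteq> {1}" using assms by auto
  then show thesis using that by (auto simp: set_eq_iff)
qed

lemma finv_rot: "a \<noteq> 0 \<Longrightarrow> finv (rot a) = rot (inverse a)"
  by (rule inv_unique_comp) (simp_all add: rot_comp rot_1)

lemma cj_rot:
  assumes "l \<noteq> 0" "S \<subseteq> range rot"
  shows "cj (rot l) S = S"
  by (rule cj_comm[OF rot_aut[OF assms(1)]]) (use assms(2) in \<open>auto simp: rot_comp mult.commute\<close>)

lemma stab_cj_rot:
  assumes "l \<noteq> 0" "stab G Infty = rot ` unity_roots k"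
  shows "stab (cj (rot l) G) Infty = rot ` unity_roots k"
proof -
  have "stab (cj (rot l) G) (rot l Infty) = cj (rot l) (stab G Infty)"
    by (rule stab_cj[OF rot_aut[OF assms(1)]])
  also have "\<dots> = stab G Infty" by (rule cj_rot[OF assms(1)]) (use assms(2) in auto)
  finally show ?thesis using assms(2) by simp
qed

text \<open>The orbit of infinity has two points, and the second is fixed by the rotations, so it is
  0. An element exchanging 0 and infinity has the form z -> b / (c z) and becomes z -> 1 / z after
  rescaling.\<close>

lemma dihedral_normal_form:
  assumes G: "mgroup G" and st: "stab G Infty = rot ` unity_roots k" and k: "k \<ge> 2"
    and n: "card G = 2 * k"
  obtains m where "m \<in> carrier aut_sphere"
    "cj m G = rot ` unity_roots k \<union> (\<lambda>f. moebius 0 1 1 0 \<circ> f) ` rot ` unity_roots k"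
proof -
  have crd: "card (rot ` unity_roots k) = k"
    using card_roots_unity_eq[of k] k by (subst card_image) (auto simp: inj_on_def rot_inject)
  then have "card (orb G Infty) = 2" using orbit_stabilizer[OF G, of Infty] st n k by simp
  then obtain P where P: "orb G Infty = {Infty, P}" "P \<noteq> Infty"
    using self_in_orb[OF G, of Infty] by (metis card_2_iff doubleton_eq_iff insertE singletonD)
  obtain \<zeta> :: complex where z: "\<zeta> ^ k = 1" "\<zeta> \<noteq> 1" using nontrivial_unity_root[OF k] by metis
  then have rz: "rot \<zeta> \<in> stab G Infty" "\<zeta> \<noteq> 0" using st k by (auto simp: power_0_left)
  have "rot \<zeta> P \<in> orb G P" using rz unfolding orb_def stab_def by blast
  then have "rot \<zeta> P \<in> {Infty, P}" using orb_eq[OF G, of P Infty] P by simp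
  moreover have "rot \<zeta> P \<noteq> Infty" using P(2) by (cases P) auto
  ultimately have "rot \<zeta> P = P" by simp
  then have P0: "P = Fin 0" using P(2) sphere_fix_rot[OF z(2)] by blast
  then have "Fin 0 \<in> orb G Infty" using P by simp
  then obtain g where g: "g \<in> G" "g Infty = Fin 0" unfolding orb_def by auto
  note ga = mgroupD(2)[OF G g(1)]
  have "g (Fin 0) \<in> orb G (Fin 0)" using g(1) unfolding orb_def by blast
  then have "g (Fin 0) \<in> {Infty, Fin 0}" using orb_eq[OF G, of "Fin 0" Infty] P P0 by simp
  moreover have "g (Fin 0) \<noteq> g Infty" using aut_inv_apply(3)[OF ga] by blast
  ultimately have g0: "g (Fin 0) = Infty" using g by auto
  obtain a b c d where abcd: "g = moebius a b c d" "a * d - b * c \<noteq> 0" using ga unfolding mem_aut_sphere by blast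
  have c: "c \<noteq> 0" using abcd g(2) by (auto split: if_splits)
  have "d = 0" "a = 0" using g0 abcd g(2) c by (auto split: if_splits)
  then have g_eq: "g (Fin z) = (if z = 0 then Infty else Fin (b / (c * z)))" for z
    using abcd c by simp
  have b: "b \<noteq> 0" using abcd \<open>a = 0\<close> by auto
  \<comment> \<open>Conjugating z -> b / (c z) by z -> l z gives z -> l^2 b / (c z), hence the
    choice l^2 = c / b.\<close>
  define l where "l = csqrt (c / b)"
  have l: "l ^ 2 = c / b" by (simp add: l_def)
  then have l0: "l \<noteq> 0" using b c by auto
  note la = rot_aut[OF l0]
  define G' where "G' = cj (rot l) G"
  have G': "mgroup G'" unfolding G'_def by (rule mgroup_cj[OF la G])
  have st': "stab G' Infty = rot ` unity_roots k" unfolding G'_def by (rule stab_cj_rot[OF l0 st])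
  have "rot l \<circ> g \<circ> finv (rot l) = moebius 0 1 1 0"
  proof (rule sphere_fun_eqI)
    show "(rot l \<circ> g \<circ> finv (rot l)) Infty = moebius 0 1 1 0 Infty"
      by (simp add: finv_rot[OF l0] g)
    fix z show "(rot l \<circ> g \<circ> finv (rot l)) (Fin z) = moebius 0 1 1 0 (Fin z)"
    proof (cases "z = 0")
      case False
      have "l * (b / (c * (inverse l * z))) = (l ^ 2 * b) / (c * z)"
        using l0 False c by (simp add: field_simps power2_eq_square)
      also have "\<dots> = 1 / z" using l b c False by (simp add: field_simps)
      finally show ?thesis using False l0 by (simp add: finv_rot[OF l0] g_eq)
    qed (use l0 in \<open>simp add: finv_rot[OF l0] g_eq\<close>)
  qed
  then have inv_in: "moebius 0 1 1 0 \<in> G'" using g(1) unfolding G'_def cj_def by (metis image_eqI)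
  let ?R = "rot ` unity_roots k"
  let ?T = "(\<lambda>f. moebius 0 1 1 0 \<circ> f) ` ?R"
  have "?R \<union> ?T = G'"
  proof (rule card_subset_eq[OF mgroupD(1)[OF G']])
    have R: "?R \<subseteq> G'" using stab_mono[of G' Infty] st' by simp
    then show "?R \<union> ?T \<subseteq> G'" using inv_in mgroupD(4)[OF G'] by blast
    have "inj_on (\<lambda>f. moebius 0 1 1 0 \<circ> f) ?R"
      by (rule inj_onI) (metis aut_inv_apply(3)[OF mgroupD(2)[OF G' inv_in]] comp_apply ext)
    then have "card ?T = k" using crd by (simp add: card_image)
    moreover have "?R \<inter> ?T = {}"
    proof -
      have "f Infty = Infty" if "f \<in> ?R" for f using that by auto
      moreover have "f Infty = Fin 0" if "f \<in> ?T" for f using that by auto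
      ultimately show ?thesis by (metis disjoint_iff sphere.distinct(1))
    qed
    moreover have "finite ?R" using finite_unity_roots[of k] k by simp
    ultimately have "card (?R \<union> ?T) = 2 * k" using crd by (subst card_Un_disjoint) auto
    then show "card (?R \<union> ?T) = card G'" unfolding G'_def card_cj[OF la] n .
  qed
  then show thesis using that[OF la] unfolding G'_def by metis
qed

text \<open>In the polyhedral cases the group is the full stabiliser of the orbit of \<open>\<infinity>\<close>: a Moebius
  transformation fixing \<open>\<infinity>\<close> and preserving the orbit fixes its centroid \<open>0\<close>.\<close>

lemma mgroup_eq_stabilizer_of_orbit:
  assumes G: "mgroup G" and st: "stab G Infty = rot ` unity_roots k" and k: "k \<ge> 2"
    and Z: "orb G Infty = insert Infty (Fin ` Z)" "Z \<noteq> {}"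
    and ext: "\<And>c. c \<noteq> 0 \<Longrightarrow> (\<And>z. z \<in> Z \<Longrightarrow> c * z \<in> Z) \<Longrightarrow> c ^ k = 1"
  shows "G = {f \<in> carrier aut_sphere. f ` orb G Infty = orb G Infty}"
proof (intro equalityI subsetI)
  have pres: "g ` orb G Infty = orb G Infty" if g: "g \<in> G" for g
  proof -
    have "g (h p) \<in> orb G p" if "h \<in> G" for h p
      using mgroupD(4)[OF G g that] unfolding orb_def by (metis comp_apply image_eqI)
    then have "g ` orb G Infty \<subseteq> orb G Infty" unfolding orb_def by blast
    moreover have "finite (orb G Infty)" using mgroupD(1)[OF G] by (simp add: orb_def)
    moreover have "card (g ` orb G Infty) = card (orb G Infty)"
      by (rule card_image) (simp add: inj_on_def aut_inv_apply(3)[OF mgroupD(2)[OF G g]])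
    ultimately show ?thesis by (metis card_subset_eq)
  qed
  fix f assume "f \<in> G"
  then show "f \<in> {f \<in> carrier aut_sphere. f ` orb G Infty = orb G Infty}"
    using pres mgroupD(2)[OF G] by blast
next
  fix h assume "h \<in> {f \<in> carrier aut_sphere. f ` orb G Infty = orb G Infty}"
  then have h: "h \<in> carrier aut_sphere" "h ` orb G Infty = orb G Infty" by auto
  have pres: "g p \<in> orb G Infty" if "g \<in> G" "p \<in> orb G Infty" for g p
    using that orb_eq[OF G that(2)] unfolding orb_def by blast
  have "h Infty \<in> orb G Infty" using h(2) self_in_orb[OF G] by blast
  then obtain g where g: "g \<in> G" "g Infty = h Infty" unfolding orb_def by auto
  note ga = mgroupD(2)[OF G g(1)]
  \<comment> \<open>Corrected by an element of G, h fixes infinity and still preserves the orbit. It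
    is then affine, and both its translation part and its multiplier can be determined.\<close>
  define e where "e = finv g \<circ> h"
  have e: "e \<in> carrier aut_sphere" unfolding e_def by (intro aut_comp aut_inv ga h)
  have eI: "e Infty = Infty" unfolding e_def using aut_inv_apply(1)[OF ga, of Infty] g by simp
  obtain a b where ab: "a \<noteq> 0" "\<And>z. e (Fin z) = Fin (a * z + b)" using aut_fix_Infty[OF e eI] by metis
  have eO: "e p \<in> orb G Infty" if "p \<in> orb G Infty" for p
    using pres[OF mgroupD(5)[OF G g(1)], of "h p"] h(2) that unfolding e_def by auto
  have "finite (orb G Infty)" using mgroupD(1)[OF G] by (simp add: orb_def)
  then have finZ: "finite Z" using Z(1) by (simp add: finite_image_iff inj_on_def)
  have aZ: "a * z + b \<in> Z" if "z \<in> Z" for z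
    using eO[of "Fin z"] that Z(1) ab by auto
  have surj: "(\<lambda>z. a * z + b) ` Z = Z"
    by (rule card_subset_eq[OF finZ]) (use aZ ab in \<open>auto intro!: card_image simp: inj_on_def\<close>)
  have sum_eq: "(\<Sum>z\<in>Z. u * z + v) = \<Sum> Z" if "(\<lambda>z. u * z + v) ` Z = Z" "u \<noteq> 0" for u v
  proof -
    have "\<Sum> Z = (\<Sum>z\<in>(\<lambda>z. u * z + v) ` Z. z)" using that by simp
    also have "\<dots> = (\<Sum>z\<in>Z. u * z + v)"
      by (rule sum.reindex_cong[of "\<lambda>z. u * z + v"]) (use that in \<open>auto simp: inj_on_def\<close>)
    finally show ?thesis ..
  qed
  obtain \<zeta> :: complex where z: "\<zeta> ^ k = 1" "\<zeta> \<noteq> 1" using nontrivial_unity_root[OF k] by metis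
  then have rz: "rot \<zeta> \<in> G" "\<zeta> \<noteq> 0" using st k stab_mono[of G Infty] by (auto simp: power_0_left)
  have "\<zeta> * w \<in> Z" if "w \<in> Z" for w
    using pres[OF rz(1), of "Fin w"] that Z(1) by auto
  then have "(\<lambda>w. \<zeta> * w + 0) ` Z = Z"
    by (intro card_subset_eq[OF finZ]) (use rz in \<open>auto intro!: card_image simp: inj_on_def\<close>)
  then have "\<zeta> * \<Sum> Z = \<Sum> Z" using sum_eq[of \<zeta> 0] rz by (simp add: sum_distrib_left)
  then have s0: "\<Sum> Z = 0" using z by simp
  have "a * \<Sum> Z + of_nat (card Z) * b = \<Sum> Z"
    using sum_eq[OF surj ab(1)] by (simp add: sum.distrib sum_distrib_left)
  then have "b = 0" using s0 finZ Z(2) by simp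
  then have "a ^ k = 1" using ext[OF ab(1)] aZ by simp
  moreover have "e = rot a" by (rule sphere_fun_eqI) (simp_all add: eI ab \<open>b = 0\<close>)
  ultimately have "e \<in> G" using st stab_mono[of G Infty] by blast
  then have "g \<circ> e \<in> G" using g mgroupD(4)[OF G] by blast
  moreover have "g \<circ> e = h" unfolding e_def by (simp add: fun_eq_iff aut_inv_apply(2)[OF ga])
  ultimately show "h \<in> G" by simp
qed

section \<open>Orbits of the polyhedral groups\<close>

lemma card_unity_root_orbits:
  fixes S :: "complex set"
  assumes "finite S" "k > 0" "0 \<notin> S" and cl: "\<And>a z. a ^ k = 1 \<Longrightarrow> z \<in> S \<Longrightarrow> a * z \<in> S"
  shows "card S = card ((\<lambda>z. z ^ k) ` S) * k"
proof -
  \<comment> \<open>On S the fibres of z -> z^k are the orbits of the k-th roots of unity. The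
    resulting divisibility by k later decides whether 0 lies in an orbit.\<close>
  have fib: "card {z \<in> S. z ^ k = w} = k" if w: "w \<in> (\<lambda>z. z ^ k) ` S" for w
  proof -
    obtain z0 where z0: "z0 \<in> S" "w = z0 ^ k" using w by blast
    then have n0: "z0 \<noteq> 0" using assms(3) by auto
    have "{z \<in> S. z ^ k = w} = (\<lambda>a. a * z0) ` unity_roots k"
    proof (intro equalityI subsetI)
      fix z assume "z \<in> {z \<in> S. z ^ k = w}"
      then have "(z / z0) ^ k = 1" using z0 n0 by (simp add: power_divide)
      moreover have "z = (z / z0) * z0" using n0 by simp
      ultimately show "z \<in> (\<lambda>a. a * z0) ` unity_roots k" by blast
    qed (use cl z0 in \<open>auto simp: power_mult_distrib\<close>)
    also have "card \<dots> = card (unity_roots k)" by (rule card_image) (use n0 in \<open>simp add: inj_on_def\<close>)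
    finally show ?thesis using card_roots_unity_eq[of k] assms(2) by simp
  qed
  have "card S = card (\<Union>w\<in>(\<lambda>z. z ^ k) ` S. {z \<in> S. z ^ k = w})"
    by (rule arg_cong[of _ _ card]) auto
  also have "\<dots> = (\<Sum>w\<in>(\<lambda>z. z ^ k) ` S. card {z \<in> S. z ^ k = w})"
    by (rule card_UN_disjoint) (use assms(1) in auto)
  also have "\<dots> = card ((\<lambda>z. z ^ k) ` S) * k" using fib by simp
  finally show ?thesis .
qed

lemma single_unity_root_orbit:
  fixes S :: "complex set"
  assumes "card S = k" "k > 0" "z0 \<in> S" "z0 \<noteq> 0" and cl: "\<And>a z. a ^ k = 1 \<Longrightarrow> z \<in> S \<Longrightarrow> a * z \<in> S"
  shows "S = (\<lambda>a. a * z0) ` unity_roots k"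
proof -
  have "finite S" using assms(1,2) by (metis card.infinite less_numeral_extra(3))
  moreover have "(\<lambda>a. a * z0) ` unity_roots k \<subseteq> S" using cl assms(3) by auto
  moreover have "card ((\<lambda>a. a * z0) ` unity_roots k) = k"
    using card_roots_unity_eq[of k] assms(2,4) by (subst card_image) (auto simp: inj_on_def)
  ultimately show ?thesis using assms(1) card_subset_eq by metis
qed

lemma orb_cj_rot:
  assumes "l \<noteq> 0" "orb G Infty = insert Infty (Fin ` Z)"
  shows "orb (cj (rot l) G) Infty = insert Infty (Fin ` (\<lambda>z. l * z) ` Z)"
  using orb_cj[OF rot_aut[OF assms(1)], of G Infty] assms(2) by (auto simp: image_image)

text \<open>For \<zeta> = cis (2 pi / 5) this is \<zeta> + 1/\<zeta> - 1, which equals (sqrt 5 - 3)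
  / 2. With two opposite vertices of an icosahedron at infinity and 0, the other ten lie on two
  circles; the absolute value is the ratio of the radii, and the negative sign is the twist between
  the two pentagons.\<close>

definition icosa_ratio :: complex where
  "icosa_ratio = of_real (2 * cos (2 * pi / 5) - 1)"

lemma icosa_ratio_norm: "norm icosa_ratio < 1"
proof -
  have "cos (2 * pi / 5) > 0" by (rule cos_gt_zero_pi) (use pi_gt_zero in linarith)+
  moreover have "cos (2 * pi / 5) < cos 0" by (rule cos_monotone_0_pi) auto
  moreover have "norm icosa_ratio = \<bar>2 * cos (2 * pi / 5) - 1\<bar>"
    unfolding icosa_ratio_def by (rule norm_of_real)
  ultimately show ?thesis by simp
qed

lemma
  defines "\<zeta> \<equiv> cis (2 * pi / 5)"
  shows cis5_power: "\<zeta> ^ 5 = 1" and cis5_ne_1: "\<zeta> \<noteq> 1"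
    and icosa_ratio_eq: "icosa_ratio * \<zeta> = \<zeta> ^ 2 - \<zeta> + 1" and icosa_ratio_nz: "icosa_ratio \<noteq> 0"
proof -
  show z5: "\<zeta> ^ 5 = 1" by (simp add: \<zeta>_def Complex.DeMoivre)
  have "cos (2 * pi / 5) < cos 0" by (rule cos_monotone_0_pi) auto
  then have "Re \<zeta> < 1" by (simp add: \<zeta>_def)
  then show z1: "\<zeta> \<noteq> 1" by auto
  have "\<zeta> * cis (- (2 * pi / 5)) = 1" by (simp add: \<zeta>_def cis_mult)
  moreover have "complex_of_real (2 * cos (2 * pi / 5)) = \<zeta> + cis (- (2 * pi / 5))"
    by (simp add: \<zeta>_def complex_eq_iff)
  ultimately show eq: "icosa_ratio * \<zeta> = \<zeta> ^ 2 - \<zeta> + 1"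
    unfolding icosa_ratio_def of_real_diff by (simp add: algebra_simps power2_eq_square)
  \<comment> \<open>Vanishing would mean \<zeta>^2 - \<zeta> + 1 = 0, hence \<zeta>^6 = 1; together
    with \<zeta>^5 = 1 this forces \<zeta> = 1.\<close>
  show "icosa_ratio \<noteq> 0"
  proof
    assume "icosa_ratio = 0"
    then have q: "\<zeta> ^ 2 = \<zeta> - 1" using eq by (simp add: algebra_simps)
    have "\<zeta> ^ 3 = \<zeta> ^ 2 * \<zeta>" by (simp add: power3_eq_cube power2_eq_square)
    also have "\<dots> = (\<zeta> - 1) * \<zeta>" by (simp only: q)
    also have "\<dots> = \<zeta> ^ 2 - \<zeta>" by (simp add: algebra_simps power2_eq_square)
    also have "\<dots> = - 1" by (simp add: q)
    finally have "\<zeta> ^ 3 = - 1" .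
    then have "(\<zeta> ^ 3) ^ 2 = 1" by simp
    then have "\<zeta> ^ 6 = 1" by (simp flip: power_mult)
    moreover have "\<zeta> ^ 6 = \<zeta> ^ 5 * \<zeta>" by (simp add: eval_nat_numeral)
    ultimately show False using z5 z1 by simp
  qed
qed

text \<open>The icosahedral case. The involution exchanging the two fixed points of each rotation of
  order five acts on the orbit; transporting the pair \<open>(\<infinity>, 0)\<close> by the group to a pair \<open>(P, P')\<close>
  gives an algebraic equation for \<open>P / P'\<close>.\<close>

lemma icosahedral_orbit:
  assumes G: "mgroup G" and st: "stab G Infty = rot ` unity_roots 5"
    and bound: "\<And>q. card (stab G q) \<le> 5"
    and Z: "orb G Infty = insert Infty (Fin ` Z)" "card Z = 11"
  obtains l where "l \<noteq> 0" "(\<lambda>z. l * z) ` Z = insert 0 (unity_roots 5 \<union> (\<lambda>a. icosa_ratio * a) ` unity_roots 5)"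
proof -
  note Gc = mgroupD(4)[OF G] and Gi = mgroupD(5)[OF G] and Ga = mgroupD(2)[OF G]
  have rotG: "rot a \<in> G" if "a ^ 5 = 1" for a using st stab_mono[of G Infty] that by blast
  have pres: "g p \<in> orb G Infty" if "g \<in> G" "p \<in> orb G Infty" for g p
    using that orb_eq[OF G that(2)] unfolding orb_def by blast
  have Zcl: "a * z \<in> Z" if "a ^ 5 = 1" "z \<in> Z" for a z
    using pres[OF rotG[OF that(1)], of "Fin z"] that(2) Z(1) by auto
  have memZ: "Fin z \<in> orb G Infty \<longleftrightarrow> z \<in> Z" for z using Z(1) by auto
  have finZ: "finite Z" using Z(2) by (metis card.infinite zero_neq_numeral)
  \<comment> \<open>Without 0 the set would split into five-element orbits, but 5 does not divide
    11.\<close>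
  have "0 \<in> Z"
  proof (rule ccontr)
    assume "0 \<notin> Z"
    then have "11 = card ((\<lambda>z. z ^ 5) ` Z) * 5"
      using card_unity_root_orbits[of Z 5] finZ Zcl Z(2) by auto
    then show False by presburger
  qed
  define \<zeta> where "\<zeta> = cis (2 * pi / 5)"
  note z5 = cis5_power[folded \<zeta>_def] and z1 = cis5_ne_1[folded \<zeta>_def] and zr = icosa_ratio_eq[folded \<zeta>_def]
  have z0: "\<zeta> \<noteq> 0" by (simp add: \<zeta>_def)
  have fixInf: "g (Fin 0) = Fin 0" if "g \<in> G" "g Infty = Infty" for g
  proof -
    have "g \<in> stab G Infty" using that by (simp add: stab_def)
    then show ?thesis using st by auto
  qed
  \<comment> \<open>The five rotations fix 0 as well, and no stabiliser has more than five
    elements.\<close>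
  have "stab G Infty = stab G (Fin 0)"
  proof (rule card_seteq)
    show "finite (stab G (Fin 0))" using mgroupD(1)[OF G] by (simp add: stab_def)
    show "stab G Infty \<subseteq> stab G (Fin 0)" using fixInf by (auto simp: stab_def)
    have "card (rot ` unity_roots 5) = 5"
      using card_roots_unity_eq[of 5] by (subst card_image) (auto simp: inj_on_def rot_inject)
    then show "card (stab G (Fin 0)) \<le> card (stab G Infty)" using bound st by simp
  qed
  then have fix0: "g Infty = Infty" if "g \<in> G" "g (Fin 0) = Fin 0" for g
    using that unfolding stab_def by blast
  obtain g0 where g0: "g0 \<in> G" "g0 Infty = Fin 0"
  proof -
    have "Fin 0 \<in> orb G Infty" using \<open>0 \<in> Z\<close> memZ by blast
    then show thesis using that unfolding orb_def by auto
  qed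
  note g0a = aut_inv_apply[OF Ga[OF g0(1)]]
  \<comment> \<open>A conjugate of the rotation by \<zeta> fixes g0(infinity) = 0, hence also
    infinity. The rotation then fixes the preimage of infinity under g0, which can only be
    0.\<close>
  have g00: "g0 (Fin 0) = Infty"
  proof -
    define h where "h = g0 \<circ> rot \<zeta> \<circ> finv g0"
    have hG: "h \<in> G" unfolding h_def using g0 rotG z5 Gc Gi by blast
    have "finv g0 (Fin 0) = Infty" using g0a(1)[of Infty] g0 by simp
    then have "h (Fin 0) = Fin 0" unfolding h_def using g0 by simp
    then have "h Infty = Infty" by (rule fix0[OF hG])
    then have "finv g0 (g0 (rot \<zeta> (finv g0 Infty))) = finv g0 Infty" unfolding h_def by simp
    then have "rot \<zeta> (finv g0 Infty) = finv g0 Infty" by (simp add: g0a(1))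
    then have "finv g0 Infty = Infty \<or> finv g0 Infty = Fin 0" using sphere_fix_rot[OF z1] by blast
    then show ?thesis using g0a(2)[of Infty] g0 by auto
  qed
  \<comment> \<open>g(0) is the vertex antipodal to g(infinity): it depends on that vertex alone,
    and by \<open>det'\<close> passing to the antipode is an involution.\<close>
  have det: "g (Fin 0) = g' (Fin 0)" if g: "g \<in> G" "g' \<in> G" "g Infty = g' Infty" for g g'
  proof -
    note ga = aut_inv_apply[OF Ga[OF g(1)]]
    have "(finv g \<circ> g') Infty = Infty" using ga(1)[of Infty] g(3) by simp
    then have "(finv g \<circ> g') (Fin 0) = Fin 0" by (rule fixInf[rotated]) (use g Gc Gi in blast)
    then have "g (finv g (g' (Fin 0))) = g (Fin 0)" by simp
    then show ?thesis by (simp add: ga(2))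
  qed
  have det': "g (Fin 0) = g' Infty" if g: "g \<in> G" "g' \<in> G" "g Infty = g' (Fin 0)" for g g'
    using det[OF g(1) Gc[OF g(2) g0(1)]] g(3) g0(2) g00 by simp
  have "card (Z - {0}) = 10" using finZ \<open>0 \<in> Z\<close> Z(2) by simp
  then have "Z - {0} \<noteq> {}" by force
  then obtain P where P: "P \<in> Z" "P \<noteq> 0" by blast
  then obtain g1 where g1: "g1 \<in> G" "g1 Infty = Fin P"
  proof -
    have "Fin P \<in> orb G Infty" using P memZ by blast
    then show thesis using that unfolding orb_def by auto
  qed
  note g1a = aut_inv_apply[OF Ga[OF g1(1)]]
  have "g1 (Fin 0) \<in> orb G Infty" using pres[OF g1(1)] memZ \<open>0 \<in> Z\<close> by blast
  moreover have "g1 (Fin 0) \<noteq> Infty"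
  proof
    assume "g1 (Fin 0) = Infty"
    then have "id (Fin 0) = g1 Infty" using det'[OF mgroupD(3)[OF G] g1(1)] by simp
    then show False using g1 P by simp
  qed
  ultimately obtain P' where P': "g1 (Fin 0) = Fin P'" "P' \<in> Z" using Z(1) by auto
  have P'0: "P' \<noteq> 0" using fix0[OF g1(1)] P' g1(2) by auto
  \<comment> \<open>If the antipode of P were a P, the involution would give a^2 P = P. With a^5 = 1
    this yields a = 1 and P' = P.\<close>
  have ne: "P' \<noteq> a * P" if a: "a ^ 5 = 1" for a
  proof
    assume eq: "P' = a * P"
    have "(rot a \<circ> g1) (Fin 0) = g1 Infty"
      by (rule det'[OF Gc[OF rotG[OF a] g1(1)] g1(1)]) (simp add: g1 P' eq)
    then have "a * (a * P) = P" using P' g1 eq by simp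
    then have a2: "a * a = 1" using P by (metis mult.assoc mult_cancel_right1)
    have "a ^ 5 = (a * a) * (a * a) * a" by (simp add: eval_nat_numeral mult.assoc)
    then have "a = 1" using a a2 by simp
    then show False using eq g1(2) P'(1) g1a(3)[of "Fin 0" Infty] by simp
  qed
  define R where "R = unity_roots 5"
  have finR: "finite R" and cR: "card R = 5"
    unfolding R_def using finite_unity_roots[of 5] card_roots_unity_eq[of 5] by auto
  have R0: "a \<noteq> 0" if "a \<in> R" for a using that by (auto simp: R_def)
  have Rdiv: "a / b \<in> R" if "a \<in> R" "b \<in> R" for a b using that by (auto simp: R_def power_divide)
  \<comment> \<open>The rotations move P and P' through two disjoint five-element sets; with 0 these
    exhaust all 11 points.\<close>
  have Zeq: "Z = insert 0 ((\<lambda>a. a * P) ` R \<union> (\<lambda>a. a * P') ` R)"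
  proof (rule card_subset_eq[OF finZ, symmetric])
    show "insert 0 ((\<lambda>a. a * P) ` R \<union> (\<lambda>a. a * P') ` R) \<subseteq> Z"
      using Zcl P P' \<open>0 \<in> Z\<close> by (auto simp: R_def)
    have "card ((\<lambda>a. a * P) ` R) = 5" "card ((\<lambda>a. a * P') ` R) = 5"
      using cR P P'0 by (simp_all add: card_image inj_on_def)
    moreover have "(\<lambda>a. a * P) ` R \<inter> (\<lambda>a. a * P') ` R = {}"
    proof (rule ccontr)
      assume "\<not> ?thesis"
      then obtain a b where ab: "a \<in> R" "b \<in> R" "a * P = b * P'" by auto
      then have "P' = (a / b) * P" using R0[of b] by (simp add: field_simps)
      then show False using ne[of "a / b"] Rdiv[OF ab(1,2)] by (simp add: R_def)
    qed
    moreover have "0 \<notin> (\<lambda>a. a * P) ` R \<union> (\<lambda>a. a * P') ` R" using R0 P P'0 by auto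
    ultimately show "card (insert 0 ((\<lambda>a. a * P) ` R \<union> (\<lambda>a. a * P') ` R)) = card Z"
      using finR Z(2) by (simp add: card_Un_disjoint)
  qed
  obtain a b c d where abcd: "finv g1 = moebius a b c d" "a * d - b * c \<noteq> 0"
    using Ga[OF Gi[OF g1(1)]] unfolding mem_aut_sphere by blast
  have "finv g1 (Fin P) = Infty" using g1a(1)[of Infty] g1 by simp
  then have cd: "c * P + d = 0" using abcd by (auto split: if_splits)
  have "finv g1 (Fin P') = Fin 0" using g1a(1)[of "Fin 0"] P' by simp
  then have ab: "a * P' + b = 0" using abcd by (auto split: if_splits)
  have b: "b = - (a * P')" and d: "d = - (c * P)" using ab cd minus_unique by metis+
  have ac: "a \<noteq> 0" "c \<noteq> 0" using abcd(2) by (auto simp: b d)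
  have h: "finv g1 (Fin z) = Fin (a * (z - P') / (c * (z - P)))" if "z \<noteq> P" for z
    using that ac by (simp add: abcd(1) b d algebra_simps)
  define u v where "u = a * (\<zeta> * P - P') / (c * (\<zeta> * P - P))" and "v = a * (\<zeta> * P' - P') / (c * (\<zeta> * P' - P))"
  have zP: "\<zeta> * P \<noteq> P" using z1 P by simp
  have zP': "\<zeta> * P' \<noteq> P"
  proof
    assume "\<zeta> * P' = P"
    then have "P' = inverse \<zeta> * P" using z0 by (simp add: field_simps)
    then show False using ne[of "inverse \<zeta>"] z5 by (simp add: power_inverse)
  qed
  \<comment> \<open>This element of G sends the pair (infinity, 0) to the antipodal pair (u, v).
    Some rotation takes P or P' to u and therefore takes the other one to v. Each case is one
    equation for \<kappa> = P / P'.\<close>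
  define e where "e = finv g1 \<circ> rot \<zeta> \<circ> g1"
  have eG: "e \<in> G" unfolding e_def using g1 rotG[OF z5] Gc Gi by blast
  have e: "e Infty = Fin u" "e (Fin 0) = Fin v"
    unfolding e_def u_def v_def using g1 P' h[OF zP] h[OF zP'] by simp_all
  have "e Infty \<in> orb G Infty" using eG unfolding orb_def by blast
  then have "u \<in> Z" using e memZ by simp
  moreover have "u \<noteq> 0" using ne[OF z5] ac zP by (auto simp: u_def)
  ultimately obtain r where r: "r \<in> R" "u = r * P \<or> u = r * P'" unfolding Zeq by auto
  have g3: "rot r \<circ> g1 \<in> G" using rotG r Gc g1 by (simp add: R_def)
  define \<kappa> where "\<kappa> = P / P'"
  have k: "P = \<kappa> * P'" "\<kappa> \<noteq> 0" "\<kappa> \<noteq> 1" using P P'0 ne[of 1] by (auto simp: \<kappa>_def)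
  have nz: "\<zeta> - 1 \<noteq> 0" "\<zeta> - \<kappa> \<noteq> 0" using z1 zP' k(1) by auto
  have u': "u = a / c * ((\<zeta> * \<kappa> - 1) / (\<kappa> * (\<zeta> - 1)))"
  proof -
    have "u = (P' * (a * (\<zeta> * \<kappa> - 1))) / (P' * (c * (\<kappa> * (\<zeta> - 1))))"
      unfolding u_def k(1) by (simp add: algebra_simps)
    then show ?thesis using P'0 by simp
  qed
  have v': "v = a / c * ((\<zeta> - 1) / (\<zeta> - \<kappa>))"
  proof -
    have "v = (P' * (a * (\<zeta> - 1))) / (P' * (c * (\<zeta> - \<kappa>)))"
      unfolding v_def k(1) by (simp add: algebra_simps)
    then show ?thesis using P'0 by simp
  qed
  from r(2) show thesis
  proof
    assume ur: "u = r * P"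
    have "e (Fin 0) = (rot r \<circ> g1) (Fin 0)"
      by (rule det[OF eG g3]) (simp add: e g1 ur)
    then have "v = r * P'" using e P' by simp
    then have "u = v * \<kappa>" using ur k(1) by simp
    then have "a / c * ((\<zeta> * \<kappa> - 1) / (\<kappa> * (\<zeta> - 1))) = a / c * ((\<zeta> - 1) / (\<zeta> - \<kappa>) * \<kappa>)"
      unfolding u' v' by (simp only: mult.assoc)
    then have "(\<zeta> * \<kappa> - 1) / (\<kappa> * (\<zeta> - 1)) = (\<zeta> - 1) / (\<zeta> - \<kappa>) * \<kappa>"
      using ac mult_left_cancel[of "a / c"] by (metis divide_eq_0_iff)
    then have "(\<zeta> * \<kappa> - 1) * (\<zeta> - \<kappa>) = \<kappa> ^ 2 * (\<zeta> - 1) ^ 2"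
      using nz k by (simp add: divide_simps power2_eq_square)
    \<comment> \<open>The factor \<kappa> - 1 reflects the excluded case P = P'; the other factor is
      linear in \<kappa>.\<close>
    then have "(\<kappa> - 1) * (\<kappa> * (\<zeta> ^ 2 - \<zeta> + 1) - \<zeta>) = 0" by (simp add: algebra_simps power2_eq_square)
    then have "\<kappa> * (icosa_ratio * \<zeta>) = \<zeta>" unfolding zr using k by simp
    then have "\<kappa> * icosa_ratio = 1" using z0 by simp
    then have "P' = icosa_ratio * P" using k(1) by (simp add: mult.commute mult.left_commute)
    then have e: "inverse P * (a * P) = a" "inverse P * (a * P') = icosa_ratio * a" for a
      using P by (simp_all add: field_simps)
    have "(\<lambda>z. inverse P * z) ` Z = insert 0 (R \<union> (\<lambda>a. icosa_ratio * a) ` R)"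
      unfolding Zeq by (simp only: image_insert image_Un image_image e mult_zero_right image_ident)
    then show thesis using that[of "inverse P"] P unfolding R_def by simp
  next
    assume ur: "u = r * P'"
    have "e (Fin 0) = (rot r \<circ> g1) Infty"
      by (rule det'[OF eG g3]) (simp add: e P' ur)
    then have "v = r * P" using e g1 by simp
    then have "v = u * \<kappa>" using ur k(1) by simp
    then have "a / c * ((\<zeta> - 1) / (\<zeta> - \<kappa>)) = a / c * ((\<zeta> * \<kappa> - 1) / (\<kappa> * (\<zeta> - 1)) * \<kappa>)"
      unfolding u' v' by (simp only: mult.assoc)
    then have "(\<zeta> - 1) / (\<zeta> - \<kappa>) = (\<zeta> * \<kappa> - 1) / (\<kappa> * (\<zeta> - 1)) * \<kappa>"
      using ac mult_left_cancel[of "a / c"] by (metis divide_eq_0_iff)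
    then have "(\<zeta> * \<kappa> - 1) * (\<zeta> - \<kappa>) = (\<zeta> - 1) ^ 2"
      using nz k by (simp add: divide_simps power2_eq_square)
    then have "(\<kappa> - 1) * (\<zeta> ^ 2 - \<zeta> + 1 - \<kappa> * \<zeta>) = 0" by (simp add: algebra_simps power2_eq_square)
    then have "icosa_ratio * \<zeta> = \<kappa> * \<zeta>" unfolding zr using k by simp
    then have "P = icosa_ratio * P'" using z0 k(1) by simp
    then have e: "inverse P' * (a * P') = a" "inverse P' * (a * P) = icosa_ratio * a" for a
      using P'0 by (simp_all add: field_simps)
    have "(\<lambda>z. inverse P' * z) ` Z = insert 0 (R \<union> (\<lambda>a. icosa_ratio * a) ` R)"
      unfolding Zeq by (simp only: image_insert image_Un image_image e mult_zero_right image_ident Un_commute)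
    then show thesis using that[of "inverse P'"] P'0 unfolding R_def by simp
  qed
qed

text \<open>Together with infinity these are the vertices of a tetrahedron, octahedron or
  icosahedron for k = 3, 4, 5, scaled so that 1 is a vertex.\<close>

definition poly_orbit :: "nat \<Rightarrow> complex set" where
  "poly_orbit k = (if k = 3 then unity_roots 3 else if k = 4 then insert 0 (unity_roots 4)
     else insert 0 (unity_roots 5 \<union> (\<lambda>a. icosa_ratio * a) ` unity_roots 5))"

text \<open>The image c of 1 lies in the set. For k = 5 a multiplier on the inner circle, of radius
  r < 1, would send that circle to radius r^2, strictly between 0 and r, where the set has no
  points.\<close>

lemma poly_orbit_multiplier:
  assumes k: "k \<in> {3, 4, 5}" and c: "c \<noteq> 0" "\<And>z. z \<in> poly_orbit k \<Longrightarrow> c * z \<in> poly_orbit k"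
  shows "c ^ k = 1"
proof -
  have "c * 1 \<in> poly_orbit k" by (rule c(2)) (simp add: poly_orbit_def)
  then consider "c ^ k = 1" | a where "k = 5" "a ^ 5 = 1" "c = icosa_ratio * a"
    using k c(1) by (auto simp: poly_orbit_def split: if_splits)
  then show ?thesis
  proof cases
    case 2
    have nR: "norm a = 1" if "a ^ 5 = 1" for a :: complex
      using that by (metis norm_one norm_power norm_ge_zero power_eq_1_iff zero_less_numeral zero_neq_numeral)
    have "icosa_ratio * a * icosa_ratio \<in> poly_orbit k"
      unfolding 2(3)[symmetric] by (rule c(2)) (use 2(1) in \<open>force simp: poly_orbit_def\<close>)
    then consider "icosa_ratio * a * icosa_ratio = 0" | "(icosa_ratio * a * icosa_ratio) ^ 5 = 1"
      | b where "b ^ 5 = 1" "icosa_ratio * a * icosa_ratio = icosa_ratio * b"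
      using 2(1) by (auto simp: poly_orbit_def)
    then have "norm icosa_ratio * norm icosa_ratio = 1 \<or> norm icosa_ratio = 1"
    proof cases
      case 1
      then show ?thesis using icosa_ratio_nz 2(3) c(1) by auto
    next
      case b: 2
      then show ?thesis using nR[OF b] nR[OF 2(2)] by (simp add: norm_mult)
    next
      case b: (3 b)
      then have "a * icosa_ratio = b" using icosa_ratio_nz by simp
      then have "norm a * norm icosa_ratio = norm b" by (metis norm_mult)
      then show ?thesis using nR[OF b(1)] nR[OF 2(2)] by simp
    qed
    moreover have "norm icosa_ratio * norm icosa_ratio < 1 * 1"
      by (rule mult_strict_mono) (use icosa_ratio_norm in auto)
    ultimately show ?thesis using icosa_ratio_norm by simp
  qed
qed

text \<open>The orbit of infinity has 3, 5 or 11 finite points. Divisibility by k settles whether 0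
  is one of them, and the rotations determine the others up to scaling, with the icosahedral case
  treated separately. The orbit then determines the group by
  \<open>mgroup_eq_stabilizer_of_orbit\<close>.\<close>

lemma polyhedral_normal_form:
  assumes G: "mgroup G" and st: "stab G Infty = rot ` unity_roots k"
    and bound: "\<And>q. card (stab G q) \<le> k" and kn: "(k, card G) \<in> {(3, 12), (4, 24), (5, 60)}"
  obtains m where "m \<in> carrier aut_sphere"
    "cj m G = {f \<in> carrier aut_sphere. f ` insert Infty (Fin ` poly_orbit k) = insert Infty (Fin ` poly_orbit k)}"
proof -
  have k: "k \<in> {3, 4, 5}" "k > 0" using kn by auto
  define Z where "Z = {z. Fin z \<in> orb G Infty}"
  have oZ: "orb G Infty = insert Infty (Fin ` Z)"
    using self_in_orb[OF G, of Infty] unfolding Z_def by (auto, metis image_eqI mem_Collect_eq sphere.exhaust)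
  have "card (rot ` unity_roots k) = k"
    using card_roots_unity_eq[of k] k by (subst card_image) (auto simp: inj_on_def rot_inject)
  then have corb: "card (orb G Infty) * k = card G" using orbit_stabilizer[OF G, of Infty] st by simp
  have fin: "finite (orb G Infty)" using mgroupD(1)[OF G] by (simp add: orb_def)
  then have finZ: "finite Z" using oZ by (simp add: finite_image_iff inj_on_def)
  have "card (orb G Infty) = Suc (card Z)"
    unfolding oZ using finZ by (subst card_insert_disjoint) (auto simp: card_image inj_on_def)
  then have cZ: "Suc (card Z) * k = card G" using corb by simp
  have pres: "g p \<in> orb G Infty" if "g \<in> G" "p \<in> orb G Infty" for g p
    using that orb_eq[OF G that(2)] unfolding orb_def by blast
  have Zcl: "a * z \<in> Z" if "a ^ k = 1" "z \<in> Z" for a z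
  proof -
    have "rot a \<in> G" using that st stab_mono[of G Infty] by blast
    then show ?thesis using pres[of "rot a" "Fin z"] that(2) by (simp add: Z_def)
  qed
  have "\<exists>l. l \<noteq> 0 \<and> (\<lambda>z. l * z) ` Z = poly_orbit k"
  proof -
    have sc: "(\<lambda>z. inverse z0 * z) ` (\<lambda>a. a * z0) ` A = A" if "z0 \<noteq> 0" for z0 :: complex and A
    proof -
      have "inverse z0 * (x * z0) = x" for x using that by (simp add: field_simps)
      then show ?thesis by (simp only: image_image image_ident)
    qed
    consider "k = 3" "card Z = 3" | "k = 4" "card Z = 5" | "k = 5" "card Z = 11"
      using kn cZ by auto
    then show ?thesis
    proof cases
      case 1
      \<comment> \<open>Otherwise two nonzero points would have to split into orbits of
        three.\<close>
      have "0 \<notin> Z"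
      proof
        assume "0 \<in> Z"
        then have "card (Z - {0}) = 2" using 1 finZ by simp
        moreover have "card (Z - {0}) = card ((\<lambda>z. z ^ k) ` (Z - {0})) * k"
          by (rule card_unity_root_orbits) (use finZ Zcl k in \<open>auto simp: power_0_left\<close>)
        ultimately have "2 = card ((\<lambda>z. z ^ k) ` (Z - {0})) * 3" using 1(1) by metis
        then show False by presburger
      qed
      moreover obtain z0 where "z0 \<in> Z" using 1(2) by fastforce
      ultimately have z0: "z0 \<in> Z" "z0 \<noteq> 0" by auto
      have "Z = (\<lambda>a. a * z0) ` unity_roots k"
        by (rule single_unity_root_orbit) (use 1 z0 Zcl in auto)
      then show ?thesis using sc[OF z0(2)] z0 1 by (intro exI[of _ "inverse z0"]) (simp add: poly_orbit_def)
    next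
      case 2
      have "0 \<in> Z"
      proof (rule ccontr)
        assume "0 \<notin> Z"
        then have "card Z = card ((\<lambda>z. z ^ k) ` Z) * k"
          by (intro card_unity_root_orbits) (use finZ Zcl k in auto)
        then have "5 = card ((\<lambda>z. z ^ k) ` Z) * 4" using 2 by metis
        then show False by presburger
      qed
      then have c4: "card (Z - {0}) = 4" using 2 finZ by simp
      then have "Z - {0} \<noteq> {}" by force
      then obtain z0 where z0: "z0 \<in> Z - {0}" by blast
      have "Z - {0} = (\<lambda>a. a * z0) ` unity_roots k"
        by (rule single_unity_root_orbit) (use 2 c4 z0 Zcl k in \<open>auto simp: power_0_left\<close>)
      then have "Z = insert 0 ((\<lambda>a. a * z0) ` unity_roots k)" using \<open>0 \<in> Z\<close> by blast
      then show ?thesis using sc[of z0] z0 2 by (intro exI[of _ "inverse z0"]) (simp add: poly_orbit_def)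
    next
      case 3
      obtain l where "l \<noteq> 0" "(\<lambda>z. l * z) ` Z = insert 0 (unity_roots 5 \<union> (\<lambda>a. icosa_ratio * a) ` unity_roots 5)"
        using icosahedral_orbit[OF G _ _ oZ] st bound 3 by metis
      then show ?thesis using 3 by (auto simp: poly_orbit_def)
    qed
  qed
  then obtain l where l: "l \<noteq> 0" "(\<lambda>z. l * z) ` Z = poly_orbit k" by blast
  note la = rot_aut[OF l(1)]
  have o: "orb (cj (rot l) G) Infty = insert Infty (Fin ` poly_orbit k)"
    using orb_cj_rot[OF l(1) oZ] l(2) by simp
  have "1 \<in> poly_orbit k" by (simp add: poly_orbit_def)
  then have "cj (rot l) G = {f \<in> carrier aut_sphere. f ` orb (cj (rot l) G) Infty = orb (cj (rot l) G) Infty}"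
    by (intro mgroup_eq_stabilizer_of_orbit[OF mgroup_cj[OF la G] stab_cj_rot[OF l(1) st] _ o])
      (use k poly_orbit_multiplier[OF k(1)] in auto)
  then show thesis using that[OF la] o by simp
qed

text \<open>Cyclic, dihedral and polyhedral representatives. They depend on the order n and the
  maximal stabiliser order k alone, so that two groups sharing these numbers have the same normal
  form.\<close>

definition std_group :: "nat \<Rightarrow> nat \<Rightarrow> (sphere \<Rightarrow> sphere) set" where
  "std_group n k = (if n = k then rot ` unity_roots k
     else if n = 2 * k then rot ` unity_roots k \<union> (\<lambda>f. moebius 0 1 1 0 \<circ> f) ` rot ` unity_roots k
     else {f \<in> carrier aut_sphere. f ` insert Infty (Fin ` poly_orbit k) = insert Infty (Fin ` poly_orbit k)})"

lemma mgroup_normal_form: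
  assumes G: "mgroup G" and n: "card G \<ge> 2"
    and k: "card (stab G p) = k" "\<And>q. card (stab G q) \<le> k"
  obtains m where "m \<in> carrier aut_sphere" "cj m G = std_group (card G) k"
proof -
  note ord = mgroup_orders[OF G n k]
  obtain m1 where m1: "m1 \<in> carrier aut_sphere" "stab (cj m1 G) Infty = rot ` unity_roots k"
    using mgroup_normal_stab[OF G k(1) ord(1)] by blast
  define G1 where "G1 = cj m1 G"
  have G1: "mgroup G1" unfolding G1_def by (rule mgroup_cj[OF m1(1) G])
  have cG1: "card G1 = card G" unfolding G1_def by (rule card_cj[OF m1(1)])
  have st1: "stab G1 Infty = rot ` unity_roots k" using m1 by (simp add: G1_def)
  have b1: "card (stab G1 q) \<le> k" for q unfolding G1_def card_stab_cj[OF m1(1)] by (rule k(2))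
  have "\<exists>m\<in>carrier aut_sphere. cj m G1 = std_group (card G) k"
  proof -
    consider "card G = k" | "card G \<noteq> k" "card G = 2 * k"
      | "card G \<noteq> k" "card G \<noteq> 2 * k" "(k, card G) \<in> {(3, 12), (4, 24), (5, 60)}" using ord(2) by blast
    then show ?thesis
    proof cases
      case 1
      have "card (stab G1 Infty) = k"
        unfolding st1 using card_roots_unity_eq[of k] ord(1) by (subst card_image) (auto simp: inj_on_def rot_inject)
      then have "stab G1 Infty = G1"
        using card_subset_eq[OF mgroupD(1)[OF G1] stab_mono] cG1 1 by simp
      then have "cj id G1 = std_group (card G) k" using st1 1 by (simp add: std_group_def cj_id)
      then show ?thesis using aut_id by blast
    next
      case 2
      obtain m where "m \<in> carrier aut_sphere"
        "cj m G1 = rot ` unity_roots k \<union> (\<lambda>f. moebius 0 1 1 0 \<circ> f) ` rot ` unity_roots k"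
        by (rule dihedral_normal_form[OF G1 st1 ord(1)]) (use cG1 2 in simp)
      then show ?thesis using 2 by (intro bexI[of _ m]) (simp_all only: std_group_def if_False if_True simp_thms)
    next
      case 3
      obtain m where "m \<in> carrier aut_sphere"
        "cj m G1 = {f \<in> carrier aut_sphere. f ` insert Infty (Fin ` poly_orbit k) = insert Infty (Fin ` poly_orbit k)}"
        by (rule polyhedral_normal_form[OF G1 st1 b1]) (use cG1 3 in simp)
      then show ?thesis using 3 by (intro bexI[of _ m]) (simp_all only: std_group_def if_False simp_thms)
    qed
  qed
  then obtain m2 where "m2 \<in> carrier aut_sphere" "cj m2 G1 = std_group (card G) k" by blast
  then show thesis using that[of "m2 \<circ> m1"] aut_comp m1(1) cj_comp unfolding G1_def by metis
qed

text \<open>A largest stabiliser in G is cyclic, generated by some f of order k. Its image \<phi>(f)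
  has a fixed point q like every Moebius transformation, and the k distinct powers of \<phi>(f) all
  fix q. Applied in both directions, this makes the maximal stabiliser order an isomorphism
  invariant.\<close>

lemma max_stab_le:
  assumes G: "mgroup G" and H: "mgroup H" and n: "card G \<ge> 2"
    and bij: "inj_on \<phi> G" "\<phi> ` G \<subseteq> H" and hom: "\<And>f g. f \<in> G \<Longrightarrow> g \<in> G \<Longrightarrow> \<phi> (f \<circ> g) = \<phi> f \<circ> \<phi> g"
    and k: "card (stab G p) = k" "\<And>q. card (stab G q) \<le> k"
    and k': "\<And>q. card (stab H q) \<le> k'"
  shows "k \<le> k'"
proof -
  have k2: "k \<ge> 2" using mgroup_orders(1)[OF G n k] .
  obtain m where m: "m \<in> carrier aut_sphere" "stab (cj m G) Infty = rot ` unity_roots k"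
    using mgroup_normal_stab[OF G k(1) k2] by blast
  define \<zeta> where "\<zeta> = cis (2 * pi / real k)"
  have pw: "\<zeta> ^ j = cis (2 * pi * real j / real k)" for j
    by (simp add: \<zeta>_def Complex.DeMoivre mult.commute)
  have "\<zeta> ^ k = 1" using k2 by (simp add: pw)
  then have "rot \<zeta> \<in> cj m G" using m stab_mono[of "cj m G" Infty] by blast
  then obtain f where f: "f \<in> G" "rot \<zeta> = m \<circ> f \<circ> finv m" by (auto simp: cj_def)
  have rp: "rot (\<zeta> ^ j) = m \<circ> f ^^ j \<circ> finv m" for j
  proof (induction j)
    case 0
    then show ?case using aut_inv[OF m(1)] by (simp add: rot_1)
  next
    case (Suc j)
    have "rot (\<zeta> ^ Suc j) = rot \<zeta> \<circ> rot (\<zeta> ^ j)" by (simp add: rot_comp)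
    also have "\<dots> = m \<circ> f ^^ Suc j \<circ> finv m"
      unfolding Suc f(2) by (simp add: fun_eq_iff aut_inv_apply[OF m(1)])
    finally show ?case .
  qed
  have inj: "inj_on (\<lambda>j. f ^^ j) {..<k}"
  proof (rule inj_onI)
    fix i j assume ij: "i \<in> {..<k}" "j \<in> {..<k}" "f ^^ i = f ^^ j"
    then have "\<zeta> ^ i = \<zeta> ^ j" using rp[of i] rp[of j] rot_inject by metis
    moreover have "inj_on (\<lambda>j. cis (2 * pi * real j / real k)) {..<k}"
      using bij_betw_roots_unity[of k] k2 by (simp add: bij_betw_def)
    ultimately show "i = j" using ij unfolding pw by (meson inj_onD)
  qed
  have \<phi>id: "\<phi> id = id"
  proof -
    have "\<phi> id \<in> H" using bij mgroupD(3)[OF G] by blast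
    then have "\<phi> id \<in> carrier aut_sphere" using mgroupD(2)[OF H] by blast
    moreover have "\<phi> id \<circ> \<phi> id = \<phi> id" using hom[OF mgroupD(3)[OF G] mgroupD(3)[OF G]] by simp
    ultimately show ?thesis by (metis aut_inv(2) comp_assoc id_comp)
  qed
  have fj: "f ^^ j \<in> G" for j by (rule mgroup_funpow[OF G f(1)])
  have \<phi>p: "\<phi> (f ^^ j) = \<phi> f ^^ j" for j
  proof (induction j)
    case 0
    then show ?case using \<phi>id by (simp only: funpow.simps)
  next
    case (Suc j)
    then show ?case using hom[OF f(1) fj] by (simp only: funpow.simps)
  qed
  have fH: "\<phi> f \<in> H" using bij f by blast
  obtain q where q: "\<phi> f q = q" using aut_has_fixed_point[OF mgroupD(2)[OF H fH]] by blast
  have "(\<phi> f ^^ j) q = q" for j by (induction j) (simp_all add: q)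
  then have "(\<lambda>j. \<phi> (f ^^ j)) ` {..<k} \<subseteq> stab H q"
    using bij fj unfolding \<phi>p stab_def by (auto simp: mgroup_funpow[OF H fH])
  then have "card ((\<lambda>j. \<phi> (f ^^ j)) ` {..<k}) \<le> card (stab H q)"
    by (intro card_mono) (use mgroupD(1)[OF H] in \<open>simp add: stab_def\<close>)
  moreover have "inj_on (\<lambda>j. \<phi> (f ^^ j)) {..<k}"
    using inj bij(1) fj by (auto simp: inj_on_def)
  ultimately have "k \<le> card (stab H q)" by (simp add: card_image)
  then show ?thesis using k'[of q] by simp
qed

lemma mgroup_max_stab:
  assumes "mgroup G"
  obtains p where "\<And>q. card (stab G q) \<le> card (stab G p)"
proof -
  have "\<forall>q. card (stab G q) \<le> card G" using card_mono[OF mgroupD(1)[OF assms] stab_mono] by blast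
  then show thesis using that ex_has_greatest_nat[of "\<lambda>_. True" Infty "\<lambda>q. card (stab G q)" "Suc (card G)"]
    by (auto simp: less_Suc_eq_le)
qed

text \<open>The order and, by \<open>max_stab_le\<close> in both directions, the maximal stabiliser
  order agree, hence so do the normal forms. The conjugation by m matches the two groups as sets and
  need not induce \<phi>.\<close>

theorem isomorphic_mgroups_conjugate:
  assumes G: "mgroup G" and H: "mgroup H" and n: "card G \<ge> 2"
    and bij: "bij_betw \<phi> G H" and hom: "\<And>f g. f \<in> G \<Longrightarrow> g \<in> G \<Longrightarrow> \<phi> (f \<circ> g) = \<phi> f \<circ> \<phi> g"
  obtains m where "m \<in> carrier aut_sphere" "cj m H = G"
proof -
  have cH: "card H = card G" using bij_betw_same_card[OF bij] by simp
  obtain p where p: "\<And>q. card (stab G q) \<le> card (stab G p)" using mgroup_max_stab[OF G] by blast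
  obtain p' where p': "\<And>q. card (stab H q) \<le> card (stab H p')" using mgroup_max_stab[OF H] by blast
  have "card (stab G p) \<le> card (stab H p')"
    by (rule max_stab_le[OF G H n bij_betw_imp_inj_on[OF bij] _ hom refl p p'])
      (use bij_betw_imp_surj_on[OF bij] in simp_all)
  moreover define \<psi> where "\<psi> = inv_into G \<phi>"
  have \<psi>: "bij_betw \<psi> H G" unfolding \<psi>_def by (rule bij_betw_inv_into[OF bij])
  have \<psi>\<phi>: "\<psi> (\<phi> f) = f" if "f \<in> G" for f
    unfolding \<psi>_def using bij that by (simp add: bij_betw_def)
  have "\<psi> (f \<circ> g) = \<psi> f \<circ> \<psi> g" if "f \<in> H" "g \<in> H" for f g
  proof -
    obtain f' g' where fg: "f' \<in> G" "g' \<in> G" "f = \<phi> f'" "g = \<phi> g'"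
      using \<open>f \<in> H\<close> \<open>g \<in> H\<close> bij by (auto simp: bij_betw_def)
    then have "\<psi> (f \<circ> g) = f' \<circ> g'" using \<psi>\<phi> hom[OF fg(1,2)] mgroupD(4)[OF G fg(1,2)] by metis
    then show ?thesis using fg \<psi>\<phi> by simp
  qed
  then have "card (stab H p') \<le> card (stab G p)"
    by (intro max_stab_le[OF H G _ bij_betw_imp_inj_on[OF \<psi>] _ _ refl p' p])
      (use n cH bij_betw_imp_surj_on[OF \<psi>] in simp_all)
  ultimately have eq: "card (stab H p') = card (stab G p)" by simp
  obtain m where m: "m \<in> carrier aut_sphere" "cj m G = std_group (card G) (card (stab G p))"
    using mgroup_normal_form[OF G n refl p] by blast
  obtain m' where m': "m' \<in> carrier aut_sphere" "cj m' H = std_group (card G) (card (stab G p))"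
    using mgroup_normal_form[OF H _ eq] p' n cH eq by metis
  have "cj (finv m \<circ> m') H = G"
    unfolding cj_comp[OF aut_inv(1)[OF m(1)] m'(1)] m'(2) m(2)[symmetric] by (rule cj_inv[OF m(1)])
  then show thesis using that aut_comp[OF aut_inv(1)[OF m(1)] m'(1)] by blast
qed

section \<open>Deck groups as finite groups of Moebius transformations\<close>

lemma finv_rat_map: "rat_degree m = 1 \<Longrightarrow> m \<odot> m' = ratvar \<Longrightarrow> m' \<odot> m = ratvar \<Longrightarrow> rat_degree m' = 1
    \<Longrightarrow> finv (rat_map m) = rat_map m'"
  by (rule inv_unique_comp)
    (simp_all add: rat_map_ratcomp[OF degree_one_not_const, symmetric] rat_map_ratvar)

lemma mgroup_rat_map:
  assumes "finite D" and deg: "\<And>m. m \<in> D \<Longrightarrow> rat_degree m = 1" and "ratvar \<in> D"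
    and cl: "\<And>m m'. m \<in> D \<Longrightarrow> m' \<in> D \<Longrightarrow> m \<odot> m' \<in> D"
    and inv: "\<And>m. m \<in> D \<Longrightarrow> \<exists>m'\<in>D. m \<odot> m' = ratvar \<and> m' \<odot> m = ratvar"
  shows "mgroup (rat_map ` D)"
  unfolding mgroup_def
proof (intro conjI ballI)
  show "finite (rat_map ` D)" using assms(1) by simp
  show "rat_map ` D \<subseteq> carrier aut_sphere" using deg carrier_aut_sphere_eq by auto
  show "id \<in> rat_map ` D" using assms(3) rat_map_ratvar by (metis imageI)
next
  fix f g assume "f \<in> rat_map ` D" "g \<in> rat_map ` D"
  then obtain m m' where m: "m \<in> D" "f = rat_map m" "m' \<in> D" "g = rat_map m'" by blast
  then have "f \<circ> g = rat_map (m \<odot> m')" using rat_map_ratcomp[OF degree_one_not_const[OF deg]] by simp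
  then show "f \<circ> g \<in> rat_map ` D" using cl m by blast
next
  fix f assume "f \<in> rat_map ` D"
  then obtain m where m: "m \<in> D" "f = rat_map m" by blast
  obtain m' where "m' \<in> D" "m \<odot> m' = ratvar" "m' \<odot> m = ratvar" using inv[OF m(1)] by blast
  then show "finv f \<in> rat_map ` D" using finv_rat_map[of m m'] m deg by auto
qed

lemma mgroup_deck_group:
  assumes "F \<notin> range const_ratfun"
  shows "mgroup (deck_group F)"
  unfolding rat_map_deck[symmetric]
proof (rule mgroup_rat_map)
  fix m assume "m \<in> deck F"
  then show "\<exists>m'\<in>deck F. m \<odot> m' = ratvar \<and> m' \<odot> m = ratvar" using deck_inverse by metis
qed (use finite_deck[OF assms] ratvar_in_deck deck_ratcomp in \<open>auto simp: deck_def\<close>)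

lemma aut_sphere_simps: "\<one>\<^bsub>aut_sphere\<^esub> = id" "f \<otimes>\<^bsub>aut_sphere\<^esub> g = f \<circ> g"
  by (simp_all add: aut_sphere_def)

lemma m_inv_aut_sphere: "f \<in> carrier aut_sphere \<Longrightarrow> m_inv aut_sphere f = finv f"
  by (rule group.inv_equality[OF group_aut_sphere]) (simp_all add: aut_sphere_simps aut_inv)

lemma mgroup_imp_subgroup: "mgroup G \<Longrightarrow> subgroup G aut_sphere"
  by (rule group.subgroupI[OF group_aut_sphere])
    (auto simp: mgroup_def aut_sphere_simps m_inv_aut_sphere subset_iff)

lemma mgroup_generate:
  assumes "S \<subseteq> carrier aut_sphere" "finite (generate aut_sphere S)"
  shows "mgroup (generate aut_sphere S)"
proof -
  interpret subgroup "generate aut_sphere S" aut_sphere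
    by (rule group.generate_is_subgroup[OF group_aut_sphere assms(1)])
  show ?thesis unfolding mgroup_def
    using assms(2) subset one_closed m_closed m_inv_closed m_inv_aut_sphere mem_carrier
    by (auto simp: aut_sphere_simps)
qed

lemma deck_group_ratcomp_aut:
  assumes m: "rat_degree \<mu> = 1" "rat_degree \<mu>' = 1" "\<mu> \<odot> \<mu>' = ratvar" "\<mu>' \<odot> \<mu> = ratvar"
  shows "deck_group (U \<odot> \<mu>') = cj (rat_map \<mu>) (deck_group U)"
proof -
  define f where "f = rat_map \<mu>"
  have fa: "f \<in> carrier aut_sphere" unfolding f_def using m carrier_aut_sphere_eq by auto
  have fi: "finv f = rat_map \<mu>'" unfolding f_def using m by (intro finv_rat_map)
  have comp: "rat_map (U \<odot> \<mu>') = rat_map U \<circ> finv f"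
    unfolding fi by (rule rat_map_ratcomp[OF degree_one_not_const[OF m(2)]])
  note fia = aut_inv_apply[OF fa]
  show ?thesis unfolding f_def[symmetric]
  proof (intro equalityI subsetI)
    fix g assume "g \<in> deck_group (U \<odot> \<mu>')"
    then have g: "g \<in> carrier aut_sphere" "rat_map U (finv f (g x)) = rat_map U (finv f x)" for x
      unfolding deck_group_def comp by (auto dest: fun_cong[of _ _ x])
    have "finv f \<circ> g \<circ> f \<in> deck_group U"
      unfolding deck_group_def using g fa by (auto simp: fun_eq_iff fia intro!: aut_comp aut_inv)
    moreover have "g = f \<circ> (finv f \<circ> g \<circ> f) \<circ> finv f" by (simp add: fun_eq_iff fia)
    ultimately show "g \<in> cj f (deck_group U)" unfolding cj_def by blast
  next
    fix g assume "g \<in> cj f (deck_group U)"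
    then obtain h where h: "h \<in> carrier aut_sphere" "rat_map U \<circ> h = rat_map U" "g = f \<circ> h \<circ> finv f"
      by (auto simp: cj_def deck_group_def)
    have "rat_map U (h x) = rat_map U x" for x using fun_cong[OF h(2), of x] by simp
    moreover have "g \<in> carrier aut_sphere" unfolding h(3) by (intro aut_comp aut_inv fa h)
    ultimately show "g \<in> deck_group (U \<odot> \<mu>')"
      unfolding deck_group_def comp by (simp add: fun_eq_iff fia h(3))
  qed
qed

text \<open>Solutions are roots of numer B - c denom B, a nonzero polynomial because c is not a
  constant. The bound is applied in C(z) and again in its algebraic closure.\<close>

lemma (in complex_embedding) card_ev_fibre:
  assumes c: "c \<notin> range emb"
  shows "finite {s. s \<notin> range emb \<and> ev s B = c}" "card {s. s \<notin> range emb \<and> ev s B = c} \<le> rat_degree B"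
proof -
  define g where "g = map_poly emb (numer B) - smult c (map_poly emb (denom B))"
  have cg: "coeff g i = emb (coeff (numer B) i) - c * emb (coeff (denom B) i)" for i
    by (simp add: g_def coeff_map_poly)
  have "g \<noteq> 0"
  proof
    assume "g = 0"
    define i where "i = degree (denom B)"
    have "coeff (denom B) i \<noteq> 0" using denom_nonzero by (simp add: i_def)
    moreover have eq: "emb (coeff (numer B) i) = c * emb (coeff (denom B) i)"
      using cg[of i] \<open>g = 0\<close> by simp
    ultimately have "c = emb (coeff (numer B) i) * inverse (emb (coeff (denom B) i))"
      by simp
    also have "inverse (emb (coeff (denom B) i)) = emb (inverse (coeff (denom B) i))"
      by (rule inverse_unique) (use \<open>coeff (denom B) i \<noteq> 0\<close> in \<open>simp flip: emb_mult\<close>)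
    finally have "c = emb (coeff (numer B) i * inverse (coeff (denom B) i))" by simp
    then show False using c by blast
  qed
  have "degree g \<le> rat_degree B"
    by (rule degree_le) (auto simp: cg rat_degree_def coeff_eq_0)
  have sub: "{s. s \<notin> range emb \<and> ev s B = c} \<subseteq> {s. poly g s = 0}"
  proof safe
    fix s assume s: "s \<notin> range emb" "c = ev s B"
    then have "pev s (denom B) \<noteq> 0" using pev_nonzero denom_nonzero by blast
    then show "poly g s = 0" by (simp add: g_def s ev_def pev_def)
  qed
  then show "finite {s. s \<notin> range emb \<and> ev s B = c}"
    using poly_roots_finite[OF \<open>g \<noteq> 0\<close>] finite_subset by blast
  show "card {s. s \<notin> range emb \<and> ev s B = c} \<le> rat_degree B"
    using card_mono[OF poly_roots_finite[OF \<open>g \<noteq> 0\<close>] sub] card_poly_roots_bound[OF \<open>g \<noteq> 0\<close>]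
      \<open>degree g \<le> rat_degree B\<close> by linarith
qed

lemma ratcomp_const_left: "F \<in> range const_ratfun \<Longrightarrow> V \<notin> range const_ratfun \<Longrightarrow> F \<odot> V \<in> range const_ratfun"
  by auto

section \<open>Linear disjointness\<close>

locale generating_pair =
  fixes x y :: ratfun
  assumes x: "x \<notin> range const_ratfun" "card (deck x) = rat_degree x"
    and y: "y \<notin> range const_ratfun"
    and gen: "adjoin {x, y} = UNIV"
begin

lemma deck_nc: "\<sigma> \<in> deck x \<Longrightarrow> \<sigma> \<notin> range const_ratfun"
  using degree_one_not_const by (simp add: deck_def)

text \<open>The functions fixed by \<sigma> form a field; if it contains x and y, it contains z.
  This is where C(x, y) = C(z) enters.\<close>

lemma deck_fixing_y:
  assumes "\<sigma> \<in> deck x" "y \<odot> \<sigma> = y"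
  shows "\<sigma> = ratvar"
proof -
  have "adjoin {x, y} \<subseteq> {F. F \<odot> \<sigma> = F}"
    by (rule adjoin_least[OF const_subfield_fixed[OF deck_nc[OF assms(1)]]])
      (use assms in \<open>simp add: deck_def\<close>)
  then have "ratvar \<odot> \<sigma> = ratvar" using gen by blast
  then show ?thesis using deck_nc[OF assms(1)] by simp
qed

lemma conjugates_distinct: "inj_on (\<lambda>\<sigma>. y \<odot> \<sigma>) (deck x)"
proof (rule inj_onI)
  fix \<sigma> \<tau> assume st: "\<sigma> \<in> deck x" "\<tau> \<in> deck x" "y \<odot> \<sigma> = y \<odot> \<tau>"
  obtain \<tau>' where t: "\<tau>' \<in> deck x" "\<tau> \<odot> \<tau>' = ratvar" "\<tau>' \<odot> \<tau> = ratvar"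
    using deck_inverse[OF st(2)] by blast
  have "y \<odot> (\<sigma> \<odot> \<tau>') = y \<odot> (\<tau> \<odot> \<tau>')"
    using ratcomp_assoc[OF deck_nc[OF t(1)] deck_nc[OF st(1)], of y]
      ratcomp_assoc[OF deck_nc[OF t(1)] deck_nc[OF st(2)], of y] st(3) by simp
  then have "\<sigma> \<odot> \<tau>' = ratvar" using deck_fixing_y[OF deck_ratcomp[OF st(1) t(1)]] t by simp
  then have "\<sigma> \<odot> \<tau>' = \<tau> \<odot> \<tau>'" using t by simp
  then show "\<sigma> = \<tau>" using ratcomp_right_cancel[OF deck_nc[OF t(1)]] by blast
qed

lemma y_conj_nc: "\<sigma> \<in> deck x \<Longrightarrow> y \<odot> \<sigma> \<notin> range const_ratfun"
  by (rule ratcomp_not_const[OF deck_nc y])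

text \<open>The conjugates \<open>y \<circ> \<sigma>\<close> are distinct solutions \<open>t\<close> of \<open>B(t) = W\<close>.\<close>

lemma degree_common_left_factor:
  assumes W: "W \<notin> range const_ratfun" "W = A \<odot> x" "W = B \<odot> y"
  shows "rat_degree x \<le> rat_degree B"
proof -
  have "(\<lambda>\<sigma>. y \<odot> \<sigma>) ` deck x \<subseteq> {s. s \<notin> range const_ratfun \<and> B \<odot> s = W}"
  proof (rule image_subsetI)
    fix \<sigma> assume s: "\<sigma> \<in> deck x"
    have "B \<odot> (y \<odot> \<sigma>) = W \<odot> \<sigma>" unfolding W(3) by (rule ratcomp_assoc[OF deck_nc[OF s] y, symmetric])
    also have "\<dots> = A \<odot> (x \<odot> \<sigma>)" unfolding W(2) by (rule ratcomp_assoc[OF deck_nc[OF s] x(1)])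
    also have "\<dots> = W" using s W(2) by (simp add: deck_def)
    finally show "y \<odot> \<sigma> \<in> {s. s \<notin> range const_ratfun \<and> B \<odot> s = W}"
      using y_conj_nc[OF s] by blast
  qed
  then have "card ((\<lambda>\<sigma>. y \<odot> \<sigma>) ` deck x) \<le> rat_degree B"
    using card_mono[OF ratfun.card_ev_fibre(1)[OF W(1)]] ratfun.card_ev_fibre(2)[OF W(1)] order_trans by blast
  then show ?thesis using card_image[OF conjugates_distinct] x(2) by simp
qed

lemma const_subfield_meet: "const_subfield (adjoin {x} \<inter> adjoin {y})"
  by (intro const_subfield_Int const_subfield_adjoin)

lemma mem_meetE:
  assumes "W \<in> adjoin {x} \<inter> adjoin {y}"
  obtains A B where "W = A \<odot> x" "W = B \<odot> y"
  using assms adjoin_singleton[OF x(1)] adjoin_singleton[OF y] by blast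

lemma mem_meetI: "W = A \<odot> x \<Longrightarrow> W = B \<odot> y \<Longrightarrow> W \<in> adjoin {x} \<inter> adjoin {y}"
  using adjoin_singleton[OF x(1)] adjoin_singleton[OF y] by blast

text \<open>Over the constants z is transcendental, so finite dimension makes the intersection some
  C(W) of codegree deg W. Writing W = B o y gives deg W = deg B deg y, and always deg B \<ge> deg x
  by \<open>degree_common_left_factor\<close>. A common W with deg B = deg x thus has the least
  possible degree, which is that of a generator.\<close>

theorem dimension_meet_iff:
  "ring.dimension ratfun_field (rat_degree x * rat_degree y) (adjoin {x} \<inter> adjoin {y}) (carrier ratfun_field)
   \<longleftrightarrow> (\<exists>W A B. W \<notin> range const_ratfun \<and> W = A \<odot> x \<and> W = B \<odot> y \<and> rat_degree B = rat_degree x)"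
    (is "?dim \<longleftrightarrow> _")
proof
  interpret field ratfun_field by (rule field_ratfun_field)
  define K where "K = adjoin {x} \<inter> adjoin {y}"
  have K: "const_subfield K" unfolding K_def by (rule const_subfield_meet)
  note sub = const_subfield_imp_subfield[OF K]
  assume "?dim"
  then have dim: "dimension (rat_degree x * rat_degree y) K (carrier ratfun_field)" by (simp add: K_def)
  have "K \<noteq> range const_ratfun"
  proof
    assume KC: "K = range const_ratfun"
    \<comment> \<open>One power of z more than the assumed dimension.\<close>
    define d where "d = Suc (rat_degree x * rat_degree y)"
    have "independent K (map (\<lambda>i. ratvar ^ i) [0..<d])"
      by (rule independent_powers[OF K]) (use const_poly_ratvar_nonzero in \<open>auto simp: KC d_def\<close>)
    then have "d \<le> rat_degree x * rat_degree y"
      using independent_length_le_dimension[OF sub dim, of "map (\<lambda>i. ratvar ^ i) [0..<d]"] by simp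
    then show False by (simp add: d_def)
  qed
  then obtain W where W: "W \<notin> range const_ratfun" "K = range (\<lambda>F. F \<odot> W)" using lueroth[OF K] by blast
  have "dimension (rat_degree W) K (carrier ratfun_field)"
    using dimension_adjoin[OF W(1)] adjoin_singleton[OF W(1)] W(2) by simp
  then have deg: "rat_degree W = rat_degree x * rat_degree y" using dimension_is_inj[OF sub _ dim] by blast
  have "W = ratvar \<odot> W" using W(1) by simp
  then have "W \<in> K" using W(2) by blast
  then obtain A B where AB: "W = A \<odot> x" "W = B \<odot> y" unfolding K_def by (rule mem_meetE)
  have "rat_degree W = rat_degree B * rat_degree y" unfolding AB(2) by (rule rat_degree_ratcomp[OF y])
  moreover have "rat_degree y > 0" using y rat_degree_eq_0_iff by blast
  ultimately have "rat_degree B = rat_degree x" using deg by simp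
  then show "\<exists>W A B. W \<notin> range const_ratfun \<and> W = A \<odot> x \<and> W = B \<odot> y \<and> rat_degree B = rat_degree x"
    using W(1) AB by blast
next
  assume "\<exists>W A B. W \<notin> range const_ratfun \<and> W = A \<odot> x \<and> W = B \<odot> y \<and> rat_degree B = rat_degree x"
  then obtain W A B where W: "W \<notin> range const_ratfun" "W = A \<odot> x" "W = B \<odot> y" "rat_degree B = rat_degree x"
    by blast
  define K where "K = adjoin {x} \<inter> adjoin {y}"
  have K: "const_subfield K" unfolding K_def by (rule const_subfield_meet)
  have WK: "W \<in> K" unfolding K_def by (rule mem_meetI[OF W(2,3)])
  obtain W' where W': "W' \<notin> range const_ratfun" "K = range (\<lambda>F. F \<odot> W')"
    using lueroth[OF K] WK W(1) by blast
  obtain S where S: "W = S \<odot> W'" using WK W'(2) by blast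
  have "W' = ratvar \<odot> W'" using W'(1) by simp
  then have "W' \<in> K" using W'(2) by blast
  then obtain A' B' where AB: "W' = A' \<odot> x" "W' = B' \<odot> y" unfolding K_def by (rule mem_meetE)
  have "rat_degree x \<le> rat_degree B'" by (rule degree_common_left_factor[OF W'(1) AB])
  moreover have dW': "rat_degree W' = rat_degree B' * rat_degree y"
    unfolding AB(2) by (rule rat_degree_ratcomp[OF y])
  moreover have dW: "rat_degree W = rat_degree x * rat_degree y"
    unfolding W(3) W(4)[symmetric] by (rule rat_degree_ratcomp[OF y])
  moreover have "rat_degree W = rat_degree S * rat_degree W'"
    unfolding S by (rule rat_degree_ratcomp[OF W'(1)])
  moreover have "rat_degree W > 0" using W(1) rat_degree_eq_0_iff by blast
  then have "rat_degree W' \<le> rat_degree W" using calculation(4) by (metis dvd_imp_le dvd_triv_right)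
  ultimately have "rat_degree W' = rat_degree x * rat_degree y"
    by (metis le_antisym mult_le_mono1)
  then show ?dim
    using dimension_adjoin[OF W'(1)] adjoin_singleton[OF W'(1)] W'(2) K_def by simp
qed

end

section \<open>The normal closure of \<open>\<complex>(Y)\<close>\<close>

lemma inv_into_deck:
  assumes "\<sigma> \<in> deck F"
  shows "inv_into (deck F) rat_map (rat_map \<sigma>) = \<sigma>"
  by (rule inv_into_f_f[OF inj_on_rat_map assms])

text \<open>With trivial intersection the products g o h are pairwise distinct, so there are already
  |G| |H| = |M| of them.\<close>

lemma generate_product_set:
  assumes G: "mgroup G" "G \<subseteq> M" and H: "mgroup H" "H \<subseteq> M" and M: "mgroup M"
    and disj: "G \<inter> H = {id}" and card: "card M = card G * card H"
  shows "generate aut_sphere (G \<union> H) = M"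
proof
  interpret group aut_sphere by (rule group_aut_sphere)
  show sub: "generate aut_sphere (G \<union> H) \<subseteq> M"
    by (rule generate_subgroup_incl[OF _ mgroup_imp_subgroup[OF M]]) (use G H in blast)
  define P where "P = (\<lambda>(g, h). g \<circ> h) ` (G \<times> H)"
  have "inj_on (\<lambda>(g, h). g \<circ> h) (G \<times> H)"
  proof (rule inj_onI, clarify)
    fix g h g' h' assume gh: "g \<in> G" "h \<in> H" "g' \<in> G" "h' \<in> H" and eq: "g \<circ> h = g' \<circ> h'"
    note ga = aut_inv[OF mgroupD(2)[OF G(1) gh(3)]] and ha = aut_inv[OF mgroupD(2)[OF H(1) gh(2)]]
    have "finv g' \<circ> (g \<circ> h) \<circ> finv h = finv g' \<circ> (g' \<circ> h') \<circ> finv h" unfolding eq ..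
    then have "finv g' \<circ> g \<circ> (h \<circ> finv h) = (finv g' \<circ> g') \<circ> h' \<circ> finv h" by (simp only: comp_assoc)
    then have e: "finv g' \<circ> g = h' \<circ> finv h" by (simp only: ga(2) ha(3) comp_id id_comp)
    have "finv g' \<circ> g \<in> G" using gh mgroupD(4,5)[OF G(1)] by blast
    moreover have "h' \<circ> finv h \<in> H" using gh mgroupD(4,5)[OF H(1)] by blast
    ultimately have i: "finv g' \<circ> g = id" "h' \<circ> finv h = id" using e disj by auto
    have "g = g' \<circ> (finv g' \<circ> g)" by (simp only: comp_assoc[symmetric] ga(3) id_comp)
    moreover have "h' = (h' \<circ> finv h) \<circ> h" by (simp only: comp_assoc ha(2) comp_id)
    ultimately show "g = g' \<and> h = h'" using i by simp
  qed
  then have "card P = card M" unfolding P_def card by (simp add: card_image card_cartesian_product)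
  moreover have PM: "P \<subseteq> M" unfolding P_def using G(2) H(2) mgroupD(4)[OF M] by auto
  ultimately have "P = M" using card_subset_eq[OF mgroupD(1)[OF M]] by blast
  moreover have "P \<subseteq> generate aut_sphere (G \<union> H)"
    unfolding P_def using generate.eng[of _ aut_sphere "G \<union> H"] generate.incl[of _ "G \<union> H" aut_sphere]
    by (auto simp: aut_sphere_simps)
  ultimately show "M \<subseteq> generate aut_sphere (G \<union> H)" by simp
qed

context generating_pair
begin

text \<open>The conjugates of \<open>y\<close> over \<open>\<complex>(W)\<close> are the functions \<open>y \<circ> \<sigma>\<close>, all of which lie in \<open>\<complex>(z)\<close>;
  they generate the normal closure \<open>\<complex>(V)\<close> of \<open>\<complex>(y)\<close>. Solutions \<open>t\<close> of \<open>R(t) = R(z)\<close> in the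
  algebraic closure permute them and are therefore rational functions.\<close>

lemma normal_closure:
  assumes W: "W \<notin> range const_ratfun" "W = A \<odot> x" "W = B \<odot> y" and B: "rat_degree B = rat_degree x"
  obtains U V \<phi> where "V \<notin> range const_ratfun" "U \<notin> range const_ratfun" "y = U \<odot> V"
    "\<And>\<sigma>. \<sigma> \<in> deck x \<Longrightarrow> rat_degree (\<phi> \<sigma>) = 1 \<and> V \<odot> \<sigma> = \<phi> \<sigma> \<odot> V \<and> \<phi> \<sigma> \<in> deck (B \<odot> U)"
    "card (deck U) = rat_degree U" "card (deck (B \<odot> U)) = rat_degree x * rat_degree U"
proof -
  have Wc: "W \<odot> \<sigma> = W" if "\<sigma> \<in> deck x" for \<sigma>
  proof -
    have "W \<odot> \<sigma> = A \<odot> (x \<odot> \<sigma>)" unfolding W(2) by (rule ratcomp_assoc[OF deck_nc[OF that] x(1)])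
    then show ?thesis using that W(2) by (simp add: deck_def)
  qed
  define N where "N = adjoin ((\<lambda>\<sigma>. y \<odot> \<sigma>) ` deck x)"
  have N: "const_subfield N" unfolding N_def by (rule const_subfield_adjoin)
  have yN: "y \<odot> \<sigma> \<in> N" if "\<sigma> \<in> deck x" for \<sigma> unfolding N_def by (rule subsetD[OF adjoin_incl imageI[OF that]])
  have yN1: "y \<in> N" using yN[OF ratvar_in_deck] by simp
  then have "N \<noteq> range const_ratfun" using y by blast
  then obtain V where V: "V \<notin> range const_ratfun" "N = range (\<lambda>F. F \<odot> V)" by (rule lueroth[OF N])
  obtain U where U: "y = U \<odot> V" using yN1 V(2) by blast
  have Unc: "U \<notin> range const_ratfun" using ratcomp_const_left[OF _ V(1)] y U by blast
  have "V = ratvar \<odot> V" using V by simp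
  then have VN: "V \<in> N" using V by blast
  \<comment> \<open>Precomposition with \<sigma> maps the set of generators y o \<tau> of N = C(V)
    to itself, hence also N.\<close>
  have "\<exists>p. V \<odot> \<sigma> = p \<odot> V" if s: "\<sigma> \<in> deck x" for \<sigma>
  proof -
    have "N \<subseteq> {F. F \<odot> \<sigma> \<in> N}"
      unfolding N_def
    proof (rule adjoin_least)
      show "const_subfield {F. F \<odot> \<sigma> \<in> adjoin ((\<lambda>\<sigma>. y \<odot> \<sigma>) ` deck x)}"
        by (rule const_subfield_vimage_ratcomp[OF const_subfield_adjoin deck_nc[OF s]])
      show "(\<lambda>\<sigma>. y \<odot> \<sigma>) ` deck x \<subseteq> {F. F \<odot> \<sigma> \<in> adjoin ((\<lambda>\<sigma>. y \<odot> \<sigma>) ` deck x)}"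
      proof (rule image_subsetI)
        fix \<tau> assume t: "\<tau> \<in> deck x"
        have "y \<odot> \<tau> \<odot> \<sigma> = y \<odot> (\<tau> \<odot> \<sigma>)" by (rule ratcomp_assoc[OF deck_nc[OF s] deck_nc[OF t]])
        then show "y \<odot> \<tau> \<in> {F. F \<odot> \<sigma> \<in> adjoin ((\<lambda>\<sigma>. y \<odot> \<sigma>) ` deck x)}"
          using yN[OF deck_ratcomp[OF t s]] by (simp add: N_def)
      qed
    qed
    then have "V \<odot> \<sigma> \<in> N" using VN by blast
    then show ?thesis using V by blast
  qed
  then obtain \<phi> where \<phi>: "\<And>\<sigma>. \<sigma> \<in> deck x \<Longrightarrow> V \<odot> \<sigma> = \<phi> \<sigma> \<odot> V" by metis
  have deg\<phi>: "rat_degree (\<phi> \<sigma>) = 1" if s: "\<sigma> \<in> deck x" for \<sigma>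
  proof -
    have "rat_degree V * rat_degree \<sigma> = rat_degree (\<phi> \<sigma>) * rat_degree V"
      using \<phi>[OF s] rat_degree_ratcomp[OF deck_nc[OF s], of V] rat_degree_ratcomp[OF V(1), of "\<phi> \<sigma>"] by metis
    moreover have "rat_degree V \<noteq> 0" using V(1) rat_degree_eq_0_iff by blast
    ultimately show ?thesis using s by (simp add: deck_def)
  qed
  note \<phi>nc = degree_one_not_const[OF deg\<phi>]
  define R where "R = B \<odot> U"
  have RV: "R \<odot> V = W" unfolding R_def W(3) U by (rule ratcomp_assoc[OF V(1) Unc])
  have Bnc: "B \<notin> range const_ratfun" using W(1,3) ratcomp_const_left[OF _ y] by blast
  have Rnc: "R \<notin> range const_ratfun" unfolding R_def by (rule ratcomp_not_const[OF Unc Bnc])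
  have R\<phi>: "R \<odot> \<phi> \<sigma> = R" if s: "\<sigma> \<in> deck x" for \<sigma>
  proof -
    have "R \<odot> \<phi> \<sigma> \<odot> V = R \<odot> (V \<odot> \<sigma>)" unfolding \<phi>[OF s] by (rule ratcomp_assoc[OF V(1) \<phi>nc[OF s]])
    also have "\<dots> = R \<odot> V \<odot> \<sigma>" by (rule ratcomp_assoc[OF deck_nc[OF s] V(1), symmetric])
    also have "\<dots> = R \<odot> V" unfolding RV by (rule Wc[OF s])
    finally show ?thesis using ratcomp_right_cancel[OF V(1)] by blast
  qed
  \<comment> \<open>The conjugates y o \<sigma> expressed in the coordinate V; they all solve B(s) =
    R.\<close>
  define Us where "Us \<sigma> = U \<odot> \<phi> \<sigma>" for \<sigma>
  have UsV: "Us \<sigma> \<odot> V = y \<odot> \<sigma>" if s: "\<sigma> \<in> deck x" for \<sigma>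
  proof -
    have "Us \<sigma> \<odot> V = U \<odot> (V \<odot> \<sigma>)" unfolding Us_def \<phi>[OF s] by (rule ratcomp_assoc[OF V(1) \<phi>nc[OF s]])
    also have "\<dots> = y \<odot> \<sigma>" unfolding U by (rule ratcomp_assoc[OF deck_nc[OF s] V(1), symmetric])
    finally show ?thesis .
  qed
  have Us_nc: "Us \<sigma> \<notin> range const_ratfun" if s: "\<sigma> \<in> deck x" for \<sigma>
    unfolding Us_def by (rule ratcomp_not_const[OF \<phi>nc[OF s] Unc])
  have BUs: "B \<odot> Us \<sigma> = R" if s: "\<sigma> \<in> deck x" for \<sigma>
    using R\<phi>[OF s] unfolding R_def Us_def ratcomp_assoc[OF \<phi>nc[OF s] Unc] .
  have inj_Us: "inj_on Us (deck x)"
    by (rule inj_onI) (metis UsV conjugates_distinct inj_onD)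
  let ?emb = "\<lambda>c. to_ac (const_ratfun c)"
  have to_ac_nc: "to_ac F \<notin> range ?emb" if "F \<notin> range const_ratfun" for F using that by auto
  have split: "t \<in> range to_ac" if t: "t \<notin> range ?emb" "ac.ev t R = to_ac R" for t
  proof -
    define S where "S = {s. s \<notin> range ?emb \<and> ac.ev s B = to_ac R}"
    note S = ac.card_ev_fibre[OF to_ac_nc[OF Rnc], of B, folded S_def]
    have "to_ac ` Us ` deck x \<subseteq> S"
    proof (clarify)
      fix \<sigma> assume s: "\<sigma> \<in> deck x"
      show "to_ac (Us \<sigma>) \<in> S"
        unfolding S_def using to_ac_nc[OF Us_nc[OF s]] to_ac_ratcomp[OF Us_nc[OF s], of B] BUs[OF s] by simp
    qed
    moreover have "card (to_ac ` Us ` deck x) = rat_degree x"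
      using inj_Us x(2) by (simp add: card_image inj_on_def)
    \<comment> \<open>There are at most deg B = deg x solutions, and the conjugates provide that
      many.\<close>
    ultimately have SU: "S = to_ac ` Us ` deck x"
      using S B by (metis card_seteq)
    \<comment> \<open>The functions whose value at t lies in C(z) form a field containing every
      \<open>Us \<sigma>\<close>. As the y o \<sigma> generate C(V), the \<open>Us \<sigma>\<close>
      generate C(z); so z belongs to E, and its value at t is t.\<close>
    define E where "E = {F. ac.ev t F \<in> range to_ac}"
    have E: "const_subfield E"
      unfolding const_subfield_def E_def
      by (auto simp: t(1) ac.ev_add[OF t(1)] ac.ev_mult[OF t(1)] ac.ev_uminus[OF t(1)] ac.ev_inverse[OF t(1)]
          ac.ev_const[OF t(1)] simp flip: to_ac_add to_ac_mult to_ac_minus to_ac_inverse)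
    have UE: "Us \<sigma> \<in> E" if s: "\<sigma> \<in> deck x" for \<sigma>
    proof -
      have "ac.ev (ac.ev t (Us \<sigma>)) B = ac.ev t R"
        using ac.ev_ratcomp[OF t(1) Us_nc[OF s], of B] BUs[OF s] by simp
      then have "ac.ev t (Us \<sigma>) \<in> S"
        unfolding S_def using ac.ev_not_emb[OF t(1) Us_nc[OF s]] t(2) by simp
      then show ?thesis unfolding SU E_def by auto
    qed
    define L where "L = adjoin (Us ` deck x)"
    have "N \<subseteq> (\<lambda>F. F \<odot> V) ` L"
      unfolding N_def
    proof (rule adjoin_least)
      show "const_subfield ((\<lambda>F. F \<odot> V) ` L)"
        unfolding L_def by (rule const_subfield_image_ratcomp[OF const_subfield_adjoin V(1)])
      show "(\<lambda>\<sigma>. y \<odot> \<sigma>) ` deck x \<subseteq> (\<lambda>F. F \<odot> V) ` L"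
      proof (rule image_subsetI)
        fix \<sigma> assume s: "\<sigma> \<in> deck x"
        have "Us \<sigma> \<in> L" unfolding L_def by (rule subsetD[OF adjoin_incl imageI[OF s]])
        then show "y \<odot> \<sigma> \<in> (\<lambda>F. F \<odot> V) ` L" using UsV[OF s] by (metis image_eqI)
      qed
    qed
    then obtain F where F: "F \<in> L" "V = F \<odot> V" using VN by blast
    then have "F = ratvar" using ratcomp_right_cancel[OF V(1), of F ratvar] V(1) by simp
    moreover have "L \<subseteq> E" unfolding L_def by (rule adjoin_least[OF E]) (use UE in blast)
    ultimately have "ratvar \<in> E" using F by blast
    then show ?thesis using t(1) by (simp add: E_def)
  qed
  have "card (deck R) = rat_degree R" by (rule card_deck_eq_degree[OF Rnc split])
  moreover have "rat_degree R = rat_degree x * rat_degree U"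
    unfolding R_def B[symmetric] by (rule rat_degree_ratcomp[OF Unc])
  \<comment> \<open>A solution of U(t) = U(z) also solves R(t) = R(z), so it is rational by the same
    argument.\<close>
  moreover have "card (deck U) = rat_degree U"
  proof (rule card_deck_eq_degree[OF Unc])
    fix t assume t: "t \<notin> range ?emb" "ac.ev t U = to_ac U"
    have "ac.ev t R = ac.ev (to_ac U) B" unfolding R_def ac.ev_ratcomp[OF t(1) Unc] t(2) ..
    also have "\<dots> = to_ac R" unfolding R_def by (rule to_ac_ratcomp[OF Unc, symmetric])
    finally show "t \<in> range to_ac" by (rule split[OF t(1)])
  qed
  ultimately show thesis
    using that[OF V(1) Unc U, of \<phi>] deg\<phi> \<phi> R\<phi> unfolding R_def[symmetric] deck_def by simp
qed

text \<open>The image of \<open>deck x\<close> under \<open>\<phi>\<close> is a complement of \<open>deck U\<close> in \<open>deck (B \<circ> U)\<close>; conjugating it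
  to \<open>deck x\<close> makes \<open>V\<close> equivariant.\<close>

lemma factorization_if:
  assumes W: "W \<notin> range const_ratfun" "W = A \<odot> x" "W = B \<odot> y" and B: "rat_degree B = rat_degree x"
    and n: "rat_degree x \<ge> 2"
  shows "\<exists>u v. rat_map y = rat_map u \<circ> rat_map v \<and> deck_equivariant x v \<and> galois_covering u \<and>
          finite (generate aut_sphere (deck_group x \<union> deck_group u)) \<and>
          card (generate aut_sphere (deck_group x \<union> deck_group u)) = rat_degree x * rat_degree u \<and>
          deck_group x \<inter> deck_group u = {id}"
proof -
  obtain U V \<phi> where V: "V \<notin> range const_ratfun" and U: "U \<notin> range const_ratfun" "y = U \<odot> V"
    and \<phi>: "\<And>\<sigma>. \<sigma> \<in> deck x \<Longrightarrow> rat_degree (\<phi> \<sigma>) = 1 \<and> V \<odot> \<sigma> = \<phi> \<sigma> \<odot> V \<and> \<phi> \<sigma> \<in> deck (B \<odot> U)"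
    and cU: "card (deck U) = rat_degree U" and cR: "card (deck (B \<odot> U)) = rat_degree x * rat_degree U"
    using normal_closure[OF W B] by blast
  note \<phi>nc = degree_one_not_const[OF conjunct1[OF \<phi>]]
  have Bnc: "B \<notin> range const_ratfun" using W(1,3) ratcomp_const_left[OF _ y] by blast
  have Rnc: "B \<odot> U \<notin> range const_ratfun" by (rule ratcomp_not_const[OF U(1) Bnc])
  have \<phi>hom: "\<phi> (\<sigma> \<odot> \<tau>) = \<phi> \<sigma> \<odot> \<phi> \<tau>" if s: "\<sigma> \<in> deck x" and t: "\<tau> \<in> deck x" for \<sigma> \<tau>
  proof -
    have "\<phi> (\<sigma> \<odot> \<tau>) \<odot> V = V \<odot> (\<sigma> \<odot> \<tau>)" using \<phi>[OF deck_ratcomp[OF s t]] by simp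
    also have "\<dots> = V \<odot> \<sigma> \<odot> \<tau>" by (rule ratcomp_assoc[OF deck_nc[OF t] deck_nc[OF s], symmetric])
    also have "\<dots> = \<phi> \<sigma> \<odot> V \<odot> \<tau>" using \<phi>[OF s] by simp
    also have "\<dots> = \<phi> \<sigma> \<odot> (V \<odot> \<tau>)" by (rule ratcomp_assoc[OF deck_nc[OF t] V])
    also have "\<dots> = \<phi> \<sigma> \<odot> (\<phi> \<tau> \<odot> V)" using \<phi>[OF t] by simp
    also have "\<dots> = \<phi> \<sigma> \<odot> \<phi> \<tau> \<odot> V" by (rule ratcomp_assoc[OF V \<phi>nc[OF t], symmetric])
    finally show ?thesis using ratcomp_right_cancel[OF V] by blast
  qed
  \<comment> \<open>If U is invariant under \<phi>(\<sigma>), then \<sigma> fixes y and is trivial.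
    Both the injectivity of \<phi> and the trivial intersection rest on this.\<close>
  have U\<phi>: "\<sigma> = ratvar" if s: "\<sigma> \<in> deck x" "U \<odot> \<phi> \<sigma> = U" for \<sigma>
  proof -
    have "y \<odot> \<sigma> = U \<odot> (V \<odot> \<sigma>)" unfolding U(2) by (rule ratcomp_assoc[OF deck_nc[OF s(1)] V])
    also have "\<dots> = U \<odot> \<phi> \<sigma> \<odot> V"
      using \<phi>[OF s(1)] ratcomp_assoc[OF V \<phi>nc[OF s(1)], of U] by simp
    finally show ?thesis using deck_fixing_y[OF s(1)] s(2) U(2) by simp
  qed
  have \<phi>id: "\<phi> ratvar = ratvar"
    using \<phi>[OF ratvar_in_deck[of x]] ratcomp_right_cancel[OF V, of "\<phi> ratvar" ratvar] V by simp
  have \<phi>inj: "inj_on \<phi> (deck x)"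
  proof (rule inj_onI)
    fix \<sigma> \<tau> assume st: "\<sigma> \<in> deck x" "\<tau> \<in> deck x" "\<phi> \<sigma> = \<phi> \<tau>"
    obtain \<tau>' where t: "\<tau>' \<in> deck x" "\<tau> \<odot> \<tau>' = ratvar" "\<tau>' \<odot> \<tau> = ratvar"
      using deck_inverse[OF st(2)] by blast
    have "\<phi> (\<sigma> \<odot> \<tau>') = ratvar" using \<phi>hom[OF st(1) t(1)] \<phi>hom[OF st(2) t(1)] st(3) t(2) \<phi>id by simp
    then have "\<sigma> \<odot> \<tau>' = \<tau> \<odot> \<tau>'" using U\<phi>[OF deck_ratcomp[OF st(1) t(1)]] t(2) by simp
    then show "\<sigma> = \<tau>" using ratcomp_right_cancel[OF deck_nc[OF t(1)]] by blast
  qed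
  define G where "G = deck_group x"
  define H where "H = rat_map ` \<phi> ` deck x"
  have G: "mgroup G" unfolding G_def by (rule mgroup_deck_group[OF x(1)])
  have H: "mgroup H" unfolding H_def
  proof (rule mgroup_rat_map)
    show "finite (\<phi> ` deck x)" using finite_deck[OF x(1)] by simp
    show "ratvar \<in> \<phi> ` deck x" by (rule image_eqI[where x = ratvar]) (simp_all add: \<phi>id ratvar_in_deck)
  next
    fix m m' assume "m \<in> \<phi> ` deck x" "m' \<in> \<phi> ` deck x"
    then obtain \<sigma> \<tau> where st: "\<sigma> \<in> deck x" "m = \<phi> \<sigma>" "\<tau> \<in> deck x" "m' = \<phi> \<tau>" by blast
    then have "m \<odot> m' = \<phi> (\<sigma> \<odot> \<tau>)" using \<phi>hom by simp
    then show "m \<odot> m' \<in> \<phi> ` deck x" using deck_ratcomp[OF st(1,3)] by blast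
  next
    fix m assume "m \<in> \<phi> ` deck x"
    then obtain \<tau> where t: "\<tau> \<in> deck x" "m = \<phi> \<tau>" by blast
    obtain \<tau>' where t': "\<tau>' \<in> deck x" "\<tau> \<odot> \<tau>' = ratvar" "\<tau>' \<odot> \<tau> = ratvar" using deck_inverse[OF t(1)] by blast
    have "m \<odot> \<phi> \<tau>' = ratvar" "\<phi> \<tau>' \<odot> m = ratvar"
      using \<phi>hom[OF t(1) t'(1)] \<phi>hom[OF t'(1) t(1)] t' t(2) \<phi>id by simp_all
    then show "\<exists>m'\<in>\<phi> ` deck x. m \<odot> m' = ratvar \<and> m' \<odot> m = ratvar" using t'(1) by blast
  qed (use \<phi> in auto)
  define r where "r = inv_into (deck x) rat_map"
  have r: "r (rat_map \<sigma>) = \<sigma>" if "\<sigma> \<in> deck x" for \<sigma>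
    unfolding r_def by (rule inv_into_deck[OF that])
  \<comment> \<open>The homomorphism \<phi> transported from rational functions to maps of the
    sphere.\<close>
  define \<psi> where "\<psi> = (\<lambda>g. rat_map (\<phi> (r g)))"
  have \<psi>: "\<psi> (rat_map \<sigma>) = rat_map (\<phi> \<sigma>)" if "\<sigma> \<in> deck x" for \<sigma> by (simp add: \<psi>_def r[OF that])
  have Gim: "G = rat_map ` deck x" by (simp add: G_def rat_map_deck)
  have bij: "bij_betw \<psi> G H"
    unfolding bij_betw_def
  proof
    show "inj_on \<psi> G"
    proof (rule inj_onI)
      fix g g' assume "g \<in> G" "g' \<in> G" and eq: "\<psi> g = \<psi> g'"
      then obtain \<sigma> \<tau> where st: "\<sigma> \<in> deck x" "g = rat_map \<sigma>" "\<tau> \<in> deck x" "g' = rat_map \<tau>"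
        unfolding Gim by blast
      then have "\<phi> \<sigma> = \<phi> \<tau>" using eq \<psi> rat_map_inject by metis
      then show "g = g'" using inj_onD[OF \<phi>inj _ st(1,3)] st by blast
    qed
    show "\<psi> ` G = H" unfolding Gim H_def image_image using \<psi> by (intro image_cong) auto
  qed
  have hom: "\<psi> (f \<circ> g) = \<psi> f \<circ> \<psi> g" if fg: "f \<in> G" "g \<in> G" for f g
  proof -
    obtain \<sigma> \<tau> where st: "\<sigma> \<in> deck x" "f = rat_map \<sigma>" "\<tau> \<in> deck x" "g = rat_map \<tau>"
      using fg unfolding Gim by blast
    have "f \<circ> g = rat_map (\<sigma> \<odot> \<tau>)" using st rat_map_ratcomp[OF deck_nc[OF st(3)]] by simp
    then have "\<psi> (f \<circ> g) = rat_map (\<phi> \<sigma> \<odot> \<phi> \<tau>)"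
      using \<psi>[OF deck_ratcomp[OF st(1,3)]] \<phi>hom[OF st(1,3)] by simp
    also have "\<dots> = \<psi> f \<circ> \<psi> g" using st \<psi> rat_map_ratcomp[OF \<phi>nc[OF st(3)]] by simp
    finally show ?thesis .
  qed
  have cG: "card G = rat_degree x" unfolding G_def card_deck_group by (rule x(2))
  then obtain m where m: "m \<in> carrier aut_sphere" "cj m H = G"
    using isomorphic_mgroups_conjugate[OF G H _ bij hom] n by metis
  obtain \<mu> where \<mu>: "m = rat_map \<mu>" "rat_degree \<mu> = 1" using m(1) carrier_aut_sphere_eq by auto
  obtain \<mu>' where \<mu>': "rat_degree \<mu>' = 1" "\<mu> \<odot> \<mu>' = ratvar" "\<mu>' \<odot> \<mu> = ratvar" using aut_inverse[OF \<mu>(2)] by blast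
  note \<mu>nc = degree_one_not_const[OF \<mu>(2)] and \<mu>'nc = degree_one_not_const[OF \<mu>'(1)]
  have mi: "finv m = rat_map \<mu>'" unfolding \<mu>(1) by (rule finv_rat_map[OF \<mu>(2) \<mu>'(2,3,1)])
  \<comment> \<open>Inserting \<mu> between U and V leaves the composite y unchanged and replaces
    the image of \<phi> by its conjugate under m, which is the deck group of x.\<close>
  define u v where "u = U \<odot> \<mu>'" and "v = \<mu> \<odot> V"
  have vnc: "v \<notin> range const_ratfun" unfolding v_def by (rule ratcomp_not_const[OF V \<mu>nc])
  have "u \<odot> v = U \<odot> (\<mu>' \<odot> v)" unfolding u_def by (rule ratcomp_assoc[OF vnc \<mu>'nc])
  also have "\<mu>' \<odot> v = \<mu>' \<odot> \<mu> \<odot> V" unfolding v_def by (rule ratcomp_assoc[OF V \<mu>nc, symmetric])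
  finally have "u \<odot> v = y" using \<mu>' V U by simp
  then have fac: "rat_map y = rat_map u \<circ> rat_map v" using rat_map_ratcomp[OF vnc, of u] by simp
  have rv: "rat_map v = m \<circ> rat_map V" unfolding v_def \<mu>(1) by (rule rat_map_ratcomp[OF V])
  note ma = aut_inv_apply[OF m(1)]
  \<comment> \<open>The isomorphism \<psi> onto H followed by the conjugation of H onto G; the
    composite is an automorphism of G.\<close>
  define h where "h = (\<lambda>g. m \<circ> \<psi> g \<circ> finv m)"
  have equiv: "deck_equivariant x v"
    unfolding deck_equivariant_def G_def[symmetric]
  proof (intro bexI[of _ h] ballI)
    fix g assume "g \<in> G"
    then obtain \<sigma> where s: "\<sigma> \<in> deck x" "g = rat_map \<sigma>" unfolding Gim by blast
    have "rat_map V \<circ> g = rat_map (\<phi> \<sigma>) \<circ> rat_map V"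
      using \<phi>[OF s(1)] rat_map_ratcomp[OF deck_nc[OF s(1)], of V] rat_map_ratcomp[OF V, of "\<phi> \<sigma>"] s(2) by metis
    then have "rat_map V (g p) = rat_map (\<phi> \<sigma>) (rat_map V p)" for p by (metis comp_apply)
    then show "rat_map v \<circ> g = h g \<circ> rat_map v"
      by (simp add: fun_eq_iff rv h_def s(2) \<psi>[OF s(1)] ma(1))
  next
    have him: "h ` G = G"
    proof -
      have "h ` G = (\<lambda>f. m \<circ> f \<circ> finv m) ` \<psi> ` G" unfolding h_def image_image ..
      then show ?thesis using bij_betw_imp_surj_on[OF bij] m(2) unfolding cj_def by simp
    qed
    moreover have "inj_on h G"
    proof -
      have "inj_on ((\<lambda>f. m \<circ> f \<circ> finv m) \<circ> \<psi>) G"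
        by (rule comp_inj_on[OF bij_betw_imp_inj_on[OF bij] inj_on_cj[OF m(1)]])
      then show ?thesis by (simp add: h_def comp_def)
    qed
    moreover have "h (f \<circ> g) = h f \<circ> h g" if "f \<in> G" "g \<in> G" for f g
      using hom[OF that] by (simp add: h_def fun_eq_iff ma(1))
    ultimately show "h \<in> iso (aut_sphere\<lparr>carrier := G\<rparr>) (aut_sphere\<lparr>carrier := G\<rparr>)"
      by (auto simp: iso_def hom_def bij_betw_def aut_sphere_simps)
  qed
  have du: "deck_group u = cj m (deck_group U)"
    unfolding u_def \<mu>(1) by (rule deck_group_ratcomp_aut[OF \<mu>(2) \<mu>'])
  have unc: "u \<notin> range const_ratfun" unfolding u_def by (rule ratcomp_not_const[OF \<mu>'nc U(1)])
  have degu: "rat_degree u = rat_degree U" unfolding u_def using rat_degree_ratcomp[OF \<mu>'nc] \<mu>'(1) by simp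
  have cdu: "card (deck_group u) = rat_degree u"
    unfolding du card_cj[OF m(1)] card_deck_group degu by (rule cU)
  then have gal: "galois_covering u" using unc by (simp add: galois_covering_iff card_deck_group)
  \<comment> \<open>The deck group of B o U in the new coordinate, of order deg x deg u. It contains
    both groups, so their trivial intersection makes it the group they generate.\<close>
  define M where "M = cj m (deck_group (B \<odot> U))"
  have M: "mgroup M" unfolding M_def by (rule mgroup_cj[OF m(1) mgroup_deck_group[OF Rnc]])
  have cM: "card M = rat_degree x * rat_degree u"
    unfolding M_def card_cj[OF m(1)] card_deck_group degu by (rule cR)
  have GM: "G \<subseteq> M"
  proof -
    have "H \<subseteq> deck_group (B \<odot> U)" unfolding H_def rat_map_deck[symmetric] using \<phi> by blast
    then show ?thesis unfolding m(2)[symmetric] M_def cj_def by blast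
  qed
  have uM: "deck_group u \<subseteq> M"
  proof -
    have "deck_group U \<subseteq> deck_group (B \<odot> U)"
      unfolding rat_map_deck[symmetric] using deck_subset_ratcomp[OF U(1), of B] by blast
    then show ?thesis unfolding du M_def cj_def by blast
  qed
  have disj: "G \<inter> deck_group u = {id}"
  proof
    show "{id} \<subseteq> G \<inter> deck_group u"
      using mgroupD(3)[OF G] mgroupD(3)[OF mgroup_deck_group[OF unc]] by blast
    show "G \<inter> deck_group u \<subseteq> {id}"
    proof
      fix f assume "f \<in> G \<inter> deck_group u"
      then obtain p q where pq: "p \<in> H" "f = m \<circ> p \<circ> finv m" "q \<in> deck_group U" "f = m \<circ> q \<circ> finv m"
        unfolding m(2)[symmetric] du cj_def by blast
      then have "p = q" using inj_onD[OF inj_on_cj[OF m(1), of UNIV]] by blast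
      then obtain \<sigma> where s: "\<sigma> \<in> deck x" "p = rat_map (\<phi> \<sigma>)" "p \<in> deck_group U"
        using pq unfolding H_def by blast
      then have "rat_map (U \<odot> \<phi> \<sigma>) = rat_map U"
        using rat_map_ratcomp[OF \<phi>nc[OF s(1)], of U] by (simp add: deck_group_def)
      then have "\<sigma> = ratvar" using U\<phi>[OF s(1)] rat_map_inject by blast
      then have "p = id" using s(2) \<phi>id rat_map_ratvar by simp
      then show "f \<in> {id}" using pq(2) aut_inv(3)[OF m(1)] by simp
    qed
  qed
  have gen: "generate aut_sphere (G \<union> deck_group u) = M"
    by (rule generate_product_set[OF G GM mgroup_deck_group[OF unc] uM M disj]) (simp add: cM cG cdu)
  show ?thesis
    using fac equiv gal disj gen cM mgroupD(1)[OF M] unfolding G_def by (intro exI[of _ u] exI[of _ v]) simp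
qed

end

section \<open>Quotients by finite groups\<close>

lemma map_poly_ratcomp_prod:
  assumes "\<delta> \<notin> range const_ratfun"
  shows "map_poly (\<lambda>F. F \<odot> \<delta>) (\<Prod>e\<in>E. [:- e, 1:]) = (\<Prod>e\<in>E. [:- (e \<odot> \<delta>), 1:])"
proof -
  have mult: "map_poly (\<lambda>F. F \<odot> \<delta>) (p * q) = map_poly (\<lambda>F. F \<odot> \<delta>) p * map_poly (\<lambda>F. F \<odot> \<delta>) q" for p q
  proof (rule poly_eqI)
    fix n
    have "(\<Sum>i\<in>A. f i) \<odot> \<delta> = (\<Sum>i\<in>A. f i \<odot> \<delta>)" for f and A :: "nat set"
      by (induction A rule: infinite_finite_induct) (simp_all add: assms)
    then show "coeff (map_poly (\<lambda>F. F \<odot> \<delta>) (p * q)) n =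
        coeff (map_poly (\<lambda>F. F \<odot> \<delta>) p * map_poly (\<lambda>F. F \<odot> \<delta>) q) n"
      using assms by (simp add: coeff_map_poly coeff_mult)
  qed
  show ?thesis
    by (induction E rule: infinite_finite_induct) (simp_all add: mult map_poly_pCons assms del: mult_pCons_left)
qed

text \<open>The product of T - e over the group has invariant coefficients and the root z, so z has
  degree at most |G| over the fixed field, and its Lueroth generator has degree at most |G|.
  Conversely G consists of deck transformations of that generator.\<close>

lemma mgroup_quotient:
  assumes G: "mgroup G"
  obtains T where "T \<notin> range const_ratfun" "rat_degree T = card G"
    "\<And>e. rat_degree e = 1 \<Longrightarrow> rat_map e \<in> G \<Longrightarrow> T \<odot> e = T"
proof -
  define E where "E = {e. rat_degree e = 1 \<and> rat_map e \<in> G}"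
  have im: "rat_map ` E = G"
    unfolding E_def using mgroupD(2)[OF G] carrier_aut_sphere_eq by auto
  have cE: "card E = card G" unfolding im[symmetric] by (rule card_image[OF inj_on_rat_map, symmetric])
  have finE: "finite E" using mgroupD(1)[OF G] im finite_imageD[OF _ inj_on_rat_map] by metis
  have nc: "e \<notin> range const_ratfun" if "e \<in> E" for e using that degree_one_not_const by (simp add: E_def)
  have one: "ratvar \<in> E" using mgroupD(3)[OF G] by (simp add: E_def rat_map_ratvar)
  define K where "K = {F. \<forall>e\<in>E. F \<odot> e = F}"
  have K: "const_subfield K"
    using const_subfield_fixed nc unfolding K_def const_subfield_def by blast
  define p where "p = (\<Prod>e\<in>E. [:- e, 1:])"
  have "coeff p i \<odot> d = coeff p i" if d: "d \<in> E" for i d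
  proof -
    have "e \<odot> d \<in> E" if "e \<in> E" for e
      using that d degree_one_ratcomp mgroupD(4)[OF G] by (auto simp: E_def rat_map_ratcomp[OF nc[OF d]])
    moreover have "inj_on (\<lambda>e. e \<odot> d) E" using ratcomp_right_cancel[OF nc[OF d]] by (simp add: inj_on_def)
    ultimately have "bij_betw (\<lambda>e. e \<odot> d) E E"
      using endo_inj_surj[OF finE, of "\<lambda>e. e \<odot> d"] by (auto simp: bij_betw_def)
    then have "(\<Prod>e\<in>E. [:- (e \<odot> d), 1:]) = p" unfolding p_def by (rule prod.reindex_bij_betw)
    then have "map_poly (\<lambda>F. F \<odot> d) p = p" using map_poly_ratcomp_prod[OF nc[OF d], of E] by (simp add: p_def)
    then have "coeff (map_poly (\<lambda>F. F \<odot> d) p) i = coeff p i" by simp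
    then show ?thesis using nc[OF d] by (simp add: coeff_map_poly)
  qed
  then have pK: "coeffs_in K p" by (simp add: coeffs_in_def K_def)
  have p0: "p \<noteq> 0" using finE by (simp add: p_def)
  have pr: "poly p ratvar = 0" unfolding p_def poly_prod using finE one by (intro prod_zero) auto
  have dp: "degree p = card G"
    unfolding p_def cE[symmetric] by (subst degree_prod_eq_sum_degree) auto
  have "K \<noteq> range const_ratfun" using const_poly_ratvar_nonzero[of p] pK p0 pr by auto
  then obtain T where T: "T \<notin> range const_ratfun" "K = range (\<lambda>F. F \<odot> T)" using lueroth[OF K] by blast
  have "T = ratvar \<odot> T" using T(1) by simp
  then have "T \<in> K" using T(2) by blast
  then have inv: "T \<odot> e = T" if "e \<in> E" for e using that by (simp add: K_def)
  have "rat_degree T \<le> card G"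
    using poly_ratvar_nonzero[OF T(1), of p] pK p0 pr dp T(2) by (metis not_le)
  moreover have "E \<subseteq> deck T" using inv by (auto simp: deck_def E_def)
  then have "card G \<le> rat_degree T"
    using card_mono[OF finite_deck[OF T(1)]] card_deck_le[OF T(1)] cE by (metis order_trans)
  ultimately show thesis using that[OF T(1)] inv by (simp add: E_def)
qed

context generating_pair
begin

text \<open>The quotient map T has degree deg x deg u, so B in T = B o u has degree deg x. For W = T
  o v, equivariance gives W o \<sigma> = T o h(\<sigma>) o v with h(\<sigma>) again in the deck
  group of x, under which T is invariant.\<close>

lemma factorization_only_if:
  assumes fac: "rat_map y = rat_map u \<circ> rat_map v" and eqv: "deck_equivariant x v" and gal: "galois_covering u"
    and fin: "finite (generate aut_sphere (deck_group x \<union> deck_group u))"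
    and card: "card (generate aut_sphere (deck_group x \<union> deck_group u)) = rat_degree x * rat_degree u"
  shows "\<exists>W A B. W \<notin> range const_ratfun \<and> W = A \<odot> x \<and> W = B \<odot> y \<and> rat_degree B = rat_degree x"
proof -
  have v: "v \<notin> range const_ratfun"
  proof
    assume "v \<in> range const_ratfun"
    then obtain c where "v = const_ratfun c" by blast
    then have "rat_map y (Fin z) = rat_map u (Fin c)" for z
      using fun_cong[OF fac, of "Fin z"] by (simp add: rat_map_const del: rat_map.simps)
    then have "{z. rat_map y (Fin z) = rat_map u (Fin c)} = UNIV" by blast
    then show False using finite_fibre[OF y, of "rat_map u (Fin c)"] infinite_UNIV_char_0 by metis
  qed
  have yuv: "y = u \<odot> v" using fac rat_map_ratcomp[OF v, of u] rat_map_inject by metis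
  have u: "u \<notin> range const_ratfun" "card (deck u) = rat_degree u" using gal galois_covering_iff by auto
  define M where "M = generate aut_sphere (deck_group x \<union> deck_group u)"
  have M: "mgroup M" unfolding M_def
    by (rule mgroup_generate[OF _ fin]) (auto simp: deck_group_def)
  obtain T where T: "T \<notin> range const_ratfun" "rat_degree T = card M"
    "\<And>e. rat_degree e = 1 \<Longrightarrow> rat_map e \<in> M \<Longrightarrow> T \<odot> e = T" using mgroup_quotient[OF M] by blast
  have Tdeck: "T \<odot> m = T" if "m \<in> deck x \<or> m \<in> deck u" for m
  proof (rule T(3))
    show "rat_degree m = 1" using that by (auto simp: deck_def)
    have "rat_map m \<in> deck_group x \<union> deck_group u" using that rat_map_deck by blast
    then show "rat_map m \<in> M" unfolding M_def by (rule generate.incl)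
  qed
  then obtain B where B: "T = B \<odot> u" using deck_fixed_field[OF u] by blast
  have "rat_degree B * rat_degree u = rat_degree x * rat_degree u"
    using rat_degree_ratcomp[OF u(1), of B] T(2) card by (simp add: B M_def)
  moreover have "rat_degree u > 0" using u(1) rat_degree_eq_0_iff by blast
  ultimately have dB: "rat_degree B = rat_degree x" by simp
  define W where "W = T \<odot> v"
  have WB: "W = B \<odot> y" unfolding W_def B yuv by (rule ratcomp_assoc[OF v u(1)])
  have Wnc: "W \<notin> range const_ratfun" unfolding W_def by (rule ratcomp_not_const[OF v T(1)])
  obtain h where h: "h \<in> iso (aut_sphere\<lparr>carrier := deck_group x\<rparr>) (aut_sphere\<lparr>carrier := deck_group x\<rparr>)"
    "\<And>\<sigma>. \<sigma> \<in> deck_group x \<Longrightarrow> rat_map v \<circ> \<sigma> = h \<sigma> \<circ> rat_map v" using eqv unfolding deck_equivariant_def by blast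
  have "W \<odot> \<sigma> = W" if s: "\<sigma> \<in> deck x" for \<sigma>
  proof -
    have sg: "rat_map \<sigma> \<in> deck_group x" using s rat_map_deck by blast
    then have "h (rat_map \<sigma>) \<in> deck_group x" using h(1) by (auto simp: iso_def hom_def)
    then obtain e where e: "e \<in> deck x" "h (rat_map \<sigma>) = rat_map e" unfolding rat_map_deck[symmetric] by blast
    have "rat_map (v \<odot> \<sigma>) = rat_map (e \<odot> v)"
      using h(2)[OF sg] e(2) rat_map_ratcomp[OF deck_nc[OF s], of v] rat_map_ratcomp[OF v, of e] by simp
    then have ve: "v \<odot> \<sigma> = e \<odot> v" by (simp only: rat_map_inject)
    have "W \<odot> \<sigma> = T \<odot> (v \<odot> \<sigma>)" unfolding W_def by (rule ratcomp_assoc[OF deck_nc[OF s] v])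
    also have "\<dots> = T \<odot> e \<odot> v" unfolding ve by (rule ratcomp_assoc[OF v deck_nc[OF e(1)], symmetric])
    also have "\<dots> = W" using Tdeck[of e] e(1) by (simp add: W_def)
    finally show ?thesis .
  qed
  then obtain A where "W = A \<odot> x" using deck_fixed_field[OF x] by blast
  then show ?thesis using Wnc WB dB by blast
qed

end

theorem theorem1p1:
  fixes x y :: ratfun
  assumes "rat_degree x \<ge> 2" and "rat_degree y \<ge> 2"
    and "adjoin {x, y} = carrier ratfun_field"
    and "galois_covering x"
  shows "ring.dimension ratfun_field (rat_degree x * rat_degree y)
           (adjoin {x} \<inter> adjoin {y}) (carrier ratfun_field)
    \<longleftrightarrow> (\<exists>u v :: ratfun. rat_map y = rat_map u \<circ> rat_map v \<and>
          deck_equivariant x v \<and> galois_covering u \<and>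
          finite (generate aut_sphere (deck_group x \<union> deck_group u)) \<and>
          card (generate aut_sphere (deck_group x \<union> deck_group u)) = rat_degree x * rat_degree u \<and>
          deck_group x \<inter> deck_group u = {id})"
proof -
  interpret generating_pair x y
  proof
    show "x \<notin> range const_ratfun" "card (deck x) = rat_degree x"
      using assms(4) galois_covering_iff by auto
    show "y \<notin> range const_ratfun" using assms(2) rat_degree_eq_0_iff[of y] by auto
    show "adjoin {x, y} = UNIV" using assms(3) by simp
  qed
  show ?thesis
    unfolding dimension_meet_iff
  proof (intro iffI; elim exE conjE)
    fix W A B assume "W \<notin> range const_ratfun" "W = A \<odot> x" "W = B \<odot> y" "rat_degree B = rat_degree x"
    then show "\<exists>u v. rat_map y = rat_map u \<circ> rat_map v \<and> deck_equivariant x v \<and> galois_covering u \<and>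
        finite (generate aut_sphere (deck_group x \<union> deck_group u)) \<and>
        card (generate aut_sphere (deck_group x \<union> deck_group u)) = rat_degree x * rat_degree u \<and>
        deck_group x \<inter> deck_group u = {id}"
      by (rule factorization_if[OF _ _ _ _ assms(1)])
  qed (rule factorization_only_if)
qed

end
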